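(* Let $m\ge2$ and for $\vec t=(t_1,\dots,t_m)\in\mathbb R^m$ write $V_{\vec t}(x)=\frac{x^2}2+\sum_{j=1}^m t_jx^j$. Suppose $V_{\vec t}\in P_m^{(1)}$. Then there exists a continuous path $\tau\mapsto\vec t(\tau)$, $[0,1]\to\mathbb R^m$, with $\vec t(0)=0$ (so $V_{\vec t(0)}(x)=x^2/2$), $\vec t(1)=\vec t$, and $V_{\vec t(\tau)}\in P_m^{(1)}$ for all $\tau\in[0,1]$.
   Context: $P_m$ is the set of real polynomials of even degree $\le m$ with positive leading coefficient and $V(0)=0$. For $V\in P_m$, $\mu_V$ is the unique Borel probability measure on $\mathbb R$ minimizing $\iint\log|x-y|^{-1}d\mu(x)d\mu(y)+\int Vd\mu$; it satisfies $2\int\log|x-y|d\mu_V(y)-V(x)=\ell_V$ on $\operatorname{supp}\mu_V$ and $\le \ell_V$ on $\mathbb R$ for a constant $\ell_V$. $V$ is $k$-cut regular if $\operatorname{supp}\mu_V$ is a union of exactly $k$ disjoint compact intervals $\cup_j[\alpha_j,\beta_j]$, the density of $\mu_V$ equals $\frac1c\sqrt{|\prod_j(x-\alpha_j)(x-\beta_j)|}\,|h(x)|$ with $h$ a polynomial without zeros on $\operatorname{supp}\mu_V$, and the inequality is strict on $\mathbb R\setminus\operatorname{supp}\mu_V$. $P_m^{(k)}\subset P_m$ denotes the $k$-cut regular elements. *)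

theory Defs
  imports "HOL-Probability.Probability" "HOL-Computational_Algebra.Polynomial"
begin

text \<open>Combined logarithmic-energy kernel:
  log(1/|x-y|) + (V x + V y)/2, equal to +infinity on the diagonal.
  Integrating it against mu x mu gives
  \<open>\<integral>\<integral> log|x-y|^{-1} d\<mu> d\<mu> + \<integral> V d\<mu>\<close> for a probability measure.\<close>
definition log_kernel :: "real poly \<Rightarrow> real \<Rightarrow> real \<Rightarrow> ereal" where
  "log_kernel V x y =
     (if x = y then \<infinity> else ereal (ln (1 / \<bar>x - y\<bar>) + (poly V x + poly V y) / 2))"

definition energy :: "real poly \<Rightarrow> real measure \<Rightarrow> ereal" where
  "energy V \<mu> =
     enn2ereal (\<integral>\<^sup>+ z. e2ennreal (log_kernel V (fst z) (snd z)) \<partial>(\<mu> \<Otimes>\<^sub>M \<mu>))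
   - enn2ereal (\<integral>\<^sup>+ z. e2ennreal (- log_kernel V (fst z) (snd z)) \<partial>(\<mu> \<Otimes>\<^sub>M \<mu>))"

definition borel_prob :: "real measure \<Rightarrow> bool" where
  "borel_prob \<mu> \<longleftrightarrow> prob_space \<mu> \<and> sets \<mu> = sets (borel :: real measure)"

definition is_energy_minimizer :: "real poly \<Rightarrow> real measure \<Rightarrow> bool" where
  "is_energy_minimizer V \<mu> \<longleftrightarrow>
     borel_prob \<mu> \<and> energy V \<mu> < \<infinity> \<and> (\<forall>\<nu>. borel_prob \<nu> \<longrightarrow> energy V \<mu> \<le> energy V \<nu>)"

definition equilibrium_measure :: "real poly \<Rightarrow> real measure" where
  "equilibrium_measure V = (THE \<mu>. is_energy_minimizer V \<mu>)"

definition measure_support :: "real measure \<Rightarrow> real set" where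
  "measure_support \<mu> = {x. \<forall>e>0. emeasure \<mu> (ball x e) > 0}"

definition P_set :: "nat \<Rightarrow> real poly set" where
  "P_set m = {V. even (degree V) \<and> degree V \<le> m \<and> lead_coeff V > 0 \<and> poly V 0 = 0}"

definition cut_regular :: "nat \<Rightarrow> real poly \<Rightarrow> bool" where
  "cut_regular k V \<longleftrightarrow>
    (let \<mu> = equilibrium_measure V; S = measure_support \<mu> in
     \<exists>(\<alpha>::nat \<Rightarrow> real) (\<beta>::nat \<Rightarrow> real) (c::real) (h::real poly) (lv::real).
       (\<forall>j<k. \<alpha> j < \<beta> j) \<and>
       disjoint_family_on (\<lambda>j. {\<alpha> j..\<beta> j}) {..<k} \<and>
       S = (\<Union>j<k. {\<alpha> j..\<beta> j}) \<and>
       c > 0 \<and> (\<forall>x\<in>S. poly h x \<noteq> 0) \<and>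
       \<mu> = density lborel (\<lambda>x. ennreal (indicator S x * (1 / c) *
               sqrt \<bar>\<Prod>j<k. (x - \<alpha> j) * (x - \<beta> j)\<bar> * \<bar>poly h x\<bar>)) \<and>
       (\<forall>x\<in>S. 2 * (\<integral>y. ln \<bar>x - y\<bar> \<partial>\<mu>) - poly V x = lv) \<and>
       (\<forall>x. x \<notin> S \<longrightarrow> 2 * (\<integral>y. ln \<bar>x - y\<bar> \<partial>\<mu>) - poly V x < lv))"

definition P_reg :: "nat \<Rightarrow> nat \<Rightarrow> real poly set" where
  "P_reg m k = {V \<in> P_set m. cut_regular k V}"

definition V_t :: "nat \<Rightarrow> (nat \<Rightarrow> real) \<Rightarrow> real poly" where
  "V_t m t = [:0, 0, 1/2:] + (\<Sum>j=1..m. monom (t j) j)"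

end

theory Submission
  imports Defs
begin

text \<open>
  Up to an affine change of variables the support of \<open>\<mu>\<^sub>V\<close> is \<open>[-2, 2]\<close>, which is also the support of
  the semicircle law, the equilibrium measure of \<open>x\<^sup>2/2\<close>. For potentials with a common support
  the Euler--Lagrange conditions are affine in the pair (potential, measure), so a convex combination
  of one-cut regular potentials with the same support is again one-cut regular. The path interpolates
  linearly between \<open>x\<^sup>2/2\<close> and the rescaled \<open>V\<close> while moving the support from \<open>[-2, 2]\<close> to that of \<open>V\<close>.

  What makes this rigorous is that the Euler--Lagrange conditions characterise the minimizer. This
  rests on positive definiteness of the logarithmic kernel on measures of total mass zero, seen from
  \<open>-log|x-y| = \<integral>\<^sub>0\<^sup>\<infinity> (exp(-s(x-y)\<^sup>2) - exp(-s)) ds/(2s)\<close>, a superposition of Gaussian kernels up to constants.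
\<close>

section \<open>A Gaussian representation of the logarithm\<close>

text \<open>On the straight segment from \<open>x^2/2\<close> to \<open>V\<close> the support moves,
  and the Euler-Lagrange conditions at the two ends say nothing about a mixture of potentials whose
  equality sets differ. This is why the affine change of variables is varied separately from the
  mixing. Only polynomial coefficients then have to depend continuously on the parameter; continuity
  of equilibrium measures is never at stake.

  A single equilibrium measure is computed explicitly, the semicircle law. For \<open>V\<close>
  itself the density, the equality and the strict inequality are read off from regularity.
  Uniqueness serves the opposite direction: it identifies the measure built for a point of the path
  with the equilibrium measure of that potential.\<close>

lemma nn_integral_frullani:
  fixes a b :: real
  assumes "0 < a" "a \<le> b"
  shows "(\<integral>\<^sup>+s. ennreal (indicator {0<..} s * ((exp (-(a * s)) - exp (-(b * s))) / s)) \<partial>lborel) = ennreal (ln b - ln a)"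
proof -
  \<comment> \<open>The quotient is the integral of \<open>exp (-(u * s))\<close> over
    \<open>u\<close> in \<open>[a, b]\<close>; Tonelli then leaves the integral of
    \<open>1 / u\<close>.\<close>
  have "(\<integral>\<^sup>+s. ennreal (indicator {0<..} s * ((exp (-(a * s)) - exp (-(b * s))) / s)) \<partial>lborel)
     = (\<integral>\<^sup>+s. (\<integral>\<^sup>+u. ennreal (indicator {0<..} s * (indicator {a..b} u * exp (-(u * s)))) \<partial>lborel) \<partial>lborel)"
  proof (rule nn_integral_cong)
    fix s :: real
    show "ennreal (indicator {0<..} s * ((exp (-(a * s)) - exp (-(b * s))) / s)) =
      (\<integral>\<^sup>+u. ennreal (indicator {0<..} s * (indicator {a..b} u * exp (-(u * s)))) \<partial>lborel)"
    proof (cases "s > 0")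
      case True
      have "(\<integral>\<^sup>+u. ennreal (exp (-(u * s))) * indicator {a..b} u \<partial>lborel)
         = ennreal (- exp (-(b * s)) / s - - exp (-(a * s)) / s)"
        using True assms
        by (intro nn_integral_FTC_Icc) (auto intro!: derivative_eq_intros)
      then show ?thesis using True
        by (simp add: indicator_mult_ennreal mult.commute diff_divide_distrib)
    qed simp
  qed
  also have "\<dots> = (\<integral>\<^sup>+u. (\<integral>\<^sup>+s. ennreal (indicator {0<..} s * (indicator {a..b} u * exp (-(u * s)))) \<partial>lborel) \<partial>lborel)"
    by (rule lborel_pair.Fubini') measurable
  also have "\<dots> = (\<integral>\<^sup>+u. ennreal (1 / u) * indicator {a..b} u \<partial>lborel)"
  proof (rule nn_integral_cong)
    fix u :: real
    show "(\<integral>\<^sup>+s. ennreal (indicator {0<..} s * (indicator {a..b} u * exp (-(u * s)))) \<partial>lborel)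
      = ennreal (1 / u) * indicator {a..b} u"
    proof (cases "u \<in> {a..b}")
      case True
      then have u: "u > 0" using assms by auto
      have "(\<integral>\<^sup>+s. ennreal (indicator {0<..} s * (indicator {a..b} u * exp (-(u * s)))) \<partial>lborel)
        = (\<integral>\<^sup>+s. ennreal (exp (-(u * s))) * indicator {0..} s \<partial>lborel)"
        using True by (intro nn_integral_cong_AE, use AE_lborel_singleton[of 0] in eventually_elim)
          (auto simp: indicator_def)
      also have "\<dots> = ennreal (0 - - exp (-(u*0)) / u)"
      proof (rule nn_integral_FTC_atLeast)
        show "((\<lambda>s. - exp (-(u * s)) / u) \<longlongrightarrow> 0) at_top"
        proof -
          have "((\<lambda>s. exp (-(u * s))) \<longlongrightarrow> 0) at_top"
            by (intro filterlim_compose[OF exp_at_bot] filterlim_compose[OF filterlim_uminus_at_bot_at_top]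
                filterlim_tendsto_pos_mult_at_top[OF tendsto_const u] filterlim_ident)
          then have "((\<lambda>s. - exp (-(u * s)) / u) \<longlongrightarrow> - 0 / u) at_top"
            using u by (intro tendsto_intros) auto
          then show ?thesis by simp
        qed
      qed (use u in \<open>auto intro!: derivative_eq_intros\<close>)
      finally show ?thesis using True by simp
    qed simp
  qed
  also have "\<dots> = ennreal (ln b - ln a)"
    using assms by (intro nn_integral_FTC_Icc) (auto intro!: derivative_eq_intros simp: divide_inverse)
  finally show ?thesis .
qed

text \<open>A signed version is needed because \<open>(x - y)^2\<close> may lie on either side of
  \<open>1 + 2 * x^2\<close>. Exchanging \<open>a\<close> and \<open>b\<close> only flips the
  sign.\<close>

lemma has_bochner_integral_frullani:
  fixes a b :: real
  assumes "0 < a" "0 < b"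
  shows "has_bochner_integral lborel (\<lambda>s. indicator {0<..} s * ((exp (-(a * s)) - exp (-(b * s))) / s)) (ln b - ln a)"
proof -
  have *: "has_bochner_integral lborel (\<lambda>s. indicator {0<..} s * ((exp (-(a * s)) - exp (-(b * s))) / s)) (ln b - ln a)"
    if "0 < a" "a \<le> b" for a b :: real
    using that by (intro has_bochner_integral_nn_integral nn_integral_frullani AE_I2)
      (auto simp: indicator_def)
  show ?thesis
  proof (cases "a \<le> b")
    case False
    then show ?thesis
      using has_bochner_integral_minus[OF *[of b a]] assms
      by (simp add: algebra_simps diff_divide_distrib)
  qed (use * assms in auto)
qed

text \<open>The functions of \<open>x\<close> alone and of \<open>y\<close> alone that are subtracted cancel in energies of measures of
  total mass zero; they make the kernel nonnegative, so that all energies live in \<^typ>\<open>ennreal\<close> and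
  Tonelli applies without integrability conditions.\<close>

definition gauss_kernel :: "real \<Rightarrow> real \<Rightarrow> real \<Rightarrow> real" where
  "gauss_kernel s x y = exp (-(s * (x - y)\<^sup>2)) + exp (-s) - exp (-(s * (1 + 2 * x\<^sup>2))) - exp (-(s * (1 + 2 * y\<^sup>2)))"

definition level_kernel :: "real \<Rightarrow> real \<Rightarrow> real \<Rightarrow> real" where
  "level_kernel s x y = indicator {0<..} s * (gauss_kernel s x y / (2 * s))"

definition reg_kernel :: "real \<Rightarrow> real \<Rightarrow> ennreal" where
  "reg_kernel x y = (\<integral>\<^sup>+s. ennreal (level_kernel s x y) \<partial>lborel)"

definition reg_log :: "real \<Rightarrow> real \<Rightarrow> real" where
  "reg_log x y = - ln \<bar>x - y\<bar> + ln (1 + 2 * x\<^sup>2) / 2 + ln (1 + 2 * y\<^sup>2) / 2"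

lemma gauss_kernel_commute: "gauss_kernel s x y = gauss_kernel s y x"
  by (simp add: gauss_kernel_def power2_commute)

text \<open>Explains the exponents \<open>1 + 2 * x^2\<close>: since
  \<open>(x - y)^2 \<le> 2 * x^2 + 2 * y^2\<close>, the kernel is at least \<open>exp (-s) * (1 -
  exp (-2 * s * x^2)) * (1 - exp (-2 * s * y^2))\<close>, whose expansion produces exactly the two
  subtracted terms.\<close>

lemma gauss_kernel_nonneg:
  assumes "s \<ge> 0" shows "0 \<le> gauss_kernel s x y"
proof -
  have a: "exp (-(s * (x - y)\<^sup>2)) \<ge> exp (-(s * (2 * x\<^sup>2 + 2 * y\<^sup>2)))"
    using assms by (auto intro!: mult_left_mono)
      (use zero_le_power2[of "x+y"] in \<open>simp add: power2_eq_square algebra_simps\<close>)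
  have b: "exp (-(s * (2 * x\<^sup>2 + 2 * y\<^sup>2))) \<ge> exp (-s) * exp (-(s * (2 * x\<^sup>2 + 2 * y\<^sup>2)))"
    using assms by simp
  have "0 \<le> exp (-s) * ((1 - exp (-(s * (2 * x\<^sup>2)))) * (1 - exp (-(s * (2 * y\<^sup>2)))))"
    using assms by simp
  also have "\<dots> = exp (-s) + exp (-s) * exp (-(s * (2 * x\<^sup>2 + 2 * y\<^sup>2)))
      - exp (-(s * (1 + 2 * x\<^sup>2))) - exp (-(s * (1 + 2 * y\<^sup>2)))"
    by (simp add: algebra_simps flip: exp_add)
  finally show ?thesis using a b unfolding gauss_kernel_def by linarith
qed

lemma level_kernel_nonneg [simp]: "0 \<le> level_kernel s x y"
  by (auto simp: level_kernel_def indicator_def gauss_kernel_nonneg)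

lemma level_kernel_measurable [measurable (raw)]:
  assumes [measurable]: "f \<in> borel_measurable M" "g \<in> borel_measurable M" "h \<in> borel_measurable M"
  shows "(\<lambda>x. level_kernel (f x) (g x) (h x)) \<in> borel_measurable M"
  unfolding level_kernel_def gauss_kernel_def by measurable

lemma reg_kernel_commute: "reg_kernel x y = reg_kernel y x"
  by (simp add: reg_kernel_def level_kernel_def gauss_kernel_commute)

lemma reg_kernel_measurable [measurable]: "(\<lambda>(x, y). reg_kernel x y) \<in> borel_measurable (borel \<Otimes>\<^sub>M borel)"
  unfolding reg_kernel_def case_prod_beta by measurable

text \<open>Half the sum of two Frullani integrals, pairing \<open>(x - y)^2\<close> with
  \<open>1 + 2 * x^2\<close> and \<open>1\<close> with \<open>1 + 2 * y^2\<close>, so that each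
  difference vanishes at \<open>s = 0\<close>.\<close>

lemma reg_kernel_eq:
  assumes "x \<noteq> y" shows "reg_kernel x y = ennreal (reg_log x y)" "0 \<le> reg_log x y"
proof -
  have p: "(0::real) < 1 + 2 * z\<^sup>2" for z :: real
    by (simp add: add_pos_nonneg)
  have xy: "(x - y)\<^sup>2 > 0" using assms by simp
  have "has_bochner_integral lborel (\<lambda>s. (1/2) * (indicator {0<..} s * ((exp (-((x-y)\<^sup>2 * s)) - exp (-((1+2*x\<^sup>2) * s))) / s)
     + indicator {0<..} s * ((exp (-(1 * s)) - exp (-((1+2*y\<^sup>2) * s))) / s))) ((1/2) * ((ln (1+2*x\<^sup>2) - ln ((x-y)\<^sup>2)) + (ln (1+2*y\<^sup>2) - ln 1)))"
    by (intro has_bochner_integral_mult_right has_bochner_integral_add has_bochner_integral_frullani p xy) auto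
  also have "((1/2) * ((ln (1+2*x\<^sup>2) - ln ((x-y)\<^sup>2)) + (ln (1+2*y\<^sup>2) - ln 1))) = reg_log x y"
  proof -
    have "ln ((x-y)\<^sup>2) = 2 * ln \<bar>x - y\<bar>"
      using assms ln_realpow[of "\<bar>x - y\<bar>" 2] by simp
    then show ?thesis by (simp add: reg_log_def field_simps)
  qed
  also have "(\<lambda>s. (1/2) * (indicator {0<..} s * ((exp (-((x-y)\<^sup>2 * s)) - exp (-((1+2*x\<^sup>2) * s))) / s)
     + indicator {0<..} s * ((exp (-(1 * s)) - exp (-((1+2*y\<^sup>2) * s))) / s))) = (\<lambda>s. level_kernel s x y)"
    by (auto simp: level_kernel_def gauss_kernel_def indicator_def field_simps)
  finally have h: "has_bochner_integral lborel (\<lambda>s. level_kernel s x y) (reg_log x y)" .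
  show "reg_kernel x y = ennreal (reg_log x y)"
    unfolding reg_kernel_def using h by (subst nn_integral_eq_integral) (auto simp: has_bochner_integral_iff)
  show "0 \<le> reg_log x y"
    using h integral_nonneg_AE[of "\<lambda>s. level_kernel s x y" lborel] by (auto simp: has_bochner_integral_iff)
qed

text \<open>Needed for agreement with \<open>log_kernel\<close> on the diagonal. There the Gaussian
  is the constant 1, which is not integrable against \<open>1 / s\<close> at infinity.\<close>

lemma reg_kernel_diag: "reg_kernel x x = \<infinity>"
proof -
  have p: "(0::real) < 1 + 2 * x\<^sup>2"
    by (simp add: add_pos_nonneg)
  have reg_kernel_ge: "ennreal (real n) \<le> reg_kernel x x" for n
  proof -
    \<comment> \<open>Replacing that constant by \<open>exp (-(exp (-(2*real n)) * s))\<close> gives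
      a smaller function to which Frullani applies; the rate is chosen so that half of minus its
      logarithm is \<open>n\<close>.\<close>
    let ?g = "\<lambda>s. (1/2) * (indicator {0<..} s * ((exp (-(exp (-(2*real n)) * s)) - exp (-((1+2*x\<^sup>2) * s))) / s)
     + indicator {0<..} s * ((exp (-(1 * s)) - exp (-((1+2*x\<^sup>2) * s))) / s))"
    have h: "has_bochner_integral lborel ?g
      ((1/2) * ((ln (1+2*x\<^sup>2) - ln (exp (-(2*real n)))) + (ln (1+2*x\<^sup>2) - ln 1)))"
      by (intro has_bochner_integral_mult_right has_bochner_integral_add has_bochner_integral_frullani p) auto
    have le: "?g s \<le> level_kernel s x x" for s
    proof (cases "s > 0")
      case True
      have "exp (-(exp (-(2*real n)) * s)) \<le> 1" using True by simp
      then show ?thesis using True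
        by (simp add: level_kernel_def gauss_kernel_def field_simps)
    qed (simp add: level_kernel_def)
    have "ennreal (real n) \<le> ennreal (integral\<^sup>L lborel ?g)"
      using h p by (intro ennreal_leI) (auto simp: has_bochner_integral_iff ln_ge_zero)
    also have "\<dots> \<le> ennreal (\<integral>s. max 0 (?g s) \<partial>lborel)"
      using h by (intro ennreal_leI integral_mono integrable_max) (auto simp: has_bochner_integral_iff)
    also have "\<dots> = (\<integral>\<^sup>+s. ennreal (max 0 (?g s)) \<partial>lborel)"
      using h by (intro nn_integral_eq_integral[symmetric] integrable_max) (auto simp: has_bochner_integral_iff)
    also have "\<dots> \<le> reg_kernel x x"
      unfolding reg_kernel_def using le by (intro nn_integral_mono ennreal_leI) auto
    finally show ?thesis .
  qed
  show ?thesis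
  proof (rule ccontr)
    assume "reg_kernel x x \<noteq> \<infinity>"
    then obtain r where r: "reg_kernel x x = ennreal r" "r \<ge> 0"
      by (cases "reg_kernel x x") auto
    obtain n where "r < real n" using reals_Archimedean2 by blast
    with reg_kernel_ge[of n] r show False by (simp add: ennreal_le_iff)
  qed
qed

section \<open>Positive definiteness of the logarithmic energy\<close>

lemma borel_prob_iff: "borel_prob \<mu> \<longleftrightarrow> real_distribution \<mu>"
  by (auto simp: borel_prob_def real_distribution_def real_distribution_axioms_def)

definition mutual_energy :: "real measure \<Rightarrow> real measure \<Rightarrow> ennreal" where
  "mutual_energy \<mu> \<nu> = (\<integral>\<^sup>+x. \<integral>\<^sup>+y. reg_kernel x y \<partial>\<nu> \<partial>\<mu>)"

definition gauss_energy :: "real \<Rightarrow> real measure \<Rightarrow> real measure \<Rightarrow> real" where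
  "gauss_energy s \<mu> \<nu> = (\<integral>x. \<integral>y. gauss_kernel s x y \<partial>\<nu> \<partial>\<mu>)"

text \<open>Up to normalisation, the convolution of \<open>\<mu>\<close> with a Gaussian. The rate
  \<open>2 * s\<close> makes it a convolution square root: two such factors multiply and integrate
  to a Gaussian of rate \<open>s\<close>.\<close>

definition gauss_smooth :: "real \<Rightarrow> real measure \<Rightarrow> real \<Rightarrow> real" where
  "gauss_smooth s \<mu> u = (\<integral>x. exp (-(2 * s * (x - u)\<^sup>2)) \<partial>\<mu>)"

lemma gauss_kernel_le: "0 \<le> s \<Longrightarrow> gauss_kernel s x y \<le> 2"
proof -
  assume s: "0 \<le> s"
  have "exp (-(s * (x - y)\<^sup>2)) \<le> 1" "exp (-s) \<le> 1" using s by auto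
  moreover have "0 < exp (-(s * (1 + 2 * x\<^sup>2)))" "0 < exp (-(s * (1 + 2 * y\<^sup>2)))" by auto
  ultimately show ?thesis unfolding gauss_kernel_def by linarith
qed

lemma gauss_kernel_measurable [measurable (raw)]:
  assumes [measurable]: "f \<in> borel_measurable M" "g \<in> borel_measurable M" "h \<in> borel_measurable M"
  shows "(\<lambda>x. gauss_kernel (f x) (g x) (h x)) \<in> borel_measurable M"
  unfolding gauss_kernel_def by measurable

lemma reg_kernel_measurable' [measurable (raw)]:
  assumes "f \<in> borel_measurable M" "g \<in> borel_measurable M"
  shows "(\<lambda>x. reg_kernel (f x) (g x)) \<in> borel_measurable M"
  using measurable_compose[OF measurable_Pair[OF assms] reg_kernel_measurable] by simp

lemma has_bochner_integral_gauss:
  fixes c m :: real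
  assumes "c > 0"
  shows "has_bochner_integral lborel (\<lambda>u. exp (-(c * (u - m)\<^sup>2))) (sqrt (pi / c))"
proof -
  define \<sigma> where "\<sigma> = 1 / sqrt (2 * c)"
  have \<sigma>: "\<sigma> > 0" using assms by (simp add: \<sigma>_def)
  have s2: "\<sigma>\<^sup>2 = 1 / (2 * c)" using assms by (simp add: \<sigma>_def power_divide)
  have "has_bochner_integral lborel (\<lambda>u. sqrt (pi / c) * normal_density m \<sigma> u) (sqrt (pi / c) * 1)"
    using \<sigma> by (intro has_bochner_integral_mult_right) (simp add: has_bochner_integral_iff)
  also have "(\<lambda>u. sqrt (pi / c) * normal_density m \<sigma> u) = (\<lambda>u. exp (-(c * (u - m)\<^sup>2)))"
    using assms by (auto simp: normal_density_def s2 real_sqrt_divide field_simps)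
  finally show ?thesis by simp
qed

context
  fixes \<mu> \<nu> :: "real measure"
  assumes real_distribution: "real_distribution \<mu>" "real_distribution \<nu>"
begin

interpretation M: real_distribution \<mu> by (fact real_distribution)
interpretation N: real_distribution \<nu> by (fact real_distribution)
interpretation MN: pair_prob_space \<mu> \<nu> ..
interpretation XL: pair_sigma_finite \<mu> lborel ..
interpretation YL: pair_sigma_finite \<nu> lborel ..

text \<open>Puts the level \<open>s\<close> outermost, because positive definiteness holds level by
  level. At a fixed \<open>s > 0\<close> the kernel is bounded, so the inner integrals are finite
  reals and can be subtracted later.\<close>

lemma mutual_energy_eq:
  "mutual_energy \<mu> \<nu> = (\<integral>\<^sup>+s. ennreal (indicator {0<..} s * (gauss_energy s \<mu> \<nu> / (2 * s))) \<partial>lborel)"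
proof -
  have "mutual_energy \<mu> \<nu> = (\<integral>\<^sup>+x. \<integral>\<^sup>+s. \<integral>\<^sup>+y. ennreal (level_kernel s x y) \<partial>\<nu> \<partial>lborel \<partial>\<mu>)"
    unfolding mutual_energy_def reg_kernel_def
    by (intro nn_integral_cong YL.Fubini'[symmetric]) measurable
  also have "\<dots> = (\<integral>\<^sup>+s. \<integral>\<^sup>+x. \<integral>\<^sup>+y. ennreal (level_kernel s x y) \<partial>\<nu> \<partial>\<mu> \<partial>lborel)"
    by (intro XL.Fubini'[symmetric]) measurable
  also have "\<dots> = (\<integral>\<^sup>+s. ennreal (indicator {0<..} s * (gauss_energy s \<mu> \<nu> / (2 * s))) \<partial>lborel)"
  proof (rule nn_integral_cong)
    fix s :: real
    show "(\<integral>\<^sup>+x. \<integral>\<^sup>+y. ennreal (level_kernel s x y) \<partial>\<nu> \<partial>\<mu>) = ennreal (indicator {0<..} s * (gauss_energy s \<mu> \<nu> / (2 * s)))"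
    proof (cases "s > 0")
      case True
      have i: "integrable \<nu> (\<lambda>y. level_kernel s x y)" for x
        using True gauss_kernel_le[of s x] gauss_kernel_nonneg[of s x]
        by (intro N.integrable_const_bound[where B="1/s"]) (auto simp: level_kernel_def divide_simps)
      have j: "integrable \<mu> (\<lambda>x. \<integral>y. level_kernel s x y \<partial>\<nu>)"
      proof (rule M.integrable_const_bound[where B="1/s"])
        show "AE x in \<mu>. norm (\<integral>y. level_kernel s x y \<partial>\<nu>) \<le> 1 / s"
        proof (rule AE_I2)
          fix x
          have "(\<integral>y. level_kernel s x y \<partial>\<nu>) \<le> (\<integral>y. 1/s \<partial>\<nu>)"
            using True gauss_kernel_le[of s x]
            by (intro integral_mono i) (auto simp: level_kernel_def divide_simps)
          then show "norm (\<integral>y. level_kernel s x y \<partial>\<nu>) \<le> 1 / s"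
            by (simp add: N.prob_space[simplified])
        qed
      qed measurable
      have "(\<integral>\<^sup>+x. \<integral>\<^sup>+y. ennreal (level_kernel s x y) \<partial>\<nu> \<partial>\<mu>) = (\<integral>\<^sup>+x. ennreal (\<integral>y. level_kernel s x y \<partial>\<nu>) \<partial>\<mu>)"
        by (intro nn_integral_cong nn_integral_eq_integral i) auto
      also have "\<dots> = ennreal (\<integral>x. \<integral>y. level_kernel s x y \<partial>\<nu> \<partial>\<mu>)"
        by (intro nn_integral_eq_integral j) auto
      finally show ?thesis
        using True by (simp add: level_kernel_def gauss_energy_def)
    qed (simp add: level_kernel_def)
  qed
  finally show ?thesis .
qed

text \<open>Turns the Gaussian energy into an inner product of smoothed measures in
  \<open>L^2\<close>, which is the source of positivity.\<close>

lemma gauss_smooth_product: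
  assumes s: "s > 0"
  shows "integrable lborel (\<lambda>u. gauss_smooth s \<mu> u * gauss_smooth s \<nu> u)"
    and "(\<integral>x. \<integral>y. exp (-(s * (x - y)\<^sup>2)) \<partial>\<nu> \<partial>\<mu>)
       = sqrt (4 * s / pi) * (\<integral>u. gauss_smooth s \<mu> u * gauss_smooth s \<nu> u \<partial>lborel)"
proof -
  let ?g = "\<lambda>x u. exp (-(2 * s * (x - u)\<^sup>2))"
  \<comment> \<open>Completing the square in \<open>u\<close> around the midpoint
    \<open>(x + y) / 2\<close>.\<close>
  have prod: "?g x u * ?g y u = exp (-(s * (x - y)\<^sup>2)) * exp (-(4 * s * (u - (x + y) / 2)\<^sup>2))" for x y u
    by (simp add: power2_eq_square field_simps flip: exp_add)
  have int_u: "has_bochner_integral lborel (\<lambda>u. ?g x u * ?g y u) (exp (-(s * (x - y)\<^sup>2)) * sqrt (pi / (4 * s)))" for x y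
    unfolding prod using s by (intro has_bochner_integral_mult_right has_bochner_integral_gauss) auto
  have ix: "integrable \<mu> (\<lambda>x. ?g x u)" for u
    using s by (intro M.integrable_const_bound[where B=1]) auto
  have iy: "integrable \<nu> (\<lambda>x. ?g x u)" for u
    using s by (intro N.integrable_const_bound[where B=1]) auto
  interpret P: pair_sigma_finite "\<mu> \<Otimes>\<^sub>M \<nu>" lborel ..
  have int3: "integrable ((\<mu> \<Otimes>\<^sub>M \<nu>) \<Otimes>\<^sub>M lborel) (case_prod (\<lambda>z u. ?g (fst z) u * ?g (snd z) u))"
  proof (rule P.Fubini_integrable)
    have "integrable (\<mu> \<Otimes>\<^sub>M \<nu>) (\<lambda>z. exp (-(s * (fst z - snd z)\<^sup>2)) * sqrt (pi / (4 * s)))"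
      using s by (intro integrable_mult_left MN.integrable_const_bound[where B=1]) auto
    then show "integrable (\<mu> \<Otimes>\<^sub>M \<nu>) (\<lambda>x. \<integral>y. norm (case (x, y) of (z, u) \<Rightarrow> ?g (fst z) u * ?g (snd z) u) \<partial>lborel)"
      using int_u by (simp add: has_bochner_integral_iff)
  qed (use int_u in \<open>auto simp: has_bochner_integral_iff\<close>)
  have fst: "(\<integral>z. ?g (fst z) u * ?g (snd z) u \<partial>(\<mu> \<Otimes>\<^sub>M \<nu>)) = gauss_smooth s \<mu> u * gauss_smooth s \<nu> u" for u
  proof -
    have "integrable (\<mu> \<Otimes>\<^sub>M \<nu>) (\<lambda>z. ?g (fst z) u * ?g (snd z) u)"
      using s by (intro MN.integrable_const_bound[where B=1]) (auto simp: mult_le_one)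
    from MN.integral_fst'[OF this] show ?thesis
      by (simp add: gauss_smooth_def)
  qed
  show "integrable lborel (\<lambda>u. gauss_smooth s \<mu> u * gauss_smooth s \<nu> u)"
    using P.integrable_snd[OF int3] fst by simp
  have i2: "integrable (\<mu> \<Otimes>\<^sub>M \<nu>) (\<lambda>z. exp (-(s * (fst z - snd z)\<^sup>2)))"
    using s by (intro MN.integrable_const_bound[where B=1]) auto
  have "(\<integral>u. gauss_smooth s \<mu> u * gauss_smooth s \<nu> u \<partial>lborel)
    = (\<integral>z. (\<integral>u. ?g (fst z) u * ?g (snd z) u \<partial>lborel) \<partial>(\<mu> \<Otimes>\<^sub>M \<nu>))"
    unfolding fst[symmetric] by (rule P.Fubini_integral[OF int3])
  also have "\<dots> = (\<integral>z. exp (-(s * (fst z - snd z)\<^sup>2)) * sqrt (pi / (4 * s)) \<partial>(\<mu> \<Otimes>\<^sub>M \<nu>))"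
    using int_u by (simp add: has_bochner_integral_iff)
  also have "\<dots> = sqrt (pi / (4 * s)) * (\<integral>x. \<integral>y. exp (-(s * (x - y)\<^sup>2)) \<partial>\<nu> \<partial>\<mu>)"
    using MN.integral_fst'[OF i2] by simp
  finally show "(\<integral>x. \<integral>y. exp (-(s * (x - y)\<^sup>2)) \<partial>\<nu> \<partial>\<mu>)
       = sqrt (4 * s / pi) * (\<integral>u. gauss_smooth s \<mu> u * gauss_smooth s \<nu> u \<partial>lborel)"
    using s by (simp add: real_sqrt_divide real_sqrt_mult)
qed

text \<open>Besides the inner product only a constant and terms depending on one measure at a time
  remain; these cancel in \<open>mutual_energy_defect\<close>.\<close>

lemma gauss_energy_eq:
  assumes s: "s > 0"
  shows "gauss_energy s \<mu> \<nu> = sqrt (4 * s / pi) * (\<integral>u. gauss_smooth s \<mu> u * gauss_smooth s \<nu> u \<partial>lborel)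
    + exp (-s) - (\<integral>x. exp (-(s * (1 + 2 * x\<^sup>2))) \<partial>\<mu>) - (\<integral>x. exp (-(s * (1 + 2 * x\<^sup>2))) \<partial>\<nu>)"
proof -
  have 1: "exp (-(s * (1 + 2 * x\<^sup>2))) \<le> 1" for x using s by (simp add: add_nonneg_nonneg)
  have i: "integrable \<nu> (\<lambda>y. exp (-(s * (x - y)\<^sup>2)))" "integrable \<nu> (\<lambda>y. exp (-(s * (1 + 2 * y\<^sup>2))))"
     "integrable \<mu> (\<lambda>y. exp (-(s * (1 + 2 * y\<^sup>2))))" for x
    using s 1 by (auto intro!: M.integrable_const_bound[where B=1] N.integrable_const_bound[where B=1])
  have j: "integrable \<mu> (\<lambda>x. \<integral>y. exp (-(s * (x - y)\<^sup>2)) \<partial>\<nu>)"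
  proof -
    have "integrable (\<mu> \<Otimes>\<^sub>M \<nu>) (\<lambda>z. exp (-(s * (fst z - snd z)\<^sup>2)))"
      using s by (intro MN.integrable_const_bound[where B=1]) auto
    from MN.integrable_fst'[OF this] show ?thesis by simp
  qed
  have "(\<integral>y. gauss_kernel s x y \<partial>\<nu>) = (\<integral>y. exp (-(s * (x - y)\<^sup>2)) \<partial>\<nu>) + exp (-s)
      - exp (-(s * (1 + 2 * x\<^sup>2))) - (\<integral>x. exp (-(s * (1 + 2 * x\<^sup>2))) \<partial>\<nu>)" for x
    unfolding gauss_kernel_def using i by (simp add: N.prob_space[simplified])
  then show ?thesis
    unfolding gauss_energy_def using i j by (simp add: M.prob_space[simplified] gauss_smooth_product(2)[OF s])
qed

end

text \<open>This is the energy of the signed measure \<open>\<mu> - \<nu>\<close>, computed level by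
  level as a squared \<open>L^2\<close> distance of smoothed measures. It is written with sums on
  both sides because energies may be infinite, where a difference would be meaningless.\<close>

lemma mutual_energy_defect:
  assumes "real_distribution \<mu>" "real_distribution \<nu>"
  shows "mutual_energy \<mu> \<mu> + mutual_energy \<nu> \<nu> = 2 * mutual_energy \<mu> \<nu> +
    (\<integral>\<^sup>+s. ennreal (indicator {0<..} s * (sqrt (4 * s / pi) *
       (\<integral>u. (gauss_smooth s \<mu> u - gauss_smooth s \<nu> u)\<^sup>2 \<partial>lborel) / (2 * s))) \<partial>lborel)"
    (is "_ = _ + (\<integral>\<^sup>+s. ennreal (?D s) \<partial>lborel)")
proof -
  let ?G = "\<lambda>\<mu> \<nu> s. indicator {0<..} s * (gauss_energy s \<mu> \<nu> / (2 * s))"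
  interpret M: real_distribution \<mu> by fact
  interpret N: real_distribution \<nu> by fact
  have G_nonneg: "?G \<mu> \<nu> s \<ge> 0" for s \<mu> \<nu>
    by (auto simp: indicator_def gauss_energy_def gauss_kernel_nonneg intro!: divide_nonneg_pos integral_nonneg_AE AE_I2)
  have D_nonneg: "?D s \<ge> 0" for s
    by (auto simp: indicator_def)
  have sum: "?G \<mu> \<mu> s + ?G \<nu> \<nu> s = 2 * ?G \<mu> \<nu> s + ?D s" for s
  proof (cases "s > 0")
    case True
    note i = gauss_smooth_product(1)[OF assms(1) assms(1) True] gauss_smooth_product(1)[OF assms(2) assms(2) True]
      gauss_smooth_product(1)[OF assms True]
    have "(\<integral>u. (gauss_smooth s \<mu> u - gauss_smooth s \<nu> u)\<^sup>2 \<partial>lborel)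
      = (\<integral>u. gauss_smooth s \<mu> u * gauss_smooth s \<mu> u + gauss_smooth s \<nu> u * gauss_smooth s \<nu> u
          - 2 * (gauss_smooth s \<mu> u * gauss_smooth s \<nu> u) \<partial>lborel)"
      by (rule Bochner_Integration.integral_cong) (auto simp: power2_eq_square algebra_simps)
    also have "\<dots> = (\<integral>u. gauss_smooth s \<mu> u * gauss_smooth s \<mu> u \<partial>lborel) + (\<integral>u. gauss_smooth s \<nu> u * gauss_smooth s \<nu> u \<partial>lborel)
       - 2 * (\<integral>u. gauss_smooth s \<mu> u * gauss_smooth s \<nu> u \<partial>lborel)"
      using i by simp
    finally have e: "(\<integral>u. (gauss_smooth s \<mu> u - gauss_smooth s \<nu> u)\<^sup>2 \<partial>lborel) = \<dots>" .
    show ?thesis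
      unfolding e gauss_energy_eq[OF assms True] gauss_energy_eq[OF assms(1) assms(1) True] gauss_energy_eq[OF assms(2) assms(2) True]
      using True by (simp add: field_simps)
  qed simp
  have [measurable]: "?G \<mu> \<nu> \<in> borel_measurable lborel" "?G \<mu> \<mu> \<in> borel_measurable lborel" "?G \<nu> \<nu> \<in> borel_measurable lborel"
    unfolding gauss_energy_def by measurable
  have [measurable]: "?D \<in> borel_measurable lborel"
    unfolding gauss_smooth_def by measurable
  have "mutual_energy \<mu> \<mu> + mutual_energy \<nu> \<nu> = (\<integral>\<^sup>+s. ennreal (?G \<mu> \<mu> s) + ennreal (?G \<nu> \<nu> s) \<partial>lborel)"
    unfolding mutual_energy_eq[OF assms(1) assms(1)] mutual_energy_eq[OF assms(2) assms(2)]
    by (rule nn_integral_add[symmetric]) measurable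
  also have "\<dots> = (\<integral>\<^sup>+s. 2 * ennreal (?G \<mu> \<nu> s) + ennreal (?D s) \<partial>lborel)"
  proof (rule nn_integral_cong)
    fix s
    have "ennreal (?G \<mu> \<mu> s) + ennreal (?G \<nu> \<nu> s) = ennreal (?G \<mu> \<mu> s + ?G \<nu> \<nu> s)"
      by (simp only: ennreal_plus[OF G_nonneg G_nonneg])
    also have "\<dots> = 2 * ennreal (?G \<mu> \<nu> s) + ennreal (?D s)"
      unfolding sum using G_nonneg[of s \<mu> \<nu>] D_nonneg[of s]
      by (subst ennreal_plus) (simp_all only: ennreal_mult mult_nonneg_nonneg zero_le_numeral ennreal_numeral)
    finally show "ennreal (?G \<mu> \<mu> s) + ennreal (?G \<nu> \<nu> s) = \<dots>" .
  qed
  also have "\<dots> = 2 * mutual_energy \<mu> \<nu> + (\<integral>\<^sup>+s. ennreal (?D s) \<partial>lborel)"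
    unfolding mutual_energy_eq[OF assms]
    by (subst nn_integral_add, measurable) (subst nn_integral_cmult, measurable)
  finally show ?thesis .
qed

lemma mutual_energy_le:
  assumes "real_distribution \<mu>" "real_distribution \<nu>"
  shows "2 * mutual_energy \<mu> \<nu> \<le> mutual_energy \<mu> \<mu> + mutual_energy \<nu> \<nu>"
  unfolding mutual_energy_defect[OF assms] by simp

text \<open>Convolution becomes multiplication under the Fourier transform, and the transform of a
  Gaussian has no zeros. The explicit form of \<open>c\<close> records that it does not depend on
  \<open>\<mu>\<close>, so that it can be cancelled between two measures.\<close>

lemma gauss_smooth_char:
  assumes "real_distribution \<mu>" and s: "s > 0"
  shows "\<exists>c. c \<noteq> 0 \<and> (\<integral>u. complex_of_real (gauss_smooth s \<mu> u) * iexp (t * u) \<partial>lborel) = c * char \<mu> t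
     \<and> c = (\<integral>v. complex_of_real (exp (-(2 * s * v\<^sup>2))) * iexp (t * v) \<partial>lborel)"
proof -
  interpret M: real_distribution \<mu> by fact
  interpret XL: pair_sigma_finite \<mu> lborel ..
  let ?c = "(\<integral>v. complex_of_real (exp (-(2 * s * v\<^sup>2))) * iexp (t * v) \<partial>lborel)"
  let ?f = "\<lambda>x u. complex_of_real (exp (-(2 * s * (x - u)\<^sup>2))) * iexp (t * u)"
  have g: "has_bochner_integral lborel (\<lambda>u. exp (-(2 * s * (x - u)\<^sup>2))) (sqrt (pi / (2 * s)))" for x
    using has_bochner_integral_gauss[of "2 * s" x] s by (simp add: power2_commute)
  have g': "integrable lborel (\<lambda>u. ?f x u)" for x
    using g[of x] by (auto simp: has_bochner_integral_iff norm_mult intro: Bochner_Integration.integrable_bound)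
  have "integrable (\<mu> \<Otimes>\<^sub>M lborel) (case_prod ?f)"
    using g g' by (intro XL.Fubini_integrable) (auto simp: has_bochner_integral_iff norm_mult)
  then have "(\<integral>u. (\<integral>x. ?f x u \<partial>\<mu>) \<partial>lborel) = (\<integral>x. (\<integral>u. ?f x u \<partial>lborel) \<partial>\<mu>)"
    by (rule XL.Fubini_integral)
  also have "(\<lambda>x. \<integral>u. ?f x u \<partial>lborel) = (\<lambda>x. ?c * iexp (t * x))"
  proof
    fix x
    have "(\<integral>u. ?f x u \<partial>lborel) = (\<integral>v. ?f x (x + 1 * v) \<partial>lborel)"
      by (subst lborel_integral_real_affine[where c=1 and t=x]) auto
    also have "\<dots> = (\<integral>v. complex_of_real (exp (-(2 * s * v\<^sup>2))) * iexp (t * v) * iexp (t * x) \<partial>lborel)"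
      by (intro Bochner_Integration.integral_cong) (auto simp: algebra_simps exp_add)
    finally show "(\<integral>u. ?f x u \<partial>lborel) = ?c * iexp (t * x)" by simp
  qed
  also have "(\<integral>x. ?c * iexp (t * x) \<partial>\<mu>) = ?c * char \<mu> t"
    by (simp add: char_def)
  also have "(\<lambda>u. (\<integral>x. ?f x u \<partial>\<mu>)) = (\<lambda>u. complex_of_real (gauss_smooth s \<mu> u) * iexp (t * u))"
    by (simp add: gauss_smooth_def)
  finally have 1: "(\<integral>u. complex_of_real (gauss_smooth s \<mu> u) * iexp (t * u) \<partial>lborel) = ?c * char \<mu> t" .
  \<comment> \<open>The scale at which \<open>exp (-(2 * s * v^2))\<close> becomes the standard
    Gaussian \<open>exp (- w^2 / 2)\<close>.\<close>
  define d where "d = 1 / sqrt (4 * s)"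
  have d: "d > 0" "d\<^sup>2 = 1 / (4 * s)" using s by (auto simp: d_def power_divide)
  have "?c = \<bar>d\<bar> *\<^sub>R (\<integral>w. complex_of_real (exp (-(2 * s * (0 + d * w)\<^sup>2))) * iexp (t * (0 + d * w)) \<partial>lborel)"
    using d by (intro lborel_integral_real_affine) auto
  also have "(\<lambda>w. complex_of_real (exp (-(2 * s * (0 + d * w)\<^sup>2))) * iexp (t * (0 + d * w)))
    = (\<lambda>w. sqrt (2 * pi) * (std_normal_density w *\<^sub>R iexp (t * d * w)))"
    using s by (auto simp: std_normal_density_def power_mult_distrib d(2) scaleR_conv_of_real algebra_simps)
  also have "(\<integral>w. sqrt (2 * pi) * (std_normal_density w *\<^sub>R iexp (t * d * w)) \<partial>lborel) = sqrt (2 * pi) * char std_normal_distribution (t * d)"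
    unfolding char_def by (subst integral_mult_right_zero, subst integral_density) auto
  finally have "?c = complex_of_real (d * sqrt (2 * pi) * exp (-((t * d)\<^sup>2) / 2))"
    using d by (simp add: char_std_normal_distribution scaleR_conv_of_real)
  also have "\<dots> \<noteq> 0" using d by (simp del: of_real_mult)
  finally show ?thesis using 1 by blast
qed

text \<open>A vanishing defect forces equal smoothings at almost every level. One level is enough,
  since the smoothing there already determines the characteristic function.\<close>

lemma mutual_energy_eq_imp_eq:
  assumes \<mu>\<nu>: "real_distribution \<mu>" "real_distribution \<nu>"
    and eq: "mutual_energy \<mu> \<mu> + mutual_energy \<nu> \<nu> \<le> 2 * mutual_energy \<mu> \<nu>"
    and fin: "mutual_energy \<mu> \<mu> + mutual_energy \<nu> \<nu> < \<infinity>"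
  shows "\<mu> = \<nu>"
proof -
  interpret M: real_distribution \<mu> by fact
  interpret N: real_distribution \<nu> by fact
  let ?D = "\<lambda>s. indicator {0<..} s * (sqrt (4 * s / pi) *
       (\<integral>u. (gauss_smooth s \<mu> u - gauss_smooth s \<nu> u)\<^sup>2 \<partial>lborel) / (2 * s))"
  have [measurable]: "?D \<in> borel_measurable lborel"
    unfolding gauss_smooth_def by measurable
  have "2 * mutual_energy \<mu> \<nu> + (\<integral>\<^sup>+s. ennreal (?D s) \<partial>lborel) \<le> 2 * mutual_energy \<mu> \<nu> + 0"
    using eq unfolding mutual_energy_defect[OF \<mu>\<nu>] by simp
  moreover have "2 * mutual_energy \<mu> \<nu> < \<infinity>"
    using mutual_energy_le[OF \<mu>\<nu>] fin by (rule le_less_trans)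
  ultimately have "(\<integral>\<^sup>+s. ennreal (?D s) \<partial>lborel) = 0"
    by (subst (asm) ennreal_add_left_cancel_le) auto
  moreover have "(\<lambda>s. ennreal (?D s)) \<in> borel_measurable lborel"
    by (rule measurable_compose[OF _ measurable_ennreal]) measurable
  ultimately have "AE s in lborel. ennreal (?D s) = 0"
    by (simp only: nn_integral_0_iff_AE)
  \<comment> \<open>A property that holds almost everywhere holds somewhere in
    \<open>(0, 1)\<close>, which is not a null set.\<close>
  then obtain s :: real where s: "ennreal (?D s) = 0" "0 < s"
  proof (rule AE_E3)
    fix N assume N: "\<And>s. s \<in> space lborel - N \<Longrightarrow> ennreal (?D s) = 0" "N \<in> null_sets lborel"
    have "\<not> {0<..<1::real} \<subseteq> N"
    proof
      assume "{0<..<1} \<subseteq> N"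
      then have "emeasure lborel {0<..<1::real} \<le> emeasure lborel N"
        using N(2) by (intro emeasure_mono) auto
      then show False using N(2) by (simp add: null_setsD1)
    qed
    then obtain s where "s \<in> {0<..<1}" "s \<notin> N" by (meson subsetI)
    with N(1)[of s] show thesis by (intro that[of s]) auto
  qed
  have i: "integrable lborel (\<lambda>u. (gauss_smooth s \<mu> u - gauss_smooth s \<nu> u)\<^sup>2)"
  proof -
    have "(\<lambda>u. (gauss_smooth s \<mu> u - gauss_smooth s \<nu> u)\<^sup>2) =
      (\<lambda>u. gauss_smooth s \<mu> u * gauss_smooth s \<mu> u + gauss_smooth s \<nu> u * gauss_smooth s \<nu> u
          - 2 * (gauss_smooth s \<mu> u * gauss_smooth s \<nu> u))"
      by (auto simp: power2_eq_square algebra_simps)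
    then show ?thesis
      using gauss_smooth_product(1) \<mu>\<nu> s(2) by simp
  qed
  have "(\<integral>u. (gauss_smooth s \<mu> u - gauss_smooth s \<nu> u)\<^sup>2 \<partial>lborel) = 0"
  proof -
    have "?D s \<le> 0" using s(1) by (simp only: ennreal_eq_0_iff)
    moreover have "sqrt (4 * s / pi) / (2 * s) > 0" using s(2) by simp
    moreover have "?D s = sqrt (4 * s / pi) / (2 * s) * (\<integral>u. (gauss_smooth s \<mu> u - gauss_smooth s \<nu> u)\<^sup>2 \<partial>lborel)"
      using s(2) by simp
    ultimately have "(\<integral>u. (gauss_smooth s \<mu> u - gauss_smooth s \<nu> u)\<^sup>2 \<partial>lborel) \<le> 0"
      by (metis mult_le_0_iff not_le)
    moreover have "(\<integral>u. (gauss_smooth s \<mu> u - gauss_smooth s \<nu> u)\<^sup>2 \<partial>lborel) \<ge> 0"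
      by (intro integral_nonneg_AE) auto
    ultimately show ?thesis by simp
  qed
  then have ae: "AE u in lborel. gauss_smooth s \<mu> u = gauss_smooth s \<nu> u"
    using integral_nonneg_eq_0_iff_AE[OF i] by auto
  have "char \<mu> t = char \<nu> t" for t
  proof -
    have [measurable]: "gauss_smooth s \<mu> \<in> borel_measurable lborel" "gauss_smooth s \<nu> \<in> borel_measurable lborel"
      unfolding gauss_smooth_def by measurable
    have "(\<integral>u. complex_of_real (gauss_smooth s \<mu> u) * iexp (t * u) \<partial>lborel)
       = (\<integral>u. complex_of_real (gauss_smooth s \<nu> u) * iexp (t * u) \<partial>lborel)"
      using ae by (intro integral_cong_AE) auto
    then show ?thesis
      using gauss_smooth_char[OF \<mu>\<nu>(1) s(2), of t] gauss_smooth_char[OF \<mu>\<nu>(2) s(2), of t] by auto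
  qed
  then show ?thesis by (intro Levy_uniqueness \<mu>\<nu> ext)
qed

section \<open>The energy functional and uniqueness of minimizers\<close>

text \<open>The part of \<open>P_set\<close> that survives affine changes of variable: the
  normalisation at 0 is dropped, and the degree bound takes over its role of excluding
  constants.\<close>

definition confining :: "real poly \<Rightarrow> bool" where
  "confining V \<longleftrightarrow> even (degree V) \<and> 2 \<le> degree V \<and> 0 < lead_coeff V"

lemma poly_bounded_below_of_even_degree:
  fixes p :: "real poly"
  assumes "even (degree p)" "0 < lead_coeff p"
  shows "\<exists>B\<ge>0. \<forall>x. - B \<le> poly p x"
proof -
  obtain n where n: "poly p x \<ge> lead_coeff p" if "x \<ge> n" for x
    using poly_pinfty_gt_lc[OF assms(2)] by auto
  have deg: "degree (p \<circ>\<^sub>p [:0, -1:]) = degree p"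
    by (simp add: degree_pcompose)
  have lead: "lead_coeff (p \<circ>\<^sub>p [:0, -1:]) = lead_coeff p"
    using assms(1) by (subst lead_coeff_comp) auto
  obtain n' where n': "poly (p \<circ>\<^sub>p [:0, -1:]) x \<ge> lead_coeff (p \<circ>\<^sub>p [:0, -1:])" if "x \<ge> n'" for x
    using poly_pinfty_gt_lc[of "p \<circ>\<^sub>p [:0, -1:]"] assms(2) lead by auto
  have n'': "poly p x \<ge> 0" if "x \<le> - n'" for x
    using n'[of "- x"] that assms(2) unfolding lead by (simp add: poly_pcompose)
  have "bounded ((\<lambda>x. poly p x) ` {- n'..n})"
    by (intro compact_imp_bounded compact_continuous_image continuous_intros) auto
  then obtain B where "\<forall>y\<in>(\<lambda>x. poly p x) ` {- n'..n}. norm y \<le> B"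
    unfolding bounded_iff by blast
  then have B: "\<bar>poly p x\<bar> \<le> B" if "x \<in> {- n'..n}" for x
    using that by auto
  have "- max B 0 \<le> poly p x" for x
  proof -
    consider "x \<ge> n" | "x \<le> - n'" | "x \<in> {- n'..n}" by fastforce
    then show ?thesis
    proof cases
      case 1
      then show ?thesis using n[of x] assms(2) by linarith
    next
      case 2
      then show ?thesis using n''[of x] by linarith
    next
      case 3
      then show ?thesis using B[of x] by linarith
    qed
  qed
  then show ?thesis by (intro exI[of _ "max B 0"]) auto
qed

lemma confining_quadratic_lower_bound:
  assumes "confining V"
  shows "\<exists>\<epsilon>>0. \<exists>B\<ge>0. \<forall>x. \<epsilon> * x\<^sup>2 - B \<le> poly V x"
proof -
  \<comment> \<open>Half the leading coefficient: in degree 2, subtracting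
    \<open>\<epsilon> * x^2\<close> must leave a positive leading coefficient; in higher degree the
    leading coefficient is untouched.\<close>
  define \<epsilon> where "\<epsilon> = lead_coeff V / 2"
  have \<epsilon>: "\<epsilon> > 0" using assms by (simp add: \<epsilon>_def confining_def)
  let ?p = "V - monom \<epsilon> 2"
  have c: "coeff ?p (degree V) > 0"
    using assms by (auto simp: confining_def \<epsilon>_def)
  have "degree ?p \<le> degree V"
    using assms by (intro degree_diff_le) (auto simp: confining_def degree_monom_le intro: order.trans[OF degree_monom_le])
  moreover have "degree ?p \<ge> degree V"
    using c by (intro le_degree) auto
  ultimately have "degree ?p = degree V" by simp
  then obtain B where "B \<ge> 0" "\<And>x. - B \<le> poly ?p x"
    using poly_bounded_below_of_even_degree[of ?p] c assms by (auto simp: confining_def)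
  then show ?thesis
    using \<epsilon> by (intro exI[of _ \<epsilon>] conjI exI[of _ B]) (auto simp: poly_monom algebra_simps)
qed

text \<open>Half of \<open>V\<close> minus the logarithm that \<open>reg_log\<close> adds for this
  variable, so that \<open>log_kernel\<close> is \<open>reg_log\<close> plus one such term per
  variable.\<close>

definition reduced_potential :: "real poly \<Rightarrow> real \<Rightarrow> real" where
  "reduced_potential V x = poly V x / 2 - ln (1 + 2 * x\<^sup>2) / 2"

lemma reduced_potential_measurable [measurable (raw)]:
  "f \<in> borel_measurable M \<Longrightarrow> (\<lambda>x. reduced_potential V (f x)) \<in> borel_measurable M"
proof -
  assume [measurable]: "f \<in> borel_measurable M"
  have [measurable]: "poly V \<in> borel_measurable borel"
    by (intro borel_measurable_continuous_onI continuous_intros)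
  show ?thesis unfolding reduced_potential_def by measurable
qed

lemma confining_reduced_potential:
  assumes "confining V"
  shows "\<exists>\<delta>>0. \<exists>C\<ge>0. \<forall>x. \<delta> * x\<^sup>2 \<le> reduced_potential V x + C"
proof -
  obtain \<epsilon> B where \<epsilon>: "\<epsilon> > 0" and B: "B \<ge> 0" "\<And>x. \<epsilon> * x\<^sup>2 - B \<le> poly V x"
    using confining_quadratic_lower_bound[OF assms] by auto
  \<comment> \<open>The inequality \<open>ln u \<le> u - 1\<close> at
    \<open>u = a * (1 + 2 * x^2)\<close> bounds the logarithm by \<open>2 * a * x^2\<close> plus a
    constant; this \<open>a\<close> spends half of the available quadratic growth.\<close>
  define a where "a = \<epsilon> / 4"
  have a: "a > 0" using \<epsilon> by (simp add: a_def)
  have "\<epsilon> / 4 * x\<^sup>2 \<le> reduced_potential V x + (B / 2 + \<bar>a - 1 - ln a\<bar> / 2)" for x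
  proof -
    have "1 + 2 * x\<^sup>2 > 0" by (simp add: add_pos_nonneg)
    then have "ln a + ln (1 + 2 * x\<^sup>2) \<le> a * (1 + 2 * x\<^sup>2) - 1"
      using a ln_le_minus_one[of "a * (1 + 2 * x\<^sup>2)"] by (simp add: ln_mult)
    then have "ln (1 + 2 * x\<^sup>2) \<le> \<epsilon> / 2 * x\<^sup>2 + \<bar>a - 1 - ln a\<bar>"
      by (simp add: a_def algebra_simps)
    with B(2)[of x] show ?thesis
      by (simp add: reduced_potential_def field_simps)
  qed
  then show ?thesis using \<epsilon> B(1) by (intro exI[of _ "\<epsilon> / 4"] conjI exI[of _ "B / 2 + \<bar>a - 1 - ln a\<bar> / 2"]) auto
qed

text \<open>\<open>C\<close> makes the potential nonnegative, so that the energy becomes an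
  \<open>ennreal\<close>; \<open>\<delta>\<close> controls mass at infinity and yields
  tightness.\<close>

locale confined =
  fixes V :: "real poly" and \<delta> C :: real
  assumes \<delta>_pos: "0 < \<delta>" and C_nonneg: "0 \<le> C"
    and coercive: "\<delta> * x\<^sup>2 \<le> reduced_potential V x + C"
begin

abbreviation Q :: "real \<Rightarrow> real" where "Q x \<equiv> reduced_potential V x + C"

text \<open>The energy raised by \<open>2 * C\<close>; \<open>Q\<close> enters twice, once for each
  variable of the kernel.\<close>

definition J :: "real measure \<Rightarrow> ennreal" where
  "J \<mu> = mutual_energy \<mu> \<mu> + 2 * (\<integral>\<^sup>+x. ennreal (Q x) \<partial>\<mu>)"

lemma Q_nonneg: "0 \<le> Q x"
proof -
  have "0 \<le> \<delta> * x\<^sup>2" using \<delta>_pos by simp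
  then show ?thesis using coercive[of x] by linarith
qed

lemma log_kernel_eq:
  "log_kernel V x y = (if x = y then \<infinity> else ereal (reg_log x y + reduced_potential V x + reduced_potential V y))"
proof (cases "x = y")
  case False
  then have "ln (1 / \<bar>x - y\<bar>) = - ln \<bar>x - y\<bar>"
    by (simp add: ln_div)
  then have "ln (1 / \<bar>x - y\<bar>) + (poly V x + poly V y) / 2 = reg_log x y + reduced_potential V x + reduced_potential V y"
    unfolding reg_log_def reduced_potential_def by argo
  with False show ?thesis by (simp add: log_kernel_def)
qed (simp add: log_kernel_def)

text \<open>Positive and negative part stand on opposite sides because \<open>e2ennreal\<close>
  sends negative values to 0 and infinite values forbid subtraction. On the diagonal both sides are
  infinite.\<close>

lemma shifted_log_kernel:
  "e2ennreal (log_kernel V x y) + ennreal (2 * C) =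
    reg_kernel x y + ennreal (Q x) + ennreal (Q y) + e2ennreal (- log_kernel V x y)"
proof (cases "x = y")
  case True
  then show ?thesis by (simp add: log_kernel_eq reg_kernel_diag top_add)
next
  case False
  define r where "r = reg_log x y + reduced_potential V x + reduced_potential V y"
  have k: "log_kernel V x y = ereal r" using False by (simp add: log_kernel_eq r_def)
  have sum: "reg_kernel x y + ennreal (Q x) + ennreal (Q y) = ennreal (r + 2 * C)"
    using reg_kernel_eq[OF False] Q_nonneg[of x] Q_nonneg[of y]
    by (simp add: r_def algebra_simps flip: ennreal_plus)
  have pos: "0 \<le> r + 2 * C" using reg_kernel_eq(2)[OF False] Q_nonneg[of x] Q_nonneg[of y] by (simp add: r_def)
  show ?thesis
    unfolding sum k using pos C_nonneg
    by (cases "0 \<le> r") (auto simp: ennreal_neg simp flip: ennreal_plus)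
qed

lemma log_kernel_measurable [measurable]:
  "(\<lambda>z::real \<times> real. log_kernel V (fst z) (snd z)) \<in> borel_measurable (borel \<Otimes>\<^sub>M borel)"
proof -
  have [measurable]: "poly V \<in> borel_measurable borel"
    by (intro borel_measurable_continuous_onI continuous_intros)
  show ?thesis unfolding log_kernel_def by measurable
qed

lemma energy_eq:
  assumes "real_distribution \<mu>"
  shows "energy V \<mu> = enn2ereal (J \<mu>) - ereal (2 * C)"
proof -
  interpret M: real_distribution \<mu> by fact
  interpret MM: pair_prob_space \<mu> \<mu> ..
  let ?P = "\<integral>\<^sup>+z. e2ennreal (log_kernel V (fst z) (snd z)) \<partial>(\<mu> \<Otimes>\<^sub>M \<mu>)"
  let ?N = "\<integral>\<^sup>+z. e2ennreal (- log_kernel V (fst z) (snd z)) \<partial>(\<mu> \<Otimes>\<^sub>M \<mu>)"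
  have [measurable_cong]: "sets (\<mu> \<Otimes>\<^sub>M \<mu>) = sets (borel \<Otimes>\<^sub>M borel)"
    by (intro sets_pair_measure_cong) auto
  have one: "emeasure (\<mu> \<Otimes>\<^sub>M \<mu>) (space (\<mu> \<Otimes>\<^sub>M \<mu>)) = 1" by (rule MM.emeasure_space_1)
  have "?P + ennreal (2 * C) = (\<integral>\<^sup>+z. e2ennreal (log_kernel V (fst z) (snd z)) + ennreal (2 * C) \<partial>(\<mu> \<Otimes>\<^sub>M \<mu>))"
    by (subst nn_integral_add) (auto simp: one)
  also have "\<dots> = (\<integral>\<^sup>+z. reg_kernel (fst z) (snd z) + ennreal (Q (fst z)) + ennreal (Q (snd z)) + e2ennreal (- log_kernel V (fst z) (snd z)) \<partial>(\<mu> \<Otimes>\<^sub>M \<mu>))"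
    by (simp only: shifted_log_kernel)
  also have "\<dots> = (\<integral>\<^sup>+z. reg_kernel (fst z) (snd z) + ennreal (Q (fst z)) + ennreal (Q (snd z)) \<partial>(\<mu> \<Otimes>\<^sub>M \<mu>)) + ?N"
    by (intro nn_integral_add) measurable
  also have "(\<integral>\<^sup>+z. reg_kernel (fst z) (snd z) + ennreal (Q (fst z)) + ennreal (Q (snd z)) \<partial>(\<mu> \<Otimes>\<^sub>M \<mu>))
    = (\<integral>\<^sup>+x. \<integral>\<^sup>+y. reg_kernel x y + ennreal (Q x) + ennreal (Q y) \<partial>\<mu> \<partial>\<mu>)"
    by (subst M.nn_integral_fst[symmetric]) auto
  also have "\<dots> = (\<integral>\<^sup>+x. (\<integral>\<^sup>+y. reg_kernel x y \<partial>\<mu>) + ennreal (Q x) + (\<integral>\<^sup>+y. ennreal (Q y) \<partial>\<mu>) \<partial>\<mu>)"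
    by (simp add: nn_integral_add M.emeasure_space_1[simplified])
  also have "\<dots> = J \<mu>"
    by (simp add: nn_integral_add M.emeasure_space_1[simplified] J_def mutual_energy_def mult_2 add.assoc)
  finally have eq: "?P + ennreal (2 * C) = J \<mu> + ?N" .
  \<comment> \<open>The negative part is at most \<open>2 * C\<close>, so the difference defining
    \<open>energy\<close> is never infinity minus infinity.\<close>
  have "?N \<le> (\<integral>\<^sup>+z. ennreal (2 * C) \<partial>(\<mu> \<Otimes>\<^sub>M \<mu>))"
  proof (rule nn_integral_mono)
    fix z :: "real \<times> real"
    obtain x y where z: "z = (x, y)" by force
    show "e2ennreal (- log_kernel V (fst z) (snd z)) \<le> ennreal (2 * C)"
    proof (cases "x = y")
      case False
      then have "- (reg_log x y + reduced_potential V x + reduced_potential V y) \<le> 2 * C"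
        using reg_kernel_eq(2)[OF False] Q_nonneg[of x] Q_nonneg[of y] by simp
      with False show ?thesis by (simp add: z log_kernel_eq ennreal_leI)
    qed (simp add: z log_kernel_eq e2ennreal_neg)
  qed
  also have "\<dots> < \<infinity>" by (simp add: one)
  finally obtain n where n: "?N = ennreal n" "0 \<le> n" by (cases ?N) auto
  show ?thesis
  proof (cases "J \<mu>")
    case (real j)
    then obtain p where p: "?P = ennreal p" "0 \<le> p"
      using eq n by (cases ?P) (auto simp: top_add ennreal_plus[symmetric] simp del: ennreal_plus)
    have "p + 2 * C = j + n" using eq n p real C_nonneg by (simp flip: ennreal_plus)
    then show ?thesis unfolding energy_def using n p real by (simp add: enn2ereal_ennreal)
  next
    case top
    then have "?P = \<infinity>" using eq n by (cases ?P) (auto simp: top_add ennreal_plus[symmetric] simp del: ennreal_plus)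
    then show ?thesis unfolding energy_def using n top by (simp add: enn2ereal_ennreal)
  qed
qed

lemma is_energy_minimizer_iff:
  "is_energy_minimizer V \<mu> \<longleftrightarrow>
    real_distribution \<mu> \<and> J \<mu> < \<infinity> \<and> (\<forall>\<nu>. real_distribution \<nu> \<longrightarrow> J \<mu> \<le> J \<nu>)"
proof -
  have 1: "energy V \<mu> < \<infinity> \<longleftrightarrow> J \<mu> < \<infinity>" if "real_distribution \<mu>" for \<mu>
    unfolding energy_eq[OF that] by (cases "J \<mu>") (auto simp: enn2ereal_ennreal)
  have 2: "energy V \<mu> \<le> energy V \<nu> \<longleftrightarrow> J \<mu> \<le> J \<nu>" if "real_distribution \<mu>" "real_distribution \<nu>" for \<mu> \<nu>
    unfolding energy_eq[OF that(1)] energy_eq[OF that(2)]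
    by (cases "J \<mu>"; cases "J \<nu>") (auto simp: enn2ereal_ennreal top_unique)
  show ?thesis
    unfolding is_energy_minimizer_def borel_prob_iff using 1 2 by blast
qed

end

section \<open>Uniqueness of the minimizer by strict convexity\<close>

lemma mutual_energy_commute:
  assumes "real_distribution \<mu>" "real_distribution \<nu>"
  shows "mutual_energy \<mu> \<nu> = mutual_energy \<nu> \<mu>"
proof -
  interpret M: real_distribution \<mu> by fact
  interpret N: real_distribution \<nu> by fact
  interpret NM: pair_prob_space \<nu> \<mu> ..
  show ?thesis
    unfolding mutual_energy_def by (subst NM.Fubini') (simp_all add: reg_kernel_commute)
qed

text \<open>The mixture is a fair coin toss followed by the chosen measure, so the monadic bind
  supplies the probability space and the integral formula. The factor 2 on the left avoids halving
  in \<open>ennreal\<close>.\<close>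

lemma midpoint_measure:
  assumes "real_distribution \<mu>" "real_distribution \<nu>"
  shows "\<exists>\<rho>. real_distribution \<rho> \<and>
    (\<forall>f\<in>borel_measurable borel. 2 * (\<integral>\<^sup>+x. f x \<partial>\<rho>) = (\<integral>\<^sup>+x. f x \<partial>\<mu>) + (\<integral>\<^sup>+x. f x \<partial>\<nu>))"
proof -
  interpret M: real_distribution \<mu> by fact
  interpret N: real_distribution \<nu> by fact
  let ?B = "measure_pmf (bernoulli_pmf (1/2))" and ?N = "\<lambda>b. if b then \<mu> else \<nu>"
  have N: "?N \<in> measurable ?B (subprob_algebra borel)"
    by (auto simp: space_subprob_algebra M.subprob_space_axioms N.subprob_space_axioms)
  have "prob_space (?B \<bind> ?N)"
    by (intro measure_pmf.prob_space_bind[OF _ N]) (auto simp: M.prob_space_axioms N.prob_space_axioms)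
  moreover have "sets (?B \<bind> ?N) = sets borel"
    by (subst sets_bind[where N=borel]) auto
  moreover have "2 * (\<integral>\<^sup>+x. f x \<partial>(?B \<bind> ?N)) = (\<integral>\<^sup>+x. f x \<partial>\<mu>) + (\<integral>\<^sup>+x. f x \<partial>\<nu>)"
    if "f \<in> borel_measurable borel" for f
  proof -
    have h: "2 * (a * ennreal (1/2)) = a" for a :: ennreal
      by (metis ennreal_mult'' ennreal_numeral ennreal_1 mult.assoc mult.commute mult.right_neutral
          nonzero_eq_divide_eq zero_le_numeral zero_neq_numeral divide_nonneg_nonneg zero_le_one)
    show ?thesis using nn_integral_bind[OF that N] h[of "\<integral>\<^sup>+x. f x \<partial>\<mu>"] h[of "\<integral>\<^sup>+x. f x \<partial>\<nu>"]
      by (simp add: distrib_left)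
  qed
  ultimately show ?thesis
    by (auto simp: real_distribution_def real_distribution_axioms_def)
qed

context confined
begin

text \<open>Both minimizers are compared with their midpoint \<open>\<rho>\<close>. Since
  \<open>4 * mutual_energy \<rho> \<rho>\<close> contains the cross term
  \<open>2 * mutual_energy \<mu> \<nu>\<close>, minimality forces the defect of positive
  definiteness to vanish.\<close>

lemma minimizer_unique:
  assumes "is_energy_minimizer V \<mu>" "is_energy_minimizer V \<nu>"
  shows "\<mu> = \<nu>"
proof -
  have \<mu>: "real_distribution \<mu>" "J \<mu> < \<infinity>" "\<And>\<rho>. real_distribution \<rho> \<Longrightarrow> J \<mu> \<le> J \<rho>"
    and \<nu>: "real_distribution \<nu>" "J \<nu> < \<infinity>" "\<And>\<rho>. real_distribution \<rho> \<Longrightarrow> J \<nu> \<le> J \<rho>"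
    using assms by (auto simp: is_energy_minimizer_iff)
  obtain \<rho> where \<rho>: "real_distribution \<rho>"
    and int: "\<And>f. f \<in> borel_measurable borel \<Longrightarrow> 2 * (\<integral>\<^sup>+x. f x \<partial>\<rho>) = (\<integral>\<^sup>+x. f x \<partial>\<mu>) + (\<integral>\<^sup>+x. f x \<partial>\<nu>)"
    using midpoint_measure[OF \<mu>(1) \<nu>(1)] by auto
  interpret M: real_distribution \<mu> by fact
  interpret N: real_distribution \<nu> by fact
  interpret R: real_distribution \<rho> by fact
  let ?a = "mutual_energy \<mu> \<mu>" and ?b = "mutual_energy \<nu> \<nu>" and ?m = "mutual_energy \<mu> \<nu>"
  let ?q = "\<lambda>\<mu>. \<integral>\<^sup>+x. ennreal (Q x) \<partial>\<mu>"
  have left: "2 * mutual_energy \<rho> \<kappa> = mutual_energy \<mu> \<kappa> + mutual_energy \<nu> \<kappa>" if "real_distribution \<kappa>" for \<kappa>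
  proof -
    interpret L: real_distribution \<kappa> by fact
    show ?thesis unfolding mutual_energy_def by (rule int) measurable
  qed
  have "4 * mutual_energy \<rho> \<rho> = 2 * mutual_energy \<mu> \<rho> + 2 * mutual_energy \<nu> \<rho>"
    using left[OF \<rho>] by (metis distrib_left mult.assoc mult_2 mult_numeral_1_right numeral_Bit0 one_eq_numeral_iff)
  also have "\<dots> = ?a + ?b + 2 * ?m"
    using left[OF \<mu>(1)] left[OF \<nu>(1)] mutual_energy_commute[OF \<rho> \<mu>(1)] mutual_energy_commute[OF \<rho> \<nu>(1)]
      mutual_energy_commute[OF \<mu>(1) \<nu>(1)] by (simp add: mult_2 ac_simps)
  finally have m: "4 * mutual_energy \<rho> \<rho> = ?a + ?b + 2 * ?m" .
  have q: "2 * ?q \<rho> = ?q \<mu> + ?q \<nu>" by (rule int) measurable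
  have "2 * J \<mu> + 2 * J \<nu> \<le> 4 * J \<rho>"
    using add_mono[OF mult_left_mono[OF \<mu>(3)[OF \<rho>], of 2] mult_left_mono[OF \<nu>(3)[OF \<rho>], of 2]]
    by (simp flip: distrib_right)
  also have "4 * J \<rho> = ?a + ?b + 2 * ?m + 4 * (?q \<mu> + ?q \<nu>)"
    unfolding J_def distrib_left m q[symmetric] by (simp add: mult.assoc[symmetric])
  finally have le: "2 * J \<mu> + 2 * J \<nu> \<le> ?a + ?b + 2 * ?m + 4 * (?q \<mu> + ?q \<nu>)" .
  have fin: "?a < \<infinity>" "?b < \<infinity>" "?q \<mu> < \<infinity>" "?q \<nu> < \<infinity>"
    using \<mu>(2) \<nu>(2) by (auto simp: J_def ennreal_mult_less_top)
  have fm: "?m < \<infinity>"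
  proof -
    have "2 * ?m < \<infinity>"
      using mutual_energy_le[OF \<mu>(1) \<nu>(1)] fin by (auto intro: le_less_trans)
    then show ?thesis by (auto simp: ennreal_mult_less_top)
  qed
  obtain a b p r n where r: "?a = ennreal a" "?b = ennreal b" "?q \<mu> = ennreal p" "?q \<nu> = ennreal r" "?m = ennreal n"
     "a \<ge> 0" "b \<ge> 0" "p \<ge> 0" "r \<ge> 0" "n \<ge> 0"
    using fin fm unfolding infinity_ennreal_def less_top_ennreal by blast
  have "ennreal (2 * (a + 2 * p) + 2 * (b + 2 * r)) \<le> ennreal (a + b + 2 * n + 4 * (p + r))"
    using le unfolding J_def r using r(6-) by (simp add: ennreal_mult' ennreal_plus)
  then have "a + b \<le> 2 * n" using r(6-) by (subst (asm) ennreal_le_iff) auto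
  then have "?a + ?b \<le> 2 * ?m"
    unfolding r using r(6-) by (simp add: ennreal_mult'[symmetric] flip: ennreal_plus ennreal_numeral)
  then show ?thesis
    using fin by (intro mutual_energy_eq_imp_eq \<mu> \<nu>) auto
qed

end

section \<open>Euler--Lagrange conditions and existence of minimizers\<close>

text \<open>An integrable majorant for the logarithmic singularity. Each side of \<open>x\<close>
  contributes at most 2, uniformly in \<open>x\<close>.\<close>

lemma nn_integral_log_singularity:
  "(\<integral>\<^sup>+y. ennreal (indicator {x-1..x+1} y * \<bar>x - y\<bar> powr (-1/2)) \<partial>lborel) \<le> 4"
proof -
  let ?h = "\<lambda>t::real. ennreal (t powr (-1/2)) * indicator {0..1} t"
  have h: "(\<integral>\<^sup>+t. ?h t \<partial>lborel) = 2"
    using nn_integral_has_integral_lebesgue'[OF _ has_integral_powr_from_0[of "-1/2" 1]] by simp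
  have "(\<integral>\<^sup>+y. ennreal (indicator {x-1..x+1} y * \<bar>x - y\<bar> powr (-1/2)) \<partial>lborel)
    \<le> (\<integral>\<^sup>+y. ?h (y - x) + ?h (x - y) \<partial>lborel)"
    by (intro nn_integral_mono) (auto simp: indicator_def abs_if)
  also have "\<dots> = (\<integral>\<^sup>+y. ?h (y - x) \<partial>lborel) + (\<integral>\<^sup>+y. ?h (x - y) \<partial>lborel)"
    by (intro nn_integral_add) measurable
  also have "(\<integral>\<^sup>+y. ?h (y - x) \<partial>lborel) = (\<integral>\<^sup>+t. ?h t \<partial>lborel)"
    using nn_integral_real_affine[of ?h 1 "-x"] by simp
  also have "(\<integral>\<^sup>+y. ?h (x - y) \<partial>lborel) = (\<integral>\<^sup>+t. ?h t \<partial>lborel)"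
    using nn_integral_real_affine[of ?h "-1" x] by simp
  finally show ?thesis unfolding h by simp
qed

lemma neg_ln_le_powr: "0 < u \<Longrightarrow> - ln u \<le> 2 * (u::real) powr (-1/2)"
  using ln_le_minus_one[of "u powr (-1/2)"] by (simp add: ln_powr)

text \<open>Boundedness tames the singularity at \<open>y = x\<close>, bounded support the growth of
  the logarithm at infinity; together they make the logarithmic potential finite at every
  \<open>x\<close>.\<close>

locale bounded_density =
  fixes f :: "real \<Rightarrow> real" and R B :: real
  assumes f_measurable [measurable]: "f \<in> borel_measurable borel"
    and f_nonneg: "0 \<le> f y" and f_le: "f y \<le> B" and f_supp: "f y \<noteq> 0 \<Longrightarrow> \<bar>y\<bar> \<le> R"
begin

lemma B_nonneg: "0 \<le> B" using f_nonneg[of 0] f_le[of 0] by linarith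

lemma nn_integral_singularity_le:
  "(\<integral>\<^sup>+y. ennreal (f y) * ennreal (2 * (indicator {x-1..x+1} y * \<bar>x - y\<bar> powr (-1/2))) \<partial>lborel) \<le> ennreal (8 * B)"
proof -
  have "(\<integral>\<^sup>+y. ennreal (f y) * ennreal (2 * (indicator {x-1..x+1} y * \<bar>x - y\<bar> powr (-1/2))) \<partial>lborel)
    \<le> (\<integral>\<^sup>+y. ennreal (2 * B) * ennreal (indicator {x-1..x+1} y * \<bar>x - y\<bar> powr (-1/2)) \<partial>lborel)"
  proof (rule nn_integral_mono)
    fix y
    have "f y * (2 * (indicator {x-1..x+1} y * \<bar>x - y\<bar> powr (-1/2))) \<le> (2 * B) * (indicator {x-1..x+1} y * \<bar>x - y\<bar> powr (-1/2))"
      using f_le[of y] by (simp add: mult_right_mono mult.assoc mult.left_commute[of _ 2])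
    then show "ennreal (f y) * ennreal (2 * (indicator {x-1..x+1} y * \<bar>x - y\<bar> powr (-1/2)))
       \<le> ennreal (2 * B) * ennreal (indicator {x-1..x+1} y * \<bar>x - y\<bar> powr (-1/2))"
      using f_nonneg[of y] B_nonneg by (simp add: ennreal_leI flip: ennreal_mult)
  qed
  also have "\<dots> \<le> ennreal (2 * B) * 4"
    by (subst nn_integral_cmult, measurable) (intro mult_left_mono nn_integral_log_singularity zero_le)
  also have "\<dots> = ennreal (8 * B)"
  proof -
    have "ennreal (2 * B) * 4 = ennreal (2 * B * 4)"
      by (subst ennreal_mult'') auto
    then show ?thesis by simp
  qed
  finally show ?thesis .
qed

lemma integrable_bounded_times:
  assumes [measurable]: "g \<in> borel_measurable borel" and g: "\<And>y. \<bar>y\<bar> \<le> R \<Longrightarrow> \<bar>g y\<bar> \<le> G"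
  shows "integrable lborel (\<lambda>y. f y * g y)"
proof (rule Bochner_Integration.integrable_bound[where f="\<lambda>y. indicator {-R..R} y * (B * \<bar>G\<bar>)"])
  show "integrable lborel (\<lambda>y. indicator {-R..R} y * (B * \<bar>G\<bar>))"
    by (intro integrable_mult_left integrable_real_indicator) (auto simp: emeasure_lborel_Icc_eq)
  show "AE y in lborel. norm (f y * g y) \<le> norm (indicator {-R..R} y * (B * \<bar>G\<bar>))"
  proof (rule AE_I2)
    fix y
    show "norm (f y * g y) \<le> norm (indicator {-R..R} y * (B * \<bar>G\<bar>))"
    proof (cases "f y = 0")
      case False
      then have "\<bar>y\<bar> \<le> R" by (rule f_supp)
      moreover have "\<bar>f y\<bar> * \<bar>g y\<bar> \<le> B * \<bar>G\<bar>"
        using g[OF calculation] f_le[of y] f_nonneg[of y] by (intro mult_mono) auto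
      ultimately show ?thesis using B_nonneg by (auto simp: abs_mult abs_le_iff)
    qed simp
  qed
qed measurable

lemma integrable_density: "integrable lborel f"
  using integrable_bounded_times[of "\<lambda>_. 1" 1] by simp

lemma integrable_log: "integrable lborel (\<lambda>y. f y * ln \<bar>x - y\<bar>)"
proof -
  let ?s = "\<lambda>y. f y * (2 * (indicator {x-1..x+1} y * \<bar>x - y\<bar> powr (-1/2)))"
  have s: "integrable lborel ?s"
  proof (rule integrableI_nonneg)
    have "(\<integral>\<^sup>+y. ennreal (?s y) \<partial>lborel) \<le> ennreal (8 * B)"
      unfolding ennreal_mult'[OF f_nonneg] by (rule nn_integral_singularity_le)
    then show "(\<integral>\<^sup>+y. ennreal (?s y) \<partial>lborel) < \<infinity>"
      by (rule le_less_trans) simp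
  qed (use f_nonneg in auto)
  have t: "integrable lborel (\<lambda>y. f y * \<bar>x - y\<bar>)"
    by (rule integrable_bounded_times[where G="\<bar>x\<bar> + R"]) auto
  show ?thesis
  proof (rule Bochner_Integration.integrable_bound[OF Bochner_Integration.integrable_add[OF s t]])
    show "AE y in lborel. norm (f y * ln \<bar>x - y\<bar>) \<le> norm (?s y + f y * \<bar>x - y\<bar>)"
    proof (rule AE_I2)
      fix y
      have "\<bar>ln \<bar>x - y\<bar>\<bar> \<le> 2 * (indicator {x-1..x+1} y * \<bar>x - y\<bar> powr (-1/2)) + \<bar>x - y\<bar>"
      proof (cases "\<bar>x - y\<bar> \<le> 1")
        case True
        show ?thesis
        \<comment> \<open>At \<open>y = x\<close> the convention \<open>ln 0 = 0\<close> makes the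
          bound trivial.\<close>
        proof (cases "x = y")
          case False
          then show ?thesis
            using True neg_ln_le_powr[of "\<bar>x - y\<bar>"] ln_le_zero_iff[of "\<bar>x - y\<bar>"]
            by (auto simp: abs_if indicator_def split: if_splits)
        qed simp
      next
        case False
        show ?thesis
        proof -
          have "\<bar>ln \<bar>x - y\<bar>\<bar> \<le> \<bar>x - y\<bar>"
            using False ln_le_minus_one[of "\<bar>x - y\<bar>"] ln_ge_zero[of "\<bar>x - y\<bar>"] by linarith
          moreover have "0 \<le> indicator {x-1..x+1} y * \<bar>x - y\<bar> powr (-1/2)" by simp
          ultimately show ?thesis by linarith
        qed
      qed
      then have "f y * \<bar>ln \<bar>x - y\<bar>\<bar> \<le> f y * (2 * (indicator {x-1..x+1} y * \<bar>x - y\<bar> powr (-1/2)) + \<bar>x - y\<bar>)"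
        using f_nonneg by (intro mult_left_mono)
      then show "norm (f y * ln \<bar>x - y\<bar>) \<le> norm (?s y + f y * \<bar>x - y\<bar>)"
        using f_nonneg[of y] by (simp add: abs_mult distrib_left)
    qed
  qed measurable
qed

end

locale bounded_prob_density = bounded_density +
  assumes total: "(\<integral>y. f y \<partial>lborel) = 1"
begin

definition \<mu> :: "real measure" where "\<mu> = density lborel (\<lambda>x. ennreal (f x))"

lemma real_distribution_density: "real_distribution \<mu>"
proof -
  have "prob_space \<mu>"
  proof
    show "emeasure \<mu> (space \<mu>) = 1"
      unfolding \<mu>_def using integrable_density f_nonneg total
      by (simp add: emeasure_density nn_integral_eq_integral)
  qed
  then show ?thesis by (auto simp: real_distribution_def real_distribution_axioms_def \<mu>_def)
qed

lemma nn_integral_density: "g \<in> borel_measurable borel \<Longrightarrow> (\<integral>\<^sup>+y. g y \<partial>\<mu>) = (\<integral>\<^sup>+y. ennreal (f y) * g y \<partial>lborel)"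
  unfolding \<mu>_def by (subst nn_integral_density) auto

text \<open>Translates back to the logarithmic potential: the added logarithms contribute a term in
  \<open>x\<close> and the constant \<open>c\<close>. Nonnegativity is recorded separately because
  \<open>ennreal\<close> would truncate a negative value to 0.\<close>

lemma nn_integral_reg_kernel:
  defines "c \<equiv> \<integral>y. f y * (ln (1 + 2 * y\<^sup>2) / 2) \<partial>lborel"
  shows "(\<integral>\<^sup>+y. reg_kernel x y \<partial>\<mu>) = ennreal (- (\<integral>y. f y * ln \<bar>x - y\<bar> \<partial>lborel) + ln (1 + 2 * x\<^sup>2) / 2 + c)"
    and "0 \<le> - (\<integral>y. f y * ln \<bar>x - y\<bar> \<partial>lborel) + ln (1 + 2 * x\<^sup>2) / 2 + c"
proof -
  have bd: "\<bar>ln (1 + 2 * y\<^sup>2) / 2\<bar> \<le> ln (1 + 2 * R\<^sup>2) / 2" if "\<bar>y\<bar> \<le> R" for y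
  proof -
    have "y\<^sup>2 \<le> R\<^sup>2" using power_mono[OF that, of 2] by simp
    then show ?thesis using ln_ge_zero[of "1 + 2 * y\<^sup>2"] by (simp add: add_pos_nonneg)
  qed
  have i: "integrable lborel (\<lambda>y. f y * (ln (1 + 2 * y\<^sup>2) / 2))"
    by (rule integrable_bounded_times[OF _ bd]) auto
  have j: "integrable lborel (\<lambda>y. - (f y * ln \<bar>x - y\<bar>) + f y * (ln (1 + 2 * x\<^sup>2) / 2) + f y * (ln (1 + 2 * y\<^sup>2) / 2))"
    by (intro Bochner_Integration.integrable_add integrable_minus i integrable_log integrable_mult_left integrable_density)
  have eq: "(\<lambda>y. f y * reg_log x y) = (\<lambda>y. - (f y * ln \<bar>x - y\<bar>) + f y * (ln (1 + 2 * x\<^sup>2) / 2) + f y * (ln (1 + 2 * y\<^sup>2) / 2))"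
    by (auto simp: reg_log_def algebra_simps)
  have ne: "AE y in lborel. y \<noteq> x" by (rule AE_lborel_singleton)
  then have nonneg: "AE y in lborel. 0 \<le> f y * reg_log x y"
    by eventually_elim (use reg_kernel_eq(2)[of x] f_nonneg in auto)
  have "(\<integral>\<^sup>+y. reg_kernel x y \<partial>\<mu>) = (\<integral>\<^sup>+y. ennreal (f y) * reg_kernel x y \<partial>lborel)"
    by (rule nn_integral_density) measurable
  also have "\<dots> = (\<integral>\<^sup>+y. ennreal (f y * reg_log x y) \<partial>lborel)"
    using ne by (intro nn_integral_cong_AE, eventually_elim) (auto simp: reg_kernel_eq ennreal_mult f_nonneg)
  also have "\<dots> = ennreal (\<integral>y. f y * reg_log x y \<partial>lborel)"
    by (intro nn_integral_eq_integral nonneg) (simp only: eq j)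
  also have int: "(\<integral>y. f y * reg_log x y \<partial>lborel) = - (\<integral>y. f y * ln \<bar>x - y\<bar> \<partial>lborel) + ln (1 + 2 * x\<^sup>2) / 2 + c"
    unfolding eq c_def using i integrable_log integrable_density by (simp add: total)
  finally show "(\<integral>\<^sup>+y. reg_kernel x y \<partial>\<mu>) = ennreal (- (\<integral>y. f y * ln \<bar>x - y\<bar> \<partial>lborel) + ln (1 + 2 * x\<^sup>2) / 2 + c)" .
  show "0 \<le> - (\<integral>y. f y * ln \<bar>x - y\<bar> \<partial>lborel) + ln (1 + 2 * x\<^sup>2) / 2 + c"
    using integral_nonneg_AE[OF nonneg] int by simp
qed

end

section \<open>Sufficiency of the Euler-Lagrange conditions\<close>

context confined
begin

text \<open>Integrating the Euler-Lagrange inequality against a competitor \<open>\<nu>\<close>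
  shows that the linear functional \<open>mutual_energy \<nu> \<mu>\<close> plus the integral of
  \<open>Q\<close> is least at \<open>\<nu> = \<mu>\<close>. Positive definiteness bounds the cross
  term by self-energies, which turns this into minimality of \<open>J\<close>.\<close>

lemma Euler_Lagrange_minimizer:
  assumes "bounded_prob_density f R B"
  defines "\<mu> \<equiv> density lborel (\<lambda>x. ennreal (f x))"
  assumes le: "\<And>x. 2 * (\<integral>y. f y * ln \<bar>x - y\<bar> \<partial>lborel) - poly V x \<le> l"
    and eq: "\<And>x. f x \<noteq> 0 \<Longrightarrow> 2 * (\<integral>y. f y * ln \<bar>x - y\<bar> \<partial>lborel) - poly V x = l"
  shows "is_energy_minimizer V \<mu>"
proof -
  interpret F: bounded_prob_density f R B by fact
  have \<mu>: "real_distribution \<mu>" using F.real_distribution_density by (simp add: F.\<mu>_def \<mu>_def)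
  interpret M: real_distribution \<mu> by fact
  define c where "c = (\<integral>y. f y * (ln (1 + 2 * y\<^sup>2) / 2) \<partial>lborel)"
  define g where "g x = - (\<integral>y. f y * ln \<bar>x - y\<bar> \<partial>lborel) + ln (1 + 2 * x\<^sup>2) / 2 + c" for x
  \<comment> \<open>The Lagrange constant in regularised form: the value of \<open>g x + Q x\<close>
    wherever the density is nonzero, and a lower bound elsewhere.\<close>
  define \<Lambda> where "\<Lambda> = - l / 2 + c + C"
  have g: "(\<integral>\<^sup>+y. reg_kernel x y \<partial>\<mu>) = ennreal (g x)" "0 \<le> g x" for x
    using F.nn_integral_reg_kernel[of x] by (auto simp: g_def c_def F.\<mu>_def \<mu>_def)
  have [measurable]: "g \<in> borel_measurable borel"
    unfolding g_def by measurable
  have gq: "g x + Q x = \<Lambda> + (l - (2 * (\<integral>y. f y * ln \<bar>x - y\<bar> \<partial>lborel) - poly V x)) / 2" for x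
    by (simp add: g_def \<Lambda>_def reduced_potential_def field_simps)
  have gq_le: "\<Lambda> \<le> g x + Q x" for x using le[of x] unfolding gq by simp
  have "\<exists>x. f x \<noteq> 0"
  proof (rule ccontr)
    assume "\<not> (\<exists>x. f x \<noteq> 0)"
    then show False using F.total by simp
  qed
  \<comment> \<open>Otherwise \<open>ennreal \<Lambda>\<close> would collapse to 0. As the density
    is nonzero somewhere, \<open>\<Lambda>\<close> is a value of the nonnegative function
    \<open>g + Q\<close>.\<close>
  then have \<Lambda>: "0 \<le> \<Lambda>" using gq eq g(2) Q_nonneg by (metis add_0_iff add_nonneg_nonneg diff_self div_0)
  let ?q = "\<lambda>\<mu>. \<integral>\<^sup>+x. ennreal (Q x) \<partial>\<mu>"
  have pot: "mutual_energy \<nu> \<mu> + ?q \<nu> = (\<integral>\<^sup>+x. ennreal (g x + Q x) \<partial>\<nu>)" if "real_distribution \<nu>" for \<nu>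
  proof -
    interpret N: real_distribution \<nu> by fact
    show ?thesis
      using g Q_nonneg by (simp add: mutual_energy_def nn_integral_add[symmetric] ennreal_plus)
  qed
  have ge: "ennreal \<Lambda> \<le> mutual_energy \<nu> \<mu> + ?q \<nu>" if "real_distribution \<nu>" for \<nu>
  proof -
    interpret N: real_distribution \<nu> by fact
    have "ennreal \<Lambda> = (\<integral>\<^sup>+x. ennreal \<Lambda> \<partial>\<nu>)" by (simp add: N.emeasure_space_1[simplified])
    also have "\<dots> \<le> (\<integral>\<^sup>+x. ennreal (g x + Q x) \<partial>\<nu>)" using gq_le by (intro nn_integral_mono ennreal_leI)
    finally show ?thesis unfolding pot[OF that] .
  qed
  have self: "mutual_energy \<mu> \<mu> + ?q \<mu> = ennreal \<Lambda>"
  proof -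
    have "(\<integral>\<^sup>+x. ennreal (g x + Q x) \<partial>\<mu>) = (\<integral>\<^sup>+x. ennreal (f x) * ennreal (g x + Q x) \<partial>lborel)"
      using F.nn_integral_density[of "\<lambda>x. ennreal (g x + Q x)"] by (simp add: F.\<mu>_def \<mu>_def)
    also have "\<dots> = (\<integral>\<^sup>+x. ennreal (f x) * ennreal \<Lambda> \<partial>lborel)"
    proof (rule nn_integral_cong)
      fix x show "ennreal (f x) * ennreal (g x + Q x) = ennreal (f x) * ennreal \<Lambda>"
        using eq[of x] gq[of x] by (cases "f x = 0") auto
    qed
    also have "\<dots> = (\<integral>\<^sup>+x. ennreal \<Lambda> \<partial>\<mu>)"
      using F.nn_integral_density[of "\<lambda>x. ennreal \<Lambda>"] by (simp add: F.\<mu>_def \<mu>_def)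
    also have "\<dots> = ennreal \<Lambda>" by (simp add: M.emeasure_space_1[simplified])
    finally show ?thesis unfolding pot[OF \<mu>] .
  qed
  have fin: "mutual_energy \<mu> \<mu> < \<infinity>" "?q \<mu> < \<infinity>"
    using self by (auto simp: less_top[symmetric] dest: sym)
  have "J \<mu> < \<infinity>" using fin by (auto simp: J_def ennreal_mult_less_top)
  moreover have "J \<mu> \<le> J \<nu>" if \<nu>: "real_distribution \<nu>" for \<nu>
  proof -
    \<comment> \<open>Adding one self-energy turns \<open>J \<mu>\<close> into twice the linear
      functional; being finite, it cancels at the end.\<close>
    have "mutual_energy \<mu> \<mu> + J \<mu> = 2 * ennreal \<Lambda>"
      unfolding self[symmetric] J_def by (simp add: mult_2 ac_simps distrib_left)
    also have "\<dots> \<le> 2 * mutual_energy \<nu> \<mu> + 2 * ?q \<nu>"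
      using mult_left_mono[OF ge[OF \<nu>], of 2] by (simp add: distrib_left)
    also have "\<dots> \<le> (mutual_energy \<nu> \<nu> + mutual_energy \<mu> \<mu>) + 2 * ?q \<nu>"
      using mutual_energy_le[OF \<nu> \<mu>] by (intro add_right_mono)
    also have "\<dots> = mutual_energy \<mu> \<mu> + J \<nu>" by (simp add: J_def ac_simps)
    finally show ?thesis using fin by (auto simp: ennreal_add_left_cancel_le)
  qed
  ultimately show ?thesis using \<mu> by (auto simp: is_energy_minimizer_iff)
qed

end

section \<open>Existence of a minimizer by the direct method\<close>

context confined
begin

text \<open>\<open>J\<close> is the triple integral of the continuous function \<open>H s\<close>, so that Fatou's lemma along an almost
  surely convergent Skorohod coupling gives lower semicontinuity.\<close>

definition H :: "real \<Rightarrow> real \<Rightarrow> real \<Rightarrow> real" where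
  "H s x y = level_kernel s x y + 2 * indicator {0..<1} s * Q x"

lemma H_measurable [measurable (raw)]:
  assumes [measurable]: "a \<in> borel_measurable M" "b \<in> borel_measurable M" "c \<in> borel_measurable M"
  shows "(\<lambda>x. H (a x) (b x) (c x)) \<in> borel_measurable M"
  unfolding H_def by measurable

lemma J_lower_semicontinuous:
  assumes "\<And>n. real_distribution (\<nu> n)" "real_distribution \<nu>'" "weak_conv_m \<nu> \<nu>'"
  shows "J \<nu>' \<le> liminf (\<lambda>n. J (\<nu> n))"
proof -
  from Skorohod[OF assms]
  obtain \<Omega> :: "real measure" and Yn Y where \<Omega>: "prob_space \<Omega>"
    and Yn [measurable]: "\<And>n. Yn n \<in> measurable \<Omega> borel" and dYn: "\<And>n. distr \<Omega> borel (Yn n) = \<nu> n"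
    and Y: "Y \<in> measurable \<Omega> lborel" and dY: "distr \<Omega> borel Y = \<nu>'"
    and lim: "\<And>x. x \<in> space \<Omega> \<Longrightarrow> (\<lambda>n. Yn n x) \<longlonglongrightarrow> Y x"
    by metis
  have [measurable]: "Y \<in> measurable \<Omega> borel" using Y by simp
  interpret prob_space \<Omega> by fact
  have J_eq: "J (distr \<Omega> borel Z) = (\<integral>\<^sup>+\<omega>. \<integral>\<^sup>+\<omega>'. \<integral>\<^sup>+s. ennreal (H s (Z \<omega>) (Z \<omega>')) \<partial>lborel \<partial>\<Omega> \<partial>\<Omega>)"
    if [measurable]: "Z \<in> measurable \<Omega> borel" for Z
  proof -
    have "(\<integral>\<^sup>+s. ennreal (H s x y) \<partial>lborel) = reg_kernel x y + 2 * ennreal (Q x)" for x y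
    proof -
      \<comment> \<open>The interval \<open>{0..<1}\<close> carried by \<open>H\<close> has length
        1, so integration over \<open>s\<close> gives back \<open>2 * Q x\<close>.\<close>
      have "(\<integral>\<^sup>+s. ennreal (H s x y) \<partial>lborel)
        = (\<integral>\<^sup>+s. ennreal (level_kernel s x y) + (2 * ennreal (Q x)) * indicator {0..<1} s \<partial>lborel)"
        using Q_nonneg[of x] by (intro nn_integral_cong)
          (auto simp: H_def indicator_def ennreal_plus ennreal_mult)
      also have "\<dots> = reg_kernel x y + 2 * ennreal (Q x)"
        by (subst nn_integral_add) (auto simp: reg_kernel_def nn_integral_cmult_indicator)
      finally show ?thesis .
    qed
    moreover have "J (distr \<Omega> borel Z) = (\<integral>\<^sup>+\<omega>. \<integral>\<^sup>+\<omega>'. reg_kernel (Z \<omega>) (Z \<omega>') + 2 * ennreal (Q (Z \<omega>)) \<partial>\<Omega> \<partial>\<Omega>)"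
      unfolding J_def mutual_energy_def
      by (simp add: nn_integral_distr nn_integral_add nn_integral_cmult emeasure_space_1)
    ultimately show ?thesis by simp
  qed
  \<comment> \<open>At a fixed level the kernel is continuous even on the diagonal; the singularity
    of the logarithm arises only after integration over \<open>s\<close>.\<close>
  have H_lim: "(\<lambda>n. ennreal (H s (Yn n \<omega>) (Yn n \<omega>'))) \<longlonglongrightarrow> ennreal (H s (Y \<omega>) (Y \<omega>'))"
    if "\<omega> \<in> space \<Omega>" "\<omega>' \<in> space \<Omega>" for s \<omega> \<omega>'
  proof -
    have "(\<lambda>n. poly V (Yn n \<omega>)) \<longlonglongrightarrow> poly V (Y \<omega>)"
      by (intro tendsto_poly lim that)
    then show ?thesis
      unfolding H_def level_kernel_def gauss_kernel_def reduced_potential_def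
      by (cases "s = 0") (auto intro!: tendsto_intros lim that simp: add_pos_nonneg add_nonneg_eq_0_iff)
  qed
  have "J \<nu>' = (\<integral>\<^sup>+\<omega>. \<integral>\<^sup>+\<omega>'. \<integral>\<^sup>+s. liminf (\<lambda>n. ennreal (H s (Yn n \<omega>) (Yn n \<omega>'))) \<partial>lborel \<partial>\<Omega> \<partial>\<Omega>)"
    unfolding dY[symmetric] using H_lim
    by (subst J_eq) (auto intro!: nn_integral_cong lim_imp_Liminf[symmetric])
  also have "\<dots> \<le> (\<integral>\<^sup>+\<omega>. \<integral>\<^sup>+\<omega>'. liminf (\<lambda>n. \<integral>\<^sup>+s. ennreal (H s (Yn n \<omega>) (Yn n \<omega>')) \<partial>lborel) \<partial>\<Omega> \<partial>\<Omega>)"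
    by (intro nn_integral_mono nn_integral_liminf) measurable
  also have "\<dots> \<le> (\<integral>\<^sup>+\<omega>. liminf (\<lambda>n. \<integral>\<^sup>+\<omega>'. \<integral>\<^sup>+s. ennreal (H s (Yn n \<omega>) (Yn n \<omega>')) \<partial>lborel \<partial>\<Omega>) \<partial>\<Omega>)"
    by (intro nn_integral_mono nn_integral_liminf) measurable
  also have "\<dots> \<le> liminf (\<lambda>n. \<integral>\<^sup>+\<omega>. \<integral>\<^sup>+\<omega>'. \<integral>\<^sup>+s. ennreal (H s (Yn n \<omega>) (Yn n \<omega>')) \<partial>lborel \<partial>\<Omega> \<partial>\<Omega>)"
    by (intro nn_integral_liminf) measurable
  also have "\<dots> = liminf (\<lambda>n. J (\<nu> n))"
    unfolding dYn[symmetric] by (subst J_eq) auto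
  finally show ?thesis .
qed

lemma tight_of_J_bounded:
  assumes \<nu>: "\<And>n. real_distribution (\<nu> n)" and bd: "\<And>n. J (\<nu> n) \<le> ennreal M"
  shows "tight \<nu>"
proof -
  have "\<exists>a b. a < b \<and> (\<forall>n. measure (\<nu> n) {a<..b} > 1 - \<epsilon>)" if \<epsilon>: "\<epsilon> > 0" for \<epsilon> :: real
  proof -
    define M' where "M' = max M 1"
    \<comment> \<open>Chosen so that Markov's inequality for \<open>\<delta> * x^2\<close> leaves
      mass at most \<open>\<epsilon> / 2\<close> outside, hence a strict bound; \<open>M'\<close>
      keeps the radius positive.\<close>
    define r where "r = sqrt (2 * M' / (\<delta> * \<epsilon>))"
    have r: "r > 0" "\<delta> * r\<^sup>2 = 2 * M' / \<epsilon>" using \<delta>_pos \<epsilon> by (auto simp: r_def M'_def)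
    have "measure (\<nu> n) {-r<..r} > 1 - \<epsilon>" for n
    proof -
      interpret N: real_distribution "\<nu> n" by (rule \<nu>)
      let ?A = "- {-r<..r}"
      have "ennreal (2 * M' / \<epsilon>) * emeasure (\<nu> n) ?A = (\<integral>\<^sup>+x. ennreal (\<delta> * r\<^sup>2) * indicator ?A x \<partial>\<nu> n)"
        unfolding r(2) by (subst nn_integral_cmult_indicator) auto
      also have "\<dots> \<le> (\<integral>\<^sup>+x. ennreal (Q x) \<partial>\<nu> n)"
      proof (rule nn_integral_mono)
        fix x
        show "ennreal (\<delta> * r\<^sup>2) * indicator ?A x \<le> ennreal (Q x)"
        proof (cases "x \<in> ?A")
          case True
          then have "r \<le> \<bar>x\<bar>" by auto
          then have "r\<^sup>2 \<le> x\<^sup>2" using r(1) power_mono[of r "\<bar>x\<bar>" 2] by simp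
          then have "\<delta> * r\<^sup>2 \<le> \<delta> * x\<^sup>2" using \<delta>_pos by (intro mult_left_mono) auto
          then have "\<delta> * r\<^sup>2 \<le> Q x" using coercive[of x] by linarith
          then show ?thesis using True by (simp add: ennreal_leI)
        qed simp
      qed
      also have "\<dots> \<le> J (\<nu> n)"
        unfolding J_def mult_2 by (simp add: add_increasing)
      also have "\<dots> \<le> ennreal M'" using bd[of n] by (rule order.trans) (simp add: M'_def ennreal_leI)
      finally have "2 * M' / \<epsilon> * measure (\<nu> n) ?A \<le> M'"
        using \<epsilon> by (simp add: N.emeasure_eq_measure M'_def ennreal_le_iff flip: ennreal_mult)
      then have "M' * (2 * measure (\<nu> n) ?A) \<le> M' * \<epsilon>" using \<epsilon> by (simp add: field_simps)
      moreover have "0 < M'" by (simp add: M'_def)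
      ultimately have "measure (\<nu> n) ?A \<le> \<epsilon> / 2" by (simp add: mult_le_cancel_left_pos)
      moreover have "measure (\<nu> n) ?A = 1 - measure (\<nu> n) {-r<..r}"
        using N.prob_compl[of "{-r<..r}"] by (simp add: Compl_eq_Diff_UNIV)
      ultimately show ?thesis using \<epsilon> by linarith
    qed
    then show ?thesis using r(1) by (intro exI[of _ "-r"] exI[of _ r]) auto
  qed
  then show ?thesis using \<nu> by (auto simp: tight_def)
qed

text \<open>Ensures that the infimum is finite. The uniform law on \<open>[0, 1]\<close> serves: its
  regularised potential is bounded there, with \<open>ln 3\<close> coming from
  \<open>1 + 2 * z^2 \<le> 3\<close>.\<close>

lemma exists_finite_J: "\<exists>\<nu>. real_distribution \<nu> \<and> J \<nu> < \<infinity>"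
proof -
  interpret U: bounded_prob_density "indicator {0..1}" 1 1
    by standard (auto simp: indicator_eq_0_iff)
  interpret M: real_distribution U.\<mu> by (rule U.real_distribution_density)
  have f_nonneg: "0 \<le> (indicator {0..1} y :: real)" for y :: real by simp
  have "bounded (poly V ` {-1..1})"
    by (intro compact_imp_bounded compact_continuous_image continuous_intros) auto
  then obtain G where "\<forall>y\<in>poly V ` {-1..1}. norm y \<le> G"
    unfolding bounded_iff by blast
  then have Q_le: "\<bar>Q x\<bar> \<le> G + C" if "\<bar>x\<bar> \<le> 1" for x
  proof -
    have "\<bar>poly V x\<bar> \<le> G" using \<open>\<forall>y\<in>poly V ` {-1..1}. norm y \<le> G\<close> that by (auto simp: abs_le_iff)
    moreover have "0 \<le> ln (1 + 2 * x\<^sup>2)" by (rule ln_ge_zero) simp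
    moreover have "0 \<le> Q x" by (rule Q_nonneg)
    ultimately show ?thesis unfolding reduced_potential_def by linarith
  qed
  have Q_int: "integrable lborel (\<lambda>x. indicator {0..1} x * Q x)"
    by (rule U.integrable_bounded_times[OF _ Q_le]) auto
  have "(\<integral>\<^sup>+x. ennreal (Q x) \<partial>U.\<mu>) = (\<integral>\<^sup>+x. ennreal (indicator {0..1} x * Q x) \<partial>lborel)"
    using U.nn_integral_density[of "\<lambda>x. ennreal (Q x)"] by (simp add: ennreal_mult'[OF f_nonneg])
  also have "\<dots> < \<infinity>"
    using Q_int Q_nonneg by (subst nn_integral_eq_integral) auto
  finally have Q_fin: "(\<integral>\<^sup>+x. ennreal (Q x) \<partial>U.\<mu>) < \<infinity>" .
  have reg_kernel_le: "reg_kernel x y \<le> ennreal (2 * (indicator {x-1..x+1} y * \<bar>x - y\<bar> powr (-1/2))) + ennreal (ln 3)"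
    if "x \<in> {0..1}" "y \<in> {0..1}" "x \<noteq> y" for x y
  proof -
    have "ln (1 + 2 * z\<^sup>2) \<le> ln 3" if "z \<in> {0..1}" for z :: real
      using that power_le_one[of z 2] by (subst ln_le_cancel_iff) (auto simp: add_pos_nonneg)
    from this[OF that(1)] this[OF that(2)]
    have "reg_log x y \<le> 2 * (indicator {x-1..x+1} y * \<bar>x - y\<bar> powr (-1/2)) + ln 3"
      using that neg_ln_le_powr[of "\<bar>x - y\<bar>"] by (simp add: reg_log_def)
    then have "reg_kernel x y \<le> ennreal (2 * (indicator {x-1..x+1} y * \<bar>x - y\<bar> powr (-1/2)) + ln 3)"
      unfolding reg_kernel_eq(1)[OF that(3)] by (rule ennreal_leI)
    also have "\<dots> = ennreal (2 * (indicator {x-1..x+1} y * \<bar>x - y\<bar> powr (-1/2))) + ennreal (ln 3)"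
      by (rule ennreal_plus) auto
    finally show ?thesis .
  qed
  have pot: "(\<integral>\<^sup>+y. reg_kernel x y \<partial>U.\<mu>) \<le> ennreal (8 + ln 3)" if x: "x \<in> {0..1}" for x
  proof -
    have "(\<integral>\<^sup>+y. reg_kernel x y \<partial>U.\<mu>) = (\<integral>\<^sup>+y. ennreal (indicator {0..1} y) * reg_kernel x y \<partial>lborel)"
      by (rule U.nn_integral_density) measurable
    also have "\<dots> \<le> (\<integral>\<^sup>+y. ennreal (indicator {0..1} y) * ennreal (2 * (indicator {x-1..x+1} y * \<bar>x - y\<bar> powr (-1/2)))
       + ennreal (indicator {0..1} y) * ennreal (ln 3) \<partial>lborel)"
      using AE_lborel_singleton[of x]
    proof (intro nn_integral_mono_AE, eventually_elim)
      case (elim y)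
      show ?case
      proof (cases "y \<in> {0..1}")
        case True
        then show ?thesis using reg_kernel_le[OF x True] elim by (simp add: indicator_def)
      qed simp
    qed
    also have "\<dots> = (\<integral>\<^sup>+y. ennreal (indicator {0..1} y) * ennreal (2 * (indicator {x-1..x+1} y * \<bar>x - y\<bar> powr (-1/2))) \<partial>lborel)
       + (\<integral>\<^sup>+y. ennreal (indicator {0..1::real} y) * ennreal (ln 3) \<partial>lborel)"
      by (subst nn_integral_add) auto
    also have "(\<integral>\<^sup>+y. ennreal (indicator {0..1::real} y) * ennreal (ln 3) \<partial>lborel) = ennreal (ln 3)"
      using U.nn_integral_density[of "\<lambda>_. ennreal (ln 3)"] by (simp add: M.emeasure_space_1[simplified])
    also have "(\<integral>\<^sup>+y. ennreal (indicator {0..1} y) * ennreal (2 * (indicator {x-1..x+1} y * \<bar>x - y\<bar> powr (-1/2))) \<partial>lborel)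
       + ennreal (ln 3) \<le> ennreal (8 * 1) + ennreal (ln 3)"
      by (intro add_right_mono U.nn_integral_singularity_le)
    finally show ?thesis by simp
  qed
  have "mutual_energy U.\<mu> U.\<mu> = (\<integral>\<^sup>+x. ennreal (indicator {0..1} x) * (\<integral>\<^sup>+y. reg_kernel x y \<partial>U.\<mu>) \<partial>lborel)"
    unfolding mutual_energy_def by (rule U.nn_integral_density) measurable
  also have "\<dots> \<le> (\<integral>\<^sup>+x. ennreal (indicator {0..1::real} x) * ennreal (8 + ln 3) \<partial>lborel)"
    using pot by (intro nn_integral_mono) (auto simp: indicator_def)
  also have "\<dots> = ennreal (8 + ln 3)"
    using U.nn_integral_density[of "\<lambda>_. ennreal (8 + ln 3)"] by (simp add: M.emeasure_space_1[simplified])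
  finally have "mutual_energy U.\<mu> U.\<mu> < \<infinity>" by (rule le_less_trans) simp
  with Q_fin have "J U.\<mu> < \<infinity>" by (auto simp: J_def ennreal_mult_less_top)
  then show ?thesis using U.real_distribution_density by blast
qed

text \<open>A minimizing sequence has bounded \<open>J\<close> and is therefore tight; the weak
  limit of a subsequence is a minimizer by lower semicontinuity.\<close>

lemma exists_minimizer: "\<exists>\<mu>. is_energy_minimizer V \<mu>"
proof -
  let ?A = "J ` {\<nu>. real_distribution \<nu>}"
  obtain \<nu>0 where \<nu>0: "real_distribution \<nu>0" "J \<nu>0 < \<infinity>" using exists_finite_J by auto
  define I where "I = Inf ?A"
  have I_le: "I \<le> J \<nu>" if "real_distribution \<nu>" for \<nu>
    unfolding I_def using that by (intro Inf_lower) auto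
  have I_fin: "I < \<infinity>" using I_le[OF \<nu>0(1)] \<nu>0(2) by (rule le_less_trans)
  have "\<exists>\<nu>. real_distribution \<nu> \<and> J \<nu> < I + ennreal (1 / Suc n)" for n
  proof -
    have "I < I + ennreal (1 / Suc n)"
      using I_fin by (cases I) (auto simp: ennreal_less_iff simp flip: ennreal_plus)
    then show ?thesis unfolding I_def Inf_less_iff by auto
  qed
  then obtain \<nu> where \<nu>: "\<And>n. real_distribution (\<nu> n)" "\<And>n. J (\<nu> n) < I + ennreal (1 / Suc n)"
    by metis
  obtain i where i: "I = ennreal i" "0 \<le> i" using I_fin by (cases I) auto
  have "J (\<nu> n) \<le> ennreal (i + 1)" for n
  proof -
    have "I + ennreal (1 / Suc n) \<le> ennreal (i + 1)"
      unfolding i(1) using i(2) by (simp add: ennreal_leI flip: ennreal_plus)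
    then show ?thesis using \<nu>(2)[of n] by (meson le_less_trans less_imp_le order.strict_trans2)
  qed
  then have "tight \<nu>" by (rule tight_of_J_bounded[OF \<nu>(1)])
  from tight_imp_convergent_subsubsequence[OF this strict_mono_id]
  obtain r \<mu> where r: "strict_mono r" and \<mu>: "real_distribution \<mu>" "weak_conv_m (\<nu> \<circ> r) \<mu>"
    by (auto simp: id_def comp_def)
  have "(\<lambda>n. I + ennreal (1 / Suc n)) \<longlonglongrightarrow> I + ennreal 0"
    by (intro tendsto_intros LIMSEQ_inverse_real_of_nat[unfolded inverse_eq_divide])
  then have "(\<lambda>n. I + ennreal (1 / Suc (r n))) \<longlonglongrightarrow> I"
    using LIMSEQ_subseq_LIMSEQ[OF _ r, of "\<lambda>n. I + ennreal (1 / Suc n)" I] by (simp add: comp_def)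
  then have "liminf (\<lambda>n. I + ennreal (1 / Suc (r n))) = I"
    by (intro lim_imp_Liminf) auto
  moreover have "liminf (\<lambda>n. J ((\<nu> \<circ> r) n)) \<le> liminf (\<lambda>n. I + ennreal (1 / Suc (r n)))"
    unfolding comp_def by (intro Liminf_mono always_eventually allI less_imp_le[OF \<nu>(2)])
  moreover have "J \<mu> \<le> liminf (\<lambda>n. J ((\<nu> \<circ> r) n))"
    using \<nu>(1) \<mu>(1) by (intro J_lower_semicontinuous[OF _ _ \<mu>(2)]) auto
  ultimately have "J \<mu> \<le> I" by simp
  then show ?thesis
    using \<mu>(1) I_fin I_le by (intro exI[of _ \<mu>]) (auto simp: is_energy_minimizer_iff intro: order.trans le_less_trans)
qed

end

text \<open>Existence is indispensable: \<^const>\<open>equilibrium_measure\<close> is a definite description, so without it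
  \<^const>\<open>cut_regular\<close> would not even say that its measure has total mass one.\<close>

lemma ex1_energy_minimizer:
  assumes "confining V"
  shows "\<exists>!\<mu>. is_energy_minimizer V \<mu>"
proof -
  obtain \<delta> C where "confined V \<delta> C"
    using confining_reduced_potential[OF assms] by (auto simp: confined_def)
  then interpret confined V \<delta> C .
  show ?thesis using exists_minimizer minimizer_unique by blast
qed

section \<open>The semicircle law\<close>

text \<open>The polynomial \<open>p\<close> stands for \<open>|h|/c\<close>: a polynomial without zeros on the support has constant sign there.\<close>

definition cut_density :: "real \<Rightarrow> real \<Rightarrow> real poly \<Rightarrow> real \<Rightarrow> real" where
  "cut_density \<alpha> \<beta> p y = indicator {\<alpha>..\<beta>} y * (sqrt ((y - \<alpha>) * (\<beta> - y)) * poly p y)"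

lemma cut_density_measurable [measurable]: "cut_density \<alpha> \<beta> p \<in> borel_measurable borel"
proof -
  have [measurable]: "poly p \<in> borel_measurable borel"
    by (intro borel_measurable_continuous_onI continuous_intros)
  show ?thesis unfolding cut_density_def by measurable
qed

lemma bounded_density_cut_density:
  assumes "\<And>y. y \<in> {\<alpha>..\<beta>} \<Longrightarrow> 0 \<le> poly p y"
  shows "\<exists>R B. bounded_density (cut_density \<alpha> \<beta> p) R B"
proof -
  have "bounded ((\<lambda>y. sqrt ((y - \<alpha>) * (\<beta> - y)) * poly p y) ` {\<alpha>..\<beta>})"
    by (intro compact_imp_bounded compact_continuous_image continuous_intros) auto
  then obtain B where B: "\<forall>z\<in>(\<lambda>y. sqrt ((y - \<alpha>) * (\<beta> - y)) * poly p y) ` {\<alpha>..\<beta>}. norm z \<le> B"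
    unfolding bounded_iff by blast
  have "bounded_density (cut_density \<alpha> \<beta> p) (max \<bar>\<alpha>\<bar> \<bar>\<beta>\<bar>) (max B 0)"
  proof
    fix y
    show "0 \<le> cut_density \<alpha> \<beta> p y"
      using assms[of y] by (auto simp: cut_density_def indicator_def)
    show "cut_density \<alpha> \<beta> p y \<le> max B 0"
    proof (cases "y \<in> {\<alpha>..\<beta>}")
      case True
      then have "\<bar>sqrt ((y - \<alpha>) * (\<beta> - y)) * poly p y\<bar> \<le> B" using B by auto
      then show ?thesis using True by (simp add: cut_density_def)
    qed (simp add: cut_density_def)
    show "\<bar>y\<bar> \<le> max \<bar>\<alpha>\<bar> \<bar>\<beta>\<bar>" if "cut_density \<alpha> \<beta> p y \<noteq> 0"
      using that by (auto simp: cut_density_def indicator_eq_0_iff)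
  qed measurable
  then show ?thesis by blast
qed

section \<open>Logarithmic potential of the semicircle law in Joukowski coordinates\<close>

lemma integral_cos_multiple:
  fixes k :: real
  assumes "sin (k * pi) = 0" "k \<noteq> 0"
  shows "has_bochner_integral lborel (\<lambda>\<theta>. cos (k * \<theta>) * indicator {0..pi} \<theta>) 0"
proof -
  have "has_bochner_integral lborel (\<lambda>\<theta>. cos (k * \<theta>) * indicator {0..pi} \<theta>) (sin (k * pi) / k - sin (k * 0) / k)"
    using assms(2) by (intro has_bochner_integral_FTC_Icc_real) (auto intro!: derivative_eq_intros)
  then show ?thesis using assms by simp
qed

text \<open>Since \<open>sin^2\<close> is \<open>(1 - cos (2 * \<theta>)) / 2\<close>, only the
  frequencies 0 and 2 survive; this gives the semicircle potential its closed form.\<close>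

lemma integral_sin_squared_cos:
  "has_bochner_integral lborel (\<lambda>\<theta>. (sin \<theta>)\<^sup>2 * cos (real n * \<theta>) * indicator {0..pi} \<theta>)
    (if n = 0 then pi / 2 else if n = 2 then - pi / 4 else 0)"
proof -
  have one: "has_bochner_integral lborel (\<lambda>\<theta>. 1 * indicator {0..pi} \<theta>) (pi - 0)"
    by (intro has_bochner_integral_FTC_Icc_real) auto
  have c: "has_bochner_integral lborel (\<lambda>\<theta>. cos (k * \<theta>) * indicator {0..pi} \<theta>) (if k = 0 then pi else 0)"
    if "sin (k * pi) = 0" for k :: real
    using one integral_cos_multiple[OF that] by auto
  have s: "sin ((real n + 2) * pi) = 0" "sin ((real n - 2) * pi) = 0" "sin (real n * pi) = 0"
    by (simp_all add: sin_add sin_diff algebra_simps)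
  have "has_bochner_integral lborel (\<lambda>\<theta>. (1/2) * (cos (real n * \<theta>) * indicator {0..pi} \<theta>)
     - (1/4) * (cos ((real n + 2) * \<theta>) * indicator {0..pi} \<theta> + cos ((real n - 2) * \<theta>) * indicator {0..pi} \<theta>))
     ((1/2) * (if real n = 0 then pi else 0) - (1/4) * ((if real n + 2 = 0 then pi else 0) + (if real n - 2 = 0 then pi else 0)))"
    by (intro has_bochner_integral_diff has_bochner_integral_add has_bochner_integral_mult_right c s)
  also have "((1/2) * (if real n = 0 then pi else 0) - (1/4) * ((if real n + 2 = 0 then pi else 0) + (if real n - 2 = 0 then pi else 0)))
     = (if n = 0 then pi / 2 else if n = 2 then - pi / 4 else 0)"
    by auto
  also have "(\<lambda>\<theta>. (1/2) * (cos (real n * \<theta>) * indicator {0..pi} \<theta>)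
     - (1/4) * (cos ((real n + 2) * \<theta>) * indicator {0..pi} \<theta> + cos ((real n - 2) * \<theta>) * indicator {0..pi} \<theta>))
    = (\<lambda>\<theta>. (sin \<theta>)\<^sup>2 * cos (real n * \<theta>) * indicator {0..pi} \<theta>)"
  proof
    fix \<theta>
    have "(1/2) * cos (real n * \<theta>) - (1/4) * (cos ((real n + 2) * \<theta>) + cos ((real n - 2) * \<theta>))
       = (1/2) * cos (real n * \<theta>) - (1/2) * (cos (real n * \<theta>) * cos (2 * \<theta>))"
      by (simp add: distrib_right left_diff_distrib cos_add cos_diff)
    also have "\<dots> = (sin \<theta>)\<^sup>2 * cos (real n * \<theta>)"
      unfolding cos_double_sin by (simp add: algebra_simps)
    finally show "(1/2) * (cos (real n * \<theta>) * indicator {0..pi} \<theta>)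
     - (1/4) * (cos ((real n + 2) * \<theta>) * indicator {0..pi} \<theta> + cos ((real n - 2) * \<theta>) * indicator {0..pi} \<theta>)
      = (sin \<theta>)\<^sup>2 * cos (real n * \<theta>) * indicator {0..pi} \<theta>"
      by (auto simp: indicator_def)
  qed
  finally show ?thesis .
qed

text \<open>Real part of the power series of \<open>-Ln (1 - cis a / r)\<close>, as the squared
  modulus of \<open>r - cis a\<close> is \<open>r^2 + 1 - 2 * r * cos a\<close>. The term
  \<open>n = 0\<close> is 0 by the convention for division by zero.\<close>

lemma log_modulus_series:
  fixes r a :: real
  assumes "r > 1"
  shows "(\<lambda>n. cos (real n * a) / (real n * r ^ n)) sums (- (ln (r\<^sup>2 + 1 - 2 * r * cos a) / 2 - ln r))"
proof -
  let ?z = "- (cis a / complex_of_real r)"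
  have "cmod ?z < 1" using assms by (simp add: norm_divide)
  from sums_Re[OF sums_minus[OF Ln_series'[OF this]]]
  have 1: "(\<lambda>n. Re ((cis a / complex_of_real r) ^ n / of_nat n)) sums - Re (Ln (1 + ?z))"
    by simp
  have 2: "Re ((cis a / complex_of_real r) ^ n / of_nat n) = cos (real n * a) / (real n * r ^ n)" for n
  proof -
    have "(cis a / complex_of_real r) ^ n / of_nat n = cis (real n * a) / complex_of_real (real n * r ^ n)"
      by (simp only: power_divide Complex.DeMoivre of_real_mult of_real_power of_real_of_nat_eq divide_divide_eq_left mult.commute)
    then show ?thesis by (simp only: Re_divide_of_real cis.simps)
  qed
  have nz: "1 + ?z \<noteq> 0"
  proof
    assume "1 + ?z = 0"
    then have "cmod ?z = 1" by (metis add.inverse_unique norm_minus_cancel norm_one)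
    then show False using \<open>cmod ?z < 1\<close> by simp
  qed
  have "(cmod (1 + ?z))\<^sup>2 = (1 - cos a / r)\<^sup>2 + (sin a / r)\<^sup>2"
    by (simp add: cmod_def)
  also have "\<dots> = 1 - 2 * cos a / r + ((sin a)\<^sup>2 + (cos a)\<^sup>2) / r\<^sup>2"
    using add_divide_distrib[of "(cos a)\<^sup>2" "(sin a)\<^sup>2" "r\<^sup>2"]
    by (simp add: power2_diff power_divide)
  also have "\<dots> = (r\<^sup>2 + 1 - 2 * r * cos a) / r\<^sup>2"
    using assms by (simp add: field_simps power2_eq_square)
  finally have m: "(cmod (1 + ?z))\<^sup>2 = (r\<^sup>2 + 1 - 2 * r * cos a) / r\<^sup>2" .
  then have pos: "r\<^sup>2 + 1 - 2 * r * cos a > 0"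
    using nz assms by (metis zero_less_norm_iff zero_less_power zero_less_divide_iff not_less_iff_gr_or_eq zero_le_power2 not_le)
  have "Re (Ln (1 + ?z)) = ln (cmod (1 + ?z))" using nz by simp
  also have "2 * \<dots> = ln ((cmod (1 + ?z))\<^sup>2)" using nz by (subst ln_realpow) auto
  also have "\<dots> = ln (r\<^sup>2 + 1 - 2 * r * cos a) - 2 * ln r"
    unfolding m using pos assms by (subst ln_div) (auto simp: ln_realpow)
  finally have "Re (Ln (1 + ?z)) = ln (r\<^sup>2 + 1 - 2 * r * cos a) / 2 - ln r" by simp
  then show ?thesis using 1 unfolding 2 by simp
qed

text \<open>For \<open>z = r cis \<phi>\<close> this is \<open>|z - cis \<theta>|\<^sup>2 |z - cis (-\<theta>)|\<^sup>2 = r\<^sup>2 |w - 2 cos \<theta>|\<^sup>2\<close> where \<open>w = z + 1/z\<close>.\<close>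

definition joukowski_product :: "real \<Rightarrow> real \<Rightarrow> real \<Rightarrow> real" where
  "joukowski_product r \<phi> \<theta> = (r\<^sup>2 + 1 - 2 * r * cos (\<phi> - \<theta>)) * (r\<^sup>2 + 1 - 2 * r * cos (\<phi> + \<theta>))"

text \<open>Everything follows from the form \<open>(r - 1)^2 + r * (2 - 2 * cos a)\<close>. The
  lower bound is the value at \<open>r = 1\<close>, which later dominates the integrands uniformly
  as \<open>r\<close> tends to 1.\<close>

lemma joukowski_factor:
  fixes r a :: real
  assumes "1 \<le> r"
  shows "2 - 2 * cos a \<le> r\<^sup>2 + 1 - 2 * r * cos a" "r\<^sup>2 + 1 - 2 * r * cos a \<le> (r + 1)\<^sup>2"
    "1 < r \<Longrightarrow> 0 < r\<^sup>2 + 1 - 2 * r * cos a"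
proof -
  have e: "r\<^sup>2 + 1 - 2 * r * cos a = (r - 1)\<^sup>2 + r * (2 - 2 * cos a)"
    by (simp add: power2_eq_square algebra_simps)
  have n: "0 \<le> 2 - 2 * cos a" by simp
  have "1 * (2 - 2 * cos a) \<le> r * (2 - 2 * cos a)" using assms n by (rule mult_right_mono)
  then show "2 - 2 * cos a \<le> r\<^sup>2 + 1 - 2 * r * cos a"
    unfolding e mult_1 by (rule add_increasing[OF zero_le_power2])
  have "r * (2 - 2 * cos a) \<le> r * 4" 
  proof (rule mult_left_mono)
    show "2 - 2 * cos a \<le> 4" using cos_ge_minus_one[of a] by linarith
  qed (use assms in simp)
  then show "r\<^sup>2 + 1 - 2 * r * cos a \<le> (r + 1)\<^sup>2"
    unfolding e by (simp add: power2_eq_square algebra_simps)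
  assume "1 < r"
  then have "0 < (r - 1)\<^sup>2" by simp
  moreover have "0 \<le> r * (2 - 2 * cos a)" using assms n by simp
  ultimately show "0 < r\<^sup>2 + 1 - 2 * r * cos a" unfolding e by (rule add_pos_nonneg)
qed

lemma joukowski_product_one: "joukowski_product 1 \<phi> \<theta> = (2 * cos \<phi> - 2 * cos \<theta>)\<^sup>2"
proof -
  have s: "(sin \<phi>)\<^sup>2 = 1 - (cos \<phi>)\<^sup>2" "(sin \<theta>)\<^sup>2 = 1 - (cos \<theta>)\<^sup>2"
    by (simp_all add: sin_squared_eq)
  have "joukowski_product 1 \<phi> \<theta> = 4 * ((1 - cos \<phi> * cos \<theta>)\<^sup>2 - (sin \<phi>)\<^sup>2 * (sin \<theta>)\<^sup>2)"
    by (simp add: joukowski_product_def cos_add cos_diff power2_eq_square algebra_simps)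
  also have "\<dots> = (2 * cos \<phi> - 2 * cos \<theta>)\<^sup>2"
    unfolding s by (simp add: power2_eq_square algebra_simps)
  finally show ?thesis .
qed

text \<open>Multiplied by \<open>2 / pi\<close>, this is the potential of the semicircle law at a
  complex point \<open>w = z + 1/z\<close> off the cut, namely
  \<open>ln |z| + Re (1 / z^2) / 2\<close>. The series at the angles
  \<open>\<phi> - \<theta>\<close> and \<open>\<phi> + \<theta>\<close> add up to terms in
  \<open>cos (n * \<phi>) * cos (n * \<theta>)\<close>, of which integration against
  \<open>sin^2\<close> retains \<open>n = 2\<close>.\<close>

lemma integral_log_joukowski:
  fixes r \<phi> :: real
  assumes r: "r > 1"
  shows "has_bochner_integral lborel
    (\<lambda>\<theta>. (sin \<theta>)\<^sup>2 * (ln (joukowski_product r \<phi> \<theta>) / 2 - ln r) * indicator {0..pi} \<theta>)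
    (pi / 2 * (ln r + cos (2 * \<phi>) / (2 * r\<^sup>2)))"
proof -
  define c where "c n = 2 * cos (real n * \<phi>) / (real n * r ^ n)" for n
  let ?f = "\<lambda>n \<theta>. c n * ((sin \<theta>)\<^sup>2 * cos (real n * \<theta>) * indicator {0..pi} \<theta>)"
  have S: "(\<lambda>n. ?f n \<theta>) sums ((sin \<theta>)\<^sup>2 * (ln r - (ln (joukowski_product r \<phi> \<theta>) / 2 - ln r)) * indicator {0..pi} \<theta>)" for \<theta>
  proof -
    have "(\<lambda>n. cos (real n * (\<phi> - \<theta>)) / (real n * r ^ n) + cos (real n * (\<phi> + \<theta>)) / (real n * r ^ n))
      sums (- (ln (r\<^sup>2 + 1 - 2 * r * cos (\<phi> - \<theta>)) / 2 - ln r) + - (ln (r\<^sup>2 + 1 - 2 * r * cos (\<phi> + \<theta>)) / 2 - ln r))"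
      by (intro sums_add log_modulus_series r)
    also have "(\<lambda>n. cos (real n * (\<phi> - \<theta>)) / (real n * r ^ n) + cos (real n * (\<phi> + \<theta>)) / (real n * r ^ n))
      = (\<lambda>n. c n * cos (real n * \<theta>))"
      by (auto simp: c_def right_diff_distrib distrib_left cos_add cos_diff simp flip: add_divide_distrib)
    also have "- (ln (r\<^sup>2 + 1 - 2 * r * cos (\<phi> - \<theta>)) / 2 - ln r) + - (ln (r\<^sup>2 + 1 - 2 * r * cos (\<phi> + \<theta>)) / 2 - ln r)
      = ln r - (ln (joukowski_product r \<phi> \<theta>) / 2 - ln r)"
    proof -
      have pos: "0 < r\<^sup>2 + 1 - 2 * r * cos a" for a using r by (intro joukowski_factor(3)) auto
      show ?thesis unfolding joukowski_product_def ln_mult_pos[OF pos pos] by (simp add: field_simps)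
    qed
    finally have "(\<lambda>n. (sin \<theta>)\<^sup>2 * indicator {0..pi} \<theta> * (c n * cos (real n * \<theta>)))
       sums ((sin \<theta>)\<^sup>2 * indicator {0..pi} \<theta> * (ln r - (ln (joukowski_product r \<phi> \<theta>) / 2 - ln r)))"
      by (rule sums_mult)
    then show ?thesis by (simp add: mult_ac)
  qed
  have c_le: "\<bar>c n\<bar> \<le> 2 * (1 / r) ^ n" for n
  proof (cases "n = 0")
    case False
    have "\<bar>c n\<bar> = 2 * (\<bar>cos (real n * \<phi>)\<bar> / real n) * (1 / r) ^ n"
      using r by (simp add: c_def abs_mult power_divide)
    also have "\<dots> \<le> 2 * 1 * (1 / r) ^ n"
    proof -
      have "1 \<le> real n" using False by simp
      then have "\<bar>cos (real n * \<phi>)\<bar> \<le> real n" using abs_cos_le_one[of "real n * \<phi>"] by linarith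
      then show ?thesis using False r by (intro mult_right_mono mult_left_mono) (auto simp: divide_le_eq_1)
    qed
    finally show ?thesis by simp
  qed (simp add: c_def)
  have f_le: "norm (?f n \<theta>) \<le> 2 * (1 / r) ^ n * indicator {0..pi} \<theta>" for n \<theta>
  proof -
    have "\<bar>(sin \<theta>)\<^sup>2 * cos (real n * \<theta>)\<bar> \<le> 1 * 1"
      unfolding abs_mult by (intro mult_mono) (auto simp: abs_square_le_1)
    then have "\<bar>c n\<bar> * \<bar>(sin \<theta>)\<^sup>2 * cos (real n * \<theta>)\<bar> \<le> 2 * (1 / r) ^ n * 1"
      using c_le[of n] by (intro mult_mono) auto
    then show ?thesis by (auto simp: abs_mult indicator_def)
  qed
  have geo: "summable (\<lambda>n. 2 * (1 / r) ^ n * B)" for B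
    using r by (intro summable_mult summable_mult2 summable_geometric) auto
  have int: "integrable lborel (?f n)" for n
    using integral_sin_squared_cos[of n] by (auto simp: has_bochner_integral_iff)
  have bd: "integrable lborel (\<lambda>\<theta>. 2 * (1 / r) ^ n * indicator {0..pi} \<theta>)" for n
    by (intro integrable_mult_right integrable_real_indicator) (auto simp: emeasure_lborel_Icc_eq)
  have "(\<integral>\<theta>. norm (?f n \<theta>) \<partial>lborel) \<le> 2 * (1 / r) ^ n * pi" for n
  proof -
    have "(\<integral>\<theta>. norm (?f n \<theta>) \<partial>lborel) \<le> (\<integral>\<theta>. 2 * (1 / r) ^ n * indicator {0..pi} \<theta> \<partial>lborel)"
      by (intro integral_mono integrable_norm int bd f_le)
    also have "\<dots> = 2 * (1 / r) ^ n * pi" by simp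
    finally show ?thesis .
  qed
  then have sum2: "summable (\<lambda>n. \<integral>\<theta>. norm (?f n \<theta>) \<partial>lborel)"
    by (intro summable_comparison_test'[OF geo[of pi]]) simp
  have sum1: "AE \<theta> in lborel. summable (\<lambda>n. norm (?f n \<theta>))"
    by (intro AE_I2 summable_comparison_test'[OF geo]) (use f_le in auto)
  have suminf: "(\<Sum>n. ?f n \<theta>) = (sin \<theta>)\<^sup>2 * (ln r - (ln (joukowski_product r \<phi> \<theta>) / 2 - ln r)) * indicator {0..pi} \<theta>" for \<theta>
    using S by (rule sums_unique[symmetric])
  note series = integrable_suminf[OF int sum1 sum2, unfolded suminf] sums_integral[OF int sum1 sum2, unfolded suminf]
  have "(\<integral>\<theta>. ?f n \<theta> \<partial>lborel) = (if n = 2 then c 2 * (- pi / 4) else 0)" for n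
  proof -
    \<comment> \<open>Division by zero gives 0 here, so the frequency 0, whose integral is
      \<open>pi / 2\<close>, contributes nothing.\<close>
    have c0: "c 0 = 0" by (simp add: c_def)
    have e: "(\<integral>\<theta>. ?f n \<theta> \<partial>lborel) = c n * (if n = 0 then pi / 2 else if n = 2 then - pi / 4 else 0)"
      using integral_sin_squared_cos[of n] by (simp only: has_bochner_integral_iff integral_mult_right_zero)
    show ?thesis unfolding e using c0 by simp
  qed
  then have "(\<lambda>n. \<integral>\<theta>. ?f n \<theta> \<partial>lborel) sums (c 2 * (- pi / 4))"
    using sums_single[of 2 "\<lambda>_. c 2 * (- pi / 4)"] by simp
  with series(2) have val: "(\<integral>\<theta>. (sin \<theta>)\<^sup>2 * (ln r - (ln (joukowski_product r \<phi> \<theta>) / 2 - ln r)) * indicator {0..pi} \<theta> \<partial>lborel) = c 2 * (- pi / 4)"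
    by (rule sums_unique2)
  have s2: "has_bochner_integral lborel (\<lambda>\<theta>. ln r * ((sin \<theta>)\<^sup>2 * cos (real 0 * \<theta>) * indicator {0..pi} \<theta>)) (ln r * (pi / 2))"
    using integral_sin_squared_cos[of 0] by (intro has_bochner_integral_mult_right) simp
  have "has_bochner_integral lborel (\<lambda>\<theta>. ln r * ((sin \<theta>)\<^sup>2 * cos (real 0 * \<theta>) * indicator {0..pi} \<theta>)
    - (sin \<theta>)\<^sup>2 * (ln r - (ln (joukowski_product r \<phi> \<theta>) / 2 - ln r)) * indicator {0..pi} \<theta>) (ln r * (pi / 2) - c 2 * (- pi / 4))"
    using series(1) val by (intro has_bochner_integral_diff s2) (simp add: has_bochner_integral_iff)
  also have "(\<lambda>\<theta>. ln r * ((sin \<theta>)\<^sup>2 * cos (real 0 * \<theta>) * indicator {0..pi} \<theta>)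
    - (sin \<theta>)\<^sup>2 * (ln r - (ln (joukowski_product r \<phi> \<theta>) / 2 - ln r)) * indicator {0..pi} \<theta>)
    = (\<lambda>\<theta>. (sin \<theta>)\<^sup>2 * (ln (joukowski_product r \<phi> \<theta>) / 2 - ln r) * indicator {0..pi} \<theta>)"
    by (auto simp: algebra_simps)
  also have "ln r * (pi / 2) - c 2 * (- pi / 4) = pi / 2 * (ln r + cos (2 * \<phi>) / (2 * r\<^sup>2))"
    by (simp add: c_def algebra_simps)
  finally show ?thesis .
qed

abbreviation semicircle :: "real \<Rightarrow> real" where
  "semicircle \<equiv> cut_density (-2) 2 [:1 / (2 * pi):]"

lemma semicircle_substitution:
  assumes "integrable lborel (\<lambda>y. semicircle y * h y)"
  shows "integrable lborel (\<lambda>\<theta>. (sin \<theta>)\<^sup>2 * h (-2 * cos \<theta>) * indicator {0..pi} \<theta>)"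
    and "(\<integral>y. semicircle y * h y \<partial>lborel) = 2 / pi * (\<integral>\<theta>. (sin \<theta>)\<^sup>2 * h (-2 * cos \<theta>) * indicator {0..pi} \<theta> \<partial>lborel)"
proof -
  \<comment> \<open>The sign in \<open>-2 * cos \<theta>\<close> makes the substitution increasing
    on \<open>{0..pi}\<close>; its derivative and the square root contribute
    \<open>2 * sin \<theta>\<close> each.\<close>
  let ?f = "\<lambda>y. semicircle y * h y" and ?g = "\<lambda>\<theta>. -2 * cos \<theta>" and ?g' = "\<lambda>\<theta>. 2 * sin \<theta>"
  have ind: "(\<lambda>y. indicator {-2..2} y * ?f y) = ?f"
    by (auto simp: cut_density_def indicator_def)
  have "set_integrable lborel {?g 0..?g pi} ?f"
    unfolding set_integrable_def using assms ind by simp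
  note sub = integral_substitution[where f="?f" and g="?g" and g'="?g'" and a=0 and b=pi, OF this]
  have d: "(?g has_real_derivative ?g' \<theta>) (at \<theta>)" for \<theta>
    by (auto intro!: derivative_eq_intros)
  have c: "continuous_on {0..pi} ?g'" by (intro continuous_intros)
  have p: "0 \<le> ?g' \<theta>" if "\<theta> \<in> {0..pi}" for \<theta> using that by (auto intro: sin_ge_zero)
  have eq: "?f (?g \<theta>) * ?g' \<theta> * indicator {0..pi} \<theta> = 2 / pi * ((sin \<theta>)\<^sup>2 * h (-2 * cos \<theta>) * indicator {0..pi} \<theta>)" for \<theta>
  proof (cases "\<theta> \<in> {0..pi}")
    case True
    have "(?g \<theta> - - 2) * (2 - ?g \<theta>) = (2 * sin \<theta>)\<^sup>2"
    proof -
      have "(?g \<theta> - - 2) * (2 - ?g \<theta>) = 4 * (1 - (cos \<theta>)\<^sup>2)"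
        by (simp add: power2_eq_square algebra_simps)
      also have "\<dots> = (2 * sin \<theta>)\<^sup>2" by (simp add: sin_squared_eq power_mult_distrib)
      finally show ?thesis .
    qed
    then have "sqrt ((?g \<theta> - - 2) * (2 - ?g \<theta>)) = 2 * sin \<theta>"
      using p[OF True] by (simp only: real_sqrt_abs)
    moreover have "?g \<theta> \<in> {-2..2}" 
      using cos_ge_minus_one[of \<theta>] cos_le_one[of \<theta>] unfolding atLeastAtMost_iff by linarith
    ultimately have "semicircle (?g \<theta>) = 2 * sin \<theta> * (1 / (2 * pi))"
      unfolding cut_density_def by simp
    then show ?thesis using True by (simp add: power2_eq_square)
  qed simp
  have i: "integrable lborel (\<lambda>\<theta>. 2 / pi * ((sin \<theta>)\<^sup>2 * h (-2 * cos \<theta>) * indicator {0..pi} \<theta>))"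
    using sub(1)[OF d c p] unfolding set_integrable_def eq[symmetric] by (simp add: mult_ac)
  then show "integrable lborel (\<lambda>\<theta>. (sin \<theta>)\<^sup>2 * h (-2 * cos \<theta>) * indicator {0..pi} \<theta>)"
    unfolding integrable_mult_left_iff by simp
  have "(\<integral>y. ?f y \<partial>lborel) = (\<integral>y. ?f y * indicator {?g 0..?g pi} y \<partial>lborel)"
    by (intro Bochner_Integration.integral_cong) (auto simp: cut_density_def indicator_def)
  also have "\<dots> = (\<integral>\<theta>. ?f (?g \<theta>) * ?g' \<theta> * indicator {0..pi} \<theta> \<partial>lborel)"
    using sub(2)[OF d c p] by simp
  finally show "(\<integral>y. semicircle y * h y \<partial>lborel) = 2 / pi * (\<integral>\<theta>. (sin \<theta>)\<^sup>2 * h (-2 * cos \<theta>) * indicator {0..pi} \<theta> \<partial>lborel)"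
    unfolding eq by simp
qed

lemma semicircle_bounded: "\<exists>R B. bounded_density semicircle R B"
  by (rule bounded_density_cut_density) simp

lemma semicircle_total: "(\<integral>y. semicircle y \<partial>lborel) = 1"
proof -
  obtain R B where "bounded_density semicircle R B" using semicircle_bounded by blast
  then interpret bounded_density semicircle R B .
  have "(\<integral>y. semicircle y * 1 \<partial>lborel) = 2 / pi * (\<integral>\<theta>. (sin \<theta>)\<^sup>2 * 1 * indicator {0..pi} \<theta> \<partial>lborel)"
    using integrable_density by (intro semicircle_substitution) simp
  also have "\<dots> = 1" using integral_sin_squared_cos[of 0] by (simp add: has_bochner_integral_iff)
  finally show ?thesis by simp
qed

definition semicircle_potential :: "real \<Rightarrow> real" where
  "semicircle_potential x = (\<integral>y. semicircle y * ln \<bar>x - y\<bar> \<partial>lborel)"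

lemma semicircle_potential_integral:
  "integrable lborel (\<lambda>\<theta>. (sin \<theta>)\<^sup>2 * ln \<bar>x + 2 * cos \<theta>\<bar> * indicator {0..pi} \<theta>)"
  "semicircle_potential x = 2 / pi * (\<integral>\<theta>. (sin \<theta>)\<^sup>2 * ln \<bar>x + 2 * cos \<theta>\<bar> * indicator {0..pi} \<theta> \<partial>lborel)"
proof -
  obtain R B where "bounded_density semicircle R B" using semicircle_bounded by blast
  then interpret bounded_density semicircle R B .
  show "integrable lborel (\<lambda>\<theta>. (sin \<theta>)\<^sup>2 * ln \<bar>x + 2 * cos \<theta>\<bar> * indicator {0..pi} \<theta>)"
    "semicircle_potential x = 2 / pi * (\<integral>\<theta>. (sin \<theta>)\<^sup>2 * ln \<bar>x + 2 * cos \<theta>\<bar> * indicator {0..pi} \<theta> \<partial>lborel)"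
    using semicircle_substitution[OF integrable_log[of x]] by (simp_all add: semicircle_potential_def)
qed

lemma semicircle_potential_outside:
  fixes r :: real
  assumes r: "r > 1" and x: "x = r + 1 / r \<or> x = - (r + 1 / r)"
  shows "semicircle_potential x = ln r + 1 / (2 * r\<^sup>2)"
proof -
  \<comment> \<open>Real points off the cut correspond to real \<open>z\<close>, so
    \<open>\<phi>\<close> is 0 or \<open>pi\<close> and the two Joukowski factors coincide. The sign
    of \<open>x\<close> is reversed because the substitution was
    \<open>y = -2 * cos \<theta>\<close>.\<close>
  obtain \<phi> where \<phi>: "cos (2 * \<phi>) = 1" "x = - cos \<phi> * (r + 1 / r)" "sin \<phi> = 0" "cos \<phi> * cos \<phi> = 1"
    using x by (elim disjE) (auto intro: that[of pi] that[of 0])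
  have "ln \<bar>x + 2 * cos \<theta>\<bar> = ln (joukowski_product r \<phi> \<theta>) / 2 - ln r" for \<theta>
  proof -
    define u where "u = r\<^sup>2 + 1 - 2 * r * (cos \<phi> * cos \<theta>)"
    have u: "u > 0" using joukowski_factor(3)[of r "\<phi> - \<theta>"] r \<phi> by (simp add: u_def cos_diff)
    have "joukowski_product r \<phi> \<theta> = u\<^sup>2"
      by (simp add: joukowski_product_def cos_add cos_diff \<phi> u_def power2_eq_square)
    then have "ln (joukowski_product r \<phi> \<theta>) = 2 * ln u" using u by (simp add: ln_realpow)
    moreover have "\<bar>x + 2 * cos \<theta>\<bar> = u / r"
    proof -
      have "x + 2 * cos \<theta> = - cos \<phi> * (u / r)"
        using r \<phi>(4) unfolding \<phi>(2) u_def by (simp add: field_simps power2_eq_square)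
      moreover have "\<bar>cos \<phi>\<bar> = 1" using \<phi>(4) by (metis abs_mult_self_eq abs_one abs_mult power2_eq_square abs_ge_zero power2_eq_1_iff abs_idempotent abs_minus_cancel)
      ultimately show ?thesis using u r by (simp add: abs_mult)
    qed
    ultimately show ?thesis using u r by (simp add: ln_div)
  qed
  then have "semicircle_potential x = 2 / pi * (pi / 2 * (ln r + cos (2 * \<phi>) / (2 * r\<^sup>2)))"
    unfolding semicircle_potential_integral(2)
    using integral_log_joukowski[OF r, of \<phi>] by (simp only: has_bochner_integral_iff)
  then show ?thesis using \<phi>(1) by simp
qed

lemma semicircle_potential_inside:
  assumes "\<bar>x\<bar> \<le> 2"
  shows "semicircle_potential x = x\<^sup>2 / 4 - 1 / 2"
proof -
  define \<phi> where "\<phi> = arccos (- x / 2)"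
  have \<phi>: "\<phi> \<in> {0..pi}" "x = - 2 * cos \<phi>"
    using assms arccos_bounded[of "- x / 2"] by (auto simp: \<phi>_def)
  define r :: "nat \<Rightarrow> real" where "r n = 1 + inverse (real (Suc n))" for n
  have r: "1 < r n" "r n \<le> 2" for n
    by (auto simp: r_def inverse_le_1_iff)
  have r_lim: "r \<longlonglongrightarrow> 1"
    unfolding r_def using tendsto_add[OF tendsto_const LIMSEQ_inverse_real_of_nat, of 1] by simp
  let ?s = "\<lambda>n \<theta>. (sin \<theta>)\<^sup>2 * (ln (joukowski_product (r n) \<phi> \<theta>) / 2 - ln (r n)) * indicator {0..pi} \<theta>"
  let ?f = "\<lambda>\<theta>. (sin \<theta>)\<^sup>2 * ln \<bar>x + 2 * cos \<theta>\<bar> * indicator {0..pi} \<theta>"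
  \<comment> \<open>The product is at least its value at \<open>r = 1\<close>, which accounts for
    the first term, and at most \<open>9 * 9\<close> since \<open>(r n + 1)^2 \<le> 9\<close>;
    \<open>ln 2\<close> bounds \<open>ln (r n)\<close>.\<close>
  let ?w = "\<lambda>\<theta>. norm (?f \<theta>) + (ln 9 + ln 2) * indicator {0..pi} \<theta>"
  have ne: "AE \<theta> in lborel. \<theta> \<noteq> \<phi>" by (rule AE_lborel_singleton)
  have pos: "0 < (2 * cos \<phi> - 2 * cos \<theta>)\<^sup>2" if "\<theta> \<noteq> \<phi>" "\<theta> \<in> {0..pi}" for \<theta>
    using that \<phi>(1) cos_inj_pi[of \<theta> \<phi>] by auto
  have ln1: "ln ((2 * cos \<phi> - 2 * cos \<theta>)\<^sup>2) / 2 = ln \<bar>x + 2 * cos \<theta>\<bar>" if "\<theta> \<noteq> \<phi>" "\<theta> \<in> {0..pi}" for \<theta>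
  proof -
    have eq: "(2 * cos \<phi> - 2 * cos \<theta>)\<^sup>2 = \<bar>x + 2 * cos \<theta>\<bar> ^ 2"
      unfolding \<phi>(2) by (simp add: power2_eq_square algebra_simps)
    have "ln ((2 * cos \<phi> - 2 * cos \<theta>)\<^sup>2) = real 2 * ln \<bar>x + 2 * cos \<theta>\<bar>"
      unfolding eq by (rule ln_realpow)
    then show ?thesis by simp
  qed
  have lim: "(\<lambda>n. \<integral>\<theta>. ?s n \<theta> \<partial>lborel) \<longlonglongrightarrow> (\<integral>\<theta>. ?f \<theta> \<partial>lborel)"
  proof (rule integral_dominated_convergence[where w="?w"])
    show "?f \<in> borel_measurable lborel" using semicircle_potential_integral(1)[of x] by (rule borel_measurable_integrable)
    show "?s n \<in> borel_measurable lborel" for n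
      using integral_log_joukowski[OF r(1)[of n], of \<phi>] by (auto simp: has_bochner_integral_iff dest: borel_measurable_integrable)
    show "integrable lborel ?w"
      using semicircle_potential_integral(1)[of x]
      by (intro Bochner_Integration.integrable_add integrable_norm integrable_mult_right integrable_real_indicator; simp add: emeasure_lborel_Icc_eq)
    show "AE \<theta> in lborel. (\<lambda>n. ?s n \<theta>) \<longlonglongrightarrow> ?f \<theta>"
      using ne
    proof eventually_elim
      case (elim \<theta>)
      show ?case
      proof (cases "\<theta> \<in> {0..pi}")
        case True
        have "(\<lambda>n. joukowski_product (r n) \<phi> \<theta>) \<longlonglongrightarrow> joukowski_product 1 \<phi> \<theta>"
          unfolding joukowski_product_def by (intro tendsto_intros r_lim)
        then have A: "(\<lambda>n. ln (joukowski_product (r n) \<phi> \<theta>)) \<longlonglongrightarrow> ln (joukowski_product 1 \<phi> \<theta>)"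
          using pos[OF elim True] by (intro tendsto_ln) (auto simp: joukowski_product_one)
        have B: "(\<lambda>n. ln (r n)) \<longlonglongrightarrow> ln 1" by (intro tendsto_ln r_lim) simp
        have "(\<lambda>n. ?s n \<theta>) \<longlonglongrightarrow> (sin \<theta>)\<^sup>2 * (ln (joukowski_product 1 \<phi> \<theta>) / 2 - ln 1) * indicator {0..pi} \<theta>"
          by (intro tendsto_mult tendsto_diff tendsto_divide tendsto_const A B) simp
        then show ?thesis using ln1[OF elim True] by (simp add: joukowski_product_one)
      qed simp
    qed
    show "AE \<theta> in lborel. norm (?s n \<theta>) \<le> ?w \<theta>" for n
      using ne
    proof eventually_elim
      case (elim \<theta>)
      show ?case
      proof (cases "\<theta> \<in> {0..pi}")
        case True
        let ?P = "joukowski_product (r n) \<phi> \<theta>"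
        have r1: "1 \<le> r n" using r(1)[of n] by simp
        have low: "joukowski_product 1 \<phi> \<theta> \<le> ?P"
          unfolding joukowski_product_def using joukowski_factor(1)[OF r1] joukowski_factor(3)[OF r1 r(1)[of n]]
          by (intro mult_mono) (auto intro: less_imp_le)
        have nine: "(r n + 1)\<^sup>2 \<le> 9" using power_mono[of "r n + 1" 3 2] r[of n] by simp
        have f9: "0 < (r n)\<^sup>2 + 1 - 2 * r n * cos a" "(r n)\<^sup>2 + 1 - 2 * r n * cos a \<le> 9" for a
          using joukowski_factor(3)[OF r1 r(1)[of n], of a] joukowski_factor(2)[OF r1, of a] nine by linarith+
        have up: "?P \<le> 9 * 9"
          unfolding joukowski_product_def using f9 by (intro mult_mono) (auto intro: less_imp_le)
        have P0: "0 < joukowski_product 1 \<phi> \<theta>" using pos[OF elim True] by (simp add: joukowski_product_one)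
        have "ln (joukowski_product 1 \<phi> \<theta>) \<le> ln ?P" using low P0 by (subst ln_le_cancel_iff) auto
        moreover have "ln ?P \<le> ln (9 * 9)" using up low P0 by (subst ln_le_cancel_iff) auto
        moreover have "ln (9 * 9 :: real) = 2 * ln 9" by (subst ln_mult_pos) auto
        moreover have "0 \<le> ln (r n)" "ln (r n) \<le> ln 2" using r[of n] by auto
        moreover have "ln (joukowski_product 1 \<phi> \<theta>) = 2 * ln \<bar>x + 2 * cos \<theta>\<bar>"
          using ln1[OF elim True] by (simp add: joukowski_product_one)
        moreover have "0 \<le> ln (9::real)" by simp
        ultimately have "\<bar>ln ?P / 2 - ln (r n)\<bar> \<le> \<bar>ln \<bar>x + 2 * cos \<theta>\<bar>\<bar> + (ln 9 + ln 2)"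
          by linarith
        then have "(sin \<theta>)\<^sup>2 * \<bar>ln ?P / 2 - ln (r n)\<bar> \<le> (sin \<theta>)\<^sup>2 * (\<bar>ln \<bar>x + 2 * cos \<theta>\<bar>\<bar> + (ln 9 + ln 2))"
          by (intro mult_left_mono) auto
        also have "\<dots> \<le> (sin \<theta>)\<^sup>2 * \<bar>ln \<bar>x + 2 * cos \<theta>\<bar>\<bar> + 1 * (ln 9 + ln 2)"
          by (subst distrib_left) (intro add_left_mono mult_right_mono, auto simp: abs_square_le_1)
        finally show ?thesis using True by (simp add: abs_mult)
      qed simp
    qed
  qed
  have val: "(\<integral>\<theta>. ?s n \<theta> \<partial>lborel) = pi / 2 * (ln (r n) + cos (2 * \<phi>) / (2 * (r n)\<^sup>2))" for n
    using integral_log_joukowski[OF r(1)[of n], of \<phi>] by (simp only: has_bochner_integral_iff)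
  have lim2: "(\<lambda>n. pi / 2 * (ln (r n) + cos (2 * \<phi>) / (2 * (r n)\<^sup>2))) \<longlonglongrightarrow> pi / 2 * (ln 1 + cos (2 * \<phi>) / (2 * 1\<^sup>2))"
    by (intro tendsto_intros r_lim) auto
  have "(\<integral>\<theta>. ?f \<theta> \<partial>lborel) = pi / 2 * (ln 1 + cos (2 * \<phi>) / (2 * 1\<^sup>2))"
    using lim lim2 unfolding val by (rule LIMSEQ_unique)
  then have "semicircle_potential x = 2 / pi * (pi / 2 * (ln 1 + cos (2 * \<phi>) / (2 * 1\<^sup>2)))"
    unfolding semicircle_potential_integral(2) by (rule arg_cong)
  then have "semicircle_potential x = cos (2 * \<phi>) / 2" by simp
  also have "\<dots> = x\<^sup>2 / 4 - 1 / 2" unfolding \<phi>(2) by (simp add: cos_double_cos power2_eq_square)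
  finally show ?thesis .
qed

text \<open>At \<open>t = r^2\<close> this is what the strict Euler-Lagrange inequality off the cut
  reduces to.\<close>

lemma two_ln_less:
  fixes t :: real
  assumes "t > 1" shows "2 * ln t < t - 1 / t"
proof -
  have "(\<lambda>t. t - 1 / t - 2 * ln t) 1 < (\<lambda>t. t - 1 / t - 2 * ln t) t"
  proof (rule DERIV_pos_imp_increasing_open[OF assms])
    fix s :: real assume s: "1 < s" "s < t"
    have "((\<lambda>t. t - 1 / t - 2 * ln t) has_real_derivative ((1 - 1 / s)\<^sup>2)) (at s)"
      using s by (auto intro!: derivative_eq_intros simp: power2_eq_square field_simps)
    moreover have "(1 - 1 / s)\<^sup>2 > 0" using s by simp
    ultimately show "\<exists>y. ((\<lambda>t. t - 1 / t - 2 * ln t) has_real_derivative y) (at s) \<and> 0 < y" by blast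
  qed (auto intro!: continuous_intros)
  then show ?thesis by simp
qed

lemma semicircle_Euler_Lagrange:
  shows "\<bar>x\<bar> \<le> 2 \<Longrightarrow> 2 * semicircle_potential x - x\<^sup>2 / 2 = -1"
    and "\<bar>x\<bar> > 2 \<Longrightarrow> 2 * semicircle_potential x - x\<^sup>2 / 2 < -1"
proof -
  show "2 * semicircle_potential x - x\<^sup>2 / 2 = -1" if "\<bar>x\<bar> \<le> 2"
    using semicircle_potential_inside[OF that] by simp
  show "2 * semicircle_potential x - x\<^sup>2 / 2 < -1" if x: "\<bar>x\<bar> > 2"
  proof -
    define d where "d = sqrt (x\<^sup>2 - 4)"
    \<comment> \<open>The root larger than 1 of \<open>r + 1 / r = |x|\<close>.\<close>
    define r where "r = (\<bar>x\<bar> + d) / 2"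
    have "x\<^sup>2 > 2\<^sup>2" using x by (metis abs_ge_zero power2_abs power_strict_mono zero_less_numeral zero_le_numeral)
    then have d: "d \<ge> 0" "d\<^sup>2 = x\<^sup>2 - 4" by (auto simp: d_def)
    have r: "r > 1" using d x by (simp add: r_def)
    have "r * (\<bar>x\<bar> - r) = 1"
    proof -
      have "r * (\<bar>x\<bar> - r) = (\<bar>x\<bar>\<^sup>2 - d\<^sup>2) / 4"
        by (simp add: r_def power2_eq_square field_simps)
      then show ?thesis by (simp add: d)
    qed
    then have xr: "\<bar>x\<bar> = r + 1 / r" using r by (simp add: field_simps)
    then have "x = r + 1 / r \<or> x = - (r + 1 / r)" by linarith
    from semicircle_potential_outside[OF r this]
    have p: "semicircle_potential x = ln r + 1 / (2 * r\<^sup>2)" .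
    have x2: "x\<^sup>2 = r\<^sup>2 + 2 + 1 / r\<^sup>2"
    proof -
      have "x\<^sup>2 = (r + 1 / r)\<^sup>2" using xr by (metis power2_abs)
      then show ?thesis using r by (simp add: power2_sum power_divide)
    qed
    have "2 * ln (r\<^sup>2) < r\<^sup>2 - 1 / r\<^sup>2" using r by (intro two_ln_less) (simp add: one_less_power)
    moreover have "ln (r\<^sup>2) = 2 * ln r" using r by (simp add: ln_realpow)
    moreover have "1 / (2 * r\<^sup>2) = (1 / r\<^sup>2) / 2" by simp
    moreover have "2 * (l + Y) - (R + 2 + X) / 2 < -1"
      if "2 * L < R - X" "L = 2 * l" "Y = X / 2" for l L R X Y :: real
      using that by (simp add: field_simps)
    ultimately show ?thesis unfolding p x2 by blast
  qed
qed

section \<open>One-cut potentials\<close>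

text \<open>Regularity freed from the definite description: the density is part of the data, so
  affine and convex operations become direct computations. For confining \<open>V\<close>, such data
  exist exactly when \<open>cut_regular 1 V\<close> holds.\<close>

definition one_cut :: "real \<Rightarrow> real \<Rightarrow> real poly \<Rightarrow> real poly \<Rightarrow> bool" where
  "one_cut \<alpha> \<beta> p V \<longleftrightarrow> \<alpha> < \<beta> \<and> (\<forall>y\<in>{\<alpha>..\<beta>}. 0 < poly p y) \<and> (\<integral>y. cut_density \<alpha> \<beta> p y \<partial>lborel) = 1 \<and>
    (\<exists>l. (\<forall>x\<in>{\<alpha>..\<beta>}. 2 * (\<integral>y. cut_density \<alpha> \<beta> p y * ln \<bar>x - y\<bar> \<partial>lborel) - poly V x = l) \<and>
         (\<forall>x. x \<notin> {\<alpha>..\<beta>} \<longrightarrow> 2 * (\<integral>y. cut_density \<alpha> \<beta> p y * ln \<bar>x - y\<bar> \<partial>lborel) - poly V x < l))"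

lemma one_cut_bounded_prob_density:
  assumes "one_cut \<alpha> \<beta> p V"
  shows "\<exists>R B. bounded_prob_density (cut_density \<alpha> \<beta> p) R B"
proof -
  obtain R B where "bounded_density (cut_density \<alpha> \<beta> p) R B"
    using bounded_density_cut_density[of \<alpha> \<beta> p] assms by (auto simp: one_cut_def less_imp_le)
  then show ?thesis
    using assms by (auto simp: one_cut_def bounded_prob_density_def bounded_prob_density_axioms_def)
qed

lemma equilibrium_measure_eqI:
  assumes "confining V" "is_energy_minimizer V \<mu>"
  shows "equilibrium_measure V = \<mu>"
  unfolding equilibrium_measure_def using ex1_energy_minimizer[OF assms(1)] assms(2) by (rule the1_equality)

lemma equilibrium_measure_minimizer:
  assumes "confining V"
  shows "is_energy_minimizer V (equilibrium_measure V)"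
  unfolding equilibrium_measure_def using ex1_energy_minimizer[OF assms(1)] by (rule theI')

lemma one_cut_minimizer:
  assumes V: "confining V" and c: "one_cut \<alpha> \<beta> p V"
  shows "is_energy_minimizer V (density lborel (\<lambda>x. ennreal (cut_density \<alpha> \<beta> p x)))"
proof -
  obtain \<delta> C where "confined V \<delta> C"
    using confining_reduced_potential[OF V] by (auto simp: confined_def)
  then interpret confined V \<delta> C .
  obtain R B where b: "bounded_prob_density (cut_density \<alpha> \<beta> p) R B"
    using one_cut_bounded_prob_density[OF c] by blast
  obtain l where l: "\<And>x. x \<in> {\<alpha>..\<beta>} \<Longrightarrow> 2 * (\<integral>y. cut_density \<alpha> \<beta> p y * ln \<bar>x - y\<bar> \<partial>lborel) - poly V x = l"
    "\<And>x. x \<notin> {\<alpha>..\<beta>} \<Longrightarrow> 2 * (\<integral>y. cut_density \<alpha> \<beta> p y * ln \<bar>x - y\<bar> \<partial>lborel) - poly V x < l"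
    using c unfolding one_cut_def by blast
  show ?thesis
  proof (rule Euler_Lagrange_minimizer[OF b])
    show "2 * (\<integral>y. cut_density \<alpha> \<beta> p y * ln \<bar>x - y\<bar> \<partial>lborel) - poly V x \<le> l" for x
      using l[of x] by (cases "x \<in> {\<alpha>..\<beta>}") auto
    show "2 * (\<integral>y. cut_density \<alpha> \<beta> p y * ln \<bar>x - y\<bar> \<partial>lborel) - poly V x = l"
      if "cut_density \<alpha> \<beta> p x \<noteq> 0" for x
      using l(1)[of x] that unfolding cut_density_def indicator_def by (auto split: if_splits)
  qed
qed

lemma support_cut_density:
  assumes "\<alpha> < \<beta>" and p: "\<And>y. y \<in> {\<alpha>..\<beta>} \<Longrightarrow> 0 < poly p y"
  shows "measure_support (density lborel (\<lambda>x. ennreal (cut_density \<alpha> \<beta> p x))) = {\<alpha>..\<beta>}" (is "measure_support ?\<mu> = _")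
proof (intro set_eqI iffI)
  fix x assume x: "x \<in> measure_support ?\<mu>"
  show "x \<in> {\<alpha>..\<beta>}"
  proof (rule ccontr)
    assume "x \<notin> {\<alpha>..\<beta>}"
    then have "x \<in> - {\<alpha>..\<beta>}" by simp
    moreover have "open (- {\<alpha>..\<beta>})" by (intro open_Compl closed_atLeastAtMost)
    ultimately obtain e where e: "e > 0" "ball x e \<subseteq> - {\<alpha>..\<beta>}"
      by (meson openE)
    have "emeasure ?\<mu> (ball x e) = (\<integral>\<^sup>+y. ennreal (cut_density \<alpha> \<beta> p y) * indicator (ball x e) y \<partial>lborel)"
      by (rule emeasure_density) auto
    also have "\<dots> = (\<integral>\<^sup>+y. 0 \<partial>(lborel :: real measure))"
      using e(2) by (intro nn_integral_cong) (auto simp: cut_density_def indicator_def)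
    finally show False using x e(1) by (auto simp: measure_support_def)
  qed
next
  fix x assume x: "x \<in> {\<alpha>..\<beta>}"
  have "emeasure ?\<mu> (ball x e) > 0" if e: "e > 0" for e
  proof (rule ccontr)
    assume "\<not> emeasure ?\<mu> (ball x e) > 0"
    then have "(\<integral>\<^sup>+y. ennreal (cut_density \<alpha> \<beta> p y) * indicator (ball x e) y \<partial>lborel) = 0"
      by (subst (asm) emeasure_density) auto
    moreover have [measurable]: "ball x e \<in> sets borel" by (rule borel_open) simp
    have "(\<lambda>y. ennreal (cut_density \<alpha> \<beta> p y) * indicator (ball x e) y) \<in> borel_measurable lborel"
      by measurable
    ultimately have ae: "AE y in lborel. ennreal (cut_density \<alpha> \<beta> p y) * indicator (ball x e) y = 0"
      by (simp only: nn_integral_0_iff_AE)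
    \<comment> \<open>The density vanishes at the endpoints, so the ball is cut down to an open
      interval inside the cut, where the density is positive.\<close>
    define a b where "a = max \<alpha> (x - e)" and "b = min \<beta> (x + e)"
    have ab: "a < b" using x e assms(1) by (auto simp: a_def b_def)
    from ae show False
    proof (rule AE_E3)
      fix N assume N: "\<And>y. y \<in> space lborel - N \<Longrightarrow> ennreal (cut_density \<alpha> \<beta> p y) * indicator (ball x e) y = 0"
        "N \<in> null_sets lborel"
      have "\<not> {a<..<b} \<subseteq> N"
      proof
        assume "{a<..<b} \<subseteq> N"
        then have "emeasure lborel {a<..<b} \<le> emeasure lborel N"
          using N(2) by (intro emeasure_mono) auto
        then show False using N(2) ab by (simp add: null_setsD1)
      qed
      then obtain y where y: "y \<in> {a<..<b}" "y \<notin> N" by (meson subsetI)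
      then have in1: "\<alpha> < y" "y < \<beta>" "y \<in> ball x e" by (auto simp: a_def b_def dist_real_def)
      then have "cut_density \<alpha> \<beta> p y > 0" using p[of y] by (simp add: cut_density_def)
      with N(1)[of y] y(2) in1(3) show False by simp
    qed
  qed
  then show "x \<in> measure_support ?\<mu>" by (auto simp: measure_support_def)
qed

lemma integral_cut_density:
  assumes "\<And>y. y \<in> {\<alpha>..\<beta>} \<Longrightarrow> 0 < poly p y" and [measurable]: "g \<in> borel_measurable borel"
  shows "(\<integral>y. g y \<partial>density lborel (\<lambda>x. ennreal (cut_density \<alpha> \<beta> p x))) = (\<integral>y. cut_density \<alpha> \<beta> p y * g y \<partial>lborel)"
proof -
  have "0 \<le> cut_density \<alpha> \<beta> p y" for y
    using assms(1)[of y] by (auto simp: cut_density_def indicator_def)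
  then show ?thesis by (subst integral_density) auto
qed

lemma one_cut_imp_cut_regular:
  assumes V: "confining V" and c: "one_cut \<alpha> \<beta> p V"
  shows "cut_regular 1 V"
proof -
  let ?\<mu> = "density lborel (\<lambda>x. ennreal (cut_density \<alpha> \<beta> p x))"
  have \<mu>: "equilibrium_measure V = ?\<mu>"
    using equilibrium_measure_eqI[OF V one_cut_minimizer[OF V c]] .
  have \<alpha>\<beta>: "\<alpha> < \<beta>" and p: "\<And>y. y \<in> {\<alpha>..\<beta>} \<Longrightarrow> 0 < poly p y"
    using c by (auto simp: one_cut_def)
  have S: "measure_support ?\<mu> = {\<alpha>..\<beta>}" by (rule support_cut_density[OF \<alpha>\<beta> p])
  obtain l where l: "\<And>x. x \<in> {\<alpha>..\<beta>} \<Longrightarrow> 2 * (\<integral>y. ln \<bar>x - y\<bar> \<partial>?\<mu>) - poly V x = l"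
    "\<And>x. x \<notin> {\<alpha>..\<beta>} \<Longrightarrow> 2 * (\<integral>y. ln \<bar>x - y\<bar> \<partial>?\<mu>) - poly V x < l"
    using c integral_cut_density[of \<alpha> \<beta> p, OF p] unfolding one_cut_def by auto
  have dens: "(\<lambda>x. ennreal (indicator {\<alpha>..\<beta>} x * (1 / 1) * sqrt \<bar>\<Prod>j<1::nat. (x - \<alpha>) * (x - \<beta>)\<bar> * \<bar>poly p x\<bar>))
     = (\<lambda>x. ennreal (cut_density \<alpha> \<beta> p x))"
  proof
    fix x
    show "ennreal (indicator {\<alpha>..\<beta>} x * (1 / 1) * sqrt \<bar>\<Prod>j<1::nat. (x - \<alpha>) * (x - \<beta>)\<bar> * \<bar>poly p x\<bar>)
     = ennreal (cut_density \<alpha> \<beta> p x)"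
    proof (cases "x \<in> {\<alpha>..\<beta>}")
      case True
      have "\<bar>(x - \<alpha>) * (x - \<beta>)\<bar> = (x - \<alpha>) * (\<beta> - x)" using True by (simp add: abs_mult)
      then show ?thesis using True p[OF True] by (simp add: cut_density_def lessThan_Suc)
    qed (simp add: cut_density_def)
  qed
  show ?thesis
    unfolding cut_regular_def \<mu> Let_def S
    by (rule exI[of _ "\<lambda>_. \<alpha>"], rule exI[of _ "\<lambda>_. \<beta>"], rule exI[of _ 1], rule exI[of _ p], rule exI[of _ l])
      (use \<alpha>\<beta> p l dens in \<open>auto simp: disjoint_family_on_def less_imp_neq[THEN not_sym]\<close>)
qed

lemma poly_sign_constant:
  fixes h :: "real poly"
  assumes "\<And>x. x \<in> {\<alpha>..\<beta>} \<Longrightarrow> poly h x \<noteq> 0" "\<alpha> \<le> \<beta>"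
  shows "(\<forall>x\<in>{\<alpha>..\<beta>}. 0 < poly h x) \<or> (\<forall>x\<in>{\<alpha>..\<beta>}. poly h x < 0)"
proof (rule ccontr)
  assume "\<not> ?thesis"
  then obtain x y where xy: "x \<in> {\<alpha>..\<beta>}" "poly h x \<le> 0" "y \<in> {\<alpha>..\<beta>}" "poly h y \<ge> 0"
    by (auto simp: not_less)
  have "connected ((\<lambda>x. poly h x) ` {\<alpha>..\<beta>})"
    by (intro connected_continuous_image continuous_intros) auto
  then have "0 \<in> (\<lambda>x. poly h x) ` {\<alpha>..\<beta>}"
    using xy unfolding connected_iff_interval by blast
  then show False using assms(1) by force
qed

lemma cut_regular_imp_one_cut:
  assumes V: "confining V" and c: "cut_regular 1 V"
  shows "\<exists>\<alpha> \<beta> p. one_cut \<alpha> \<beta> p V"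
proof -
  let ?\<mu> = "equilibrium_measure V"
  let ?S = "measure_support ?\<mu>"
  obtain A B :: "nat \<Rightarrow> real" and c h l where
    AB: "\<forall>j<1. A j < B j" and S: "?S = (\<Union>j<1::nat. {A j..B j})" and cpos: "c > (0::real)"
    and h: "\<forall>x\<in>?S. poly h x \<noteq> 0"
    and \<mu>: "?\<mu> = density lborel (\<lambda>x. ennreal (indicator ?S x * (1 / c) * sqrt \<bar>\<Prod>j<1::nat. (x - A j) * (x - B j)\<bar> * \<bar>poly h x\<bar>))"
    and l: "\<forall>x\<in>?S. 2 * (\<integral>y. ln \<bar>x - y\<bar> \<partial>?\<mu>) - poly V x = l"
      "\<forall>x. x \<notin> ?S \<longrightarrow> 2 * (\<integral>y. ln \<bar>x - y\<bar> \<partial>?\<mu>) - poly V x < l"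
    using c unfolding cut_regular_def Let_def by (elim exE conjE) (rule that; assumption)
  define \<alpha> \<beta> where "\<alpha> = A 0" and "\<beta> = B 0"
  have \<alpha>\<beta>: "\<alpha> < \<beta>" using AB by (simp add: \<alpha>_def \<beta>_def)
  have S': "?S = {\<alpha>..\<beta>}" unfolding S by (simp add: lessThan_Suc \<alpha>_def \<beta>_def)
  have "(\<forall>x\<in>{\<alpha>..\<beta>}. 0 < poly h x) \<or> (\<forall>x\<in>{\<alpha>..\<beta>}. poly h x < 0)"
    using h \<alpha>\<beta> unfolding S' by (intro poly_sign_constant) auto
  then have "\<exists>p. \<forall>x\<in>{\<alpha>..\<beta>}. poly p x = \<bar>poly h x\<bar> / c"
  proof (elim disjE)
    assume "\<forall>x\<in>{\<alpha>..\<beta>}. 0 < poly h x"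
    then show ?thesis by (intro exI[of _ "smult (1 / c) h"]) auto
  next
    assume "\<forall>x\<in>{\<alpha>..\<beta>}. poly h x < 0"
    then show ?thesis by (intro exI[of _ "smult (- 1 / c) h"]) auto
  qed
  then obtain p where p: "\<And>x. x \<in> {\<alpha>..\<beta>} \<Longrightarrow> poly p x = \<bar>poly h x\<bar> / c" by blast
  have p_pos: "0 < poly p x" if "x \<in> {\<alpha>..\<beta>}" for x
    using p[OF that] h that cpos unfolding S' by auto
  have \<mu>': "?\<mu> = density lborel (\<lambda>x. ennreal (cut_density \<alpha> \<beta> p x))"
  proof -
    have "(\<lambda>x. ennreal (indicator ?S x * (1 / c) * sqrt \<bar>\<Prod>j<1::nat. (x - A j) * (x - B j)\<bar> * \<bar>poly h x\<bar>))
      = (\<lambda>x. ennreal (cut_density \<alpha> \<beta> p x))"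
    proof
      fix x
      show "ennreal (indicator ?S x * (1 / c) * sqrt \<bar>\<Prod>j<1::nat. (x - A j) * (x - B j)\<bar> * \<bar>poly h x\<bar>)
        = ennreal (cut_density \<alpha> \<beta> p x)"
      proof (cases "x \<in> {\<alpha>..\<beta>}")
        case True
        have "\<bar>(x - \<alpha>) * (x - \<beta>)\<bar> = (x - \<alpha>) * (\<beta> - x)" using True by (simp add: abs_mult)
        then show ?thesis using True p[OF True] unfolding S'
          by (simp add: cut_density_def lessThan_Suc flip: \<alpha>_def \<beta>_def)
      qed (simp add: cut_density_def S')
    qed
    with \<mu> show ?thesis by simp
  qed
  \<comment> \<open>Regularity prescribes the shape of the density but not its mass; that the mass
    is one is inherited from the minimizer.\<close>
  have "real_distribution ?\<mu>"
    using equilibrium_measure_minimizer[OF V] by (simp add: is_energy_minimizer_def borel_prob_iff)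
  then interpret M: real_distribution ?\<mu> .
  have nonneg: "0 \<le> cut_density \<alpha> \<beta> p y" for y
    using p_pos[of y] by (auto simp: cut_density_def indicator_def)
  have int: "integrable lborel (cut_density \<alpha> \<beta> p)"
  proof -
    obtain R B where "bounded_density (cut_density \<alpha> \<beta> p) R B"
      using bounded_density_cut_density[of \<alpha> \<beta> p] p_pos by (auto simp: less_imp_le)
    then show ?thesis by (rule bounded_density.integrable_density)
  qed
  have "1 = emeasure ?\<mu> UNIV" using M.emeasure_space_1 by simp
  also have "\<dots> = (\<integral>\<^sup>+y. ennreal (cut_density \<alpha> \<beta> p y) \<partial>lborel)"
    by (subst \<mu>') (simp add: emeasure_density)
  also have "\<dots> = ennreal (\<integral>y. cut_density \<alpha> \<beta> p y \<partial>lborel)"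
    using int nonneg by (intro nn_integral_eq_integral) auto
  finally have "(\<integral>y. cut_density \<alpha> \<beta> p y \<partial>lborel) = 1"
    using nonneg by (simp add: ennreal_eq_1)
  moreover have "(\<integral>y. ln \<bar>x - y\<bar> \<partial>?\<mu>) = (\<integral>y. cut_density \<alpha> \<beta> p y * ln \<bar>x - y\<bar> \<partial>lborel)" for x
    by (subst \<mu>') (rule integral_cut_density[OF p_pos]; measurable)
  ultimately have "one_cut \<alpha> \<beta> p V"
    using \<alpha>\<beta> p_pos l unfolding one_cut_def S' by auto
  then show ?thesis by blast
qed

text \<open>The measure is pushed forward under \<open>y -> a * y + b\<close>: of
  \<open>1 / a^2\<close>, one factor is the Jacobian and one compensates the scaling of the square
  root. The potential changes by \<open>ln a\<close>, which together with \<open>k\<close> goes into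
  the Lagrange constant.\<close>

lemma one_cut_affine:
  assumes c: "one_cut \<alpha> \<beta> p V" and a: "a > 0"
  shows "one_cut (a * \<alpha> + b) (a * \<beta> + b) (smult (1 / a\<^sup>2) (p \<circ>\<^sub>p [:- b / a, 1 / a:])) (V \<circ>\<^sub>p [:- b / a, 1 / a:] + [:k:])"
proof -
  let ?\<alpha> = "a * \<alpha> + b" and ?\<beta> = "a * \<beta> + b" and ?p = "smult (1 / a\<^sup>2) (p \<circ>\<^sub>p [:- b / a, 1 / a:])"
  have \<alpha>\<beta>: "\<alpha> < \<beta>" and p: "\<And>y. y \<in> {\<alpha>..\<beta>} \<Longrightarrow> 0 < poly p y" and total: "(\<integral>y. cut_density \<alpha> \<beta> p y \<partial>lborel) = 1"
    using c by (auto simp: one_cut_def)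
  obtain l where l: "\<And>x. x \<in> {\<alpha>..\<beta>} \<Longrightarrow> 2 * (\<integral>y. cut_density \<alpha> \<beta> p y * ln \<bar>x - y\<bar> \<partial>lborel) - poly V x = l"
    "\<And>x. x \<notin> {\<alpha>..\<beta>} \<Longrightarrow> 2 * (\<integral>y. cut_density \<alpha> \<beta> p y * ln \<bar>x - y\<bar> \<partial>lborel) - poly V x < l"
    using c unfolding one_cut_def by blast
  obtain R B where "bounded_prob_density (cut_density \<alpha> \<beta> p) R B"
    using one_cut_bounded_prob_density[OF c] by blast
  then interpret F: bounded_prob_density "cut_density \<alpha> \<beta> p" R B .
  have mem: "b + a * y \<in> {?\<alpha>..?\<beta>} \<longleftrightarrow> y \<in> {\<alpha>..\<beta>}" for y
    using a by (simp add: add.commute)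
  have poly_aff: "poly (q \<circ>\<^sub>p [:- b / a, 1 / a:]) (b + a * y) = poly q y" for q y
    using a by (simp add: poly_pcompose field_simps)
  have dens: "cut_density ?\<alpha> ?\<beta> ?p (b + a * y) = cut_density \<alpha> \<beta> p y / a" for y
  proof -
    have "(b + a * y - ?\<alpha>) * (?\<beta> - (b + a * y)) = a\<^sup>2 * ((y - \<alpha>) * (\<beta> - y))"
      by (simp add: power2_eq_square algebra_simps)
    then have "sqrt ((b + a * y - ?\<alpha>) * (?\<beta> - (b + a * y))) = a * sqrt ((y - \<alpha>) * (\<beta> - y))"
      using a by (simp only: real_sqrt_mult real_sqrt_abs abs_of_pos)
    moreover have "indicator {?\<alpha>..?\<beta>} (b + a * y) = (indicator {\<alpha>..\<beta>} y :: real)"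
      using mem[of y] by (simp only: indicator_def)
    ultimately show ?thesis
      using a unfolding cut_density_def poly_smult poly_aff by (simp add: power2_eq_square)
  qed
  have sub: "(\<integral>z. cut_density ?\<alpha> ?\<beta> ?p z * g z \<partial>lborel) = (\<integral>y. cut_density \<alpha> \<beta> p y * g (b + a * y) \<partial>lborel)"
    for g :: "real \<Rightarrow> real"
  proof -
    have "(\<integral>z. cut_density ?\<alpha> ?\<beta> ?p z * g z \<partial>lborel)
      = \<bar>a\<bar> *\<^sub>R (\<integral>y. cut_density ?\<alpha> ?\<beta> ?p (b + a * y) * g (b + a * y) \<partial>lborel)"
      using a by (intro lborel_integral_real_affine) auto
    also have "\<dots> = (\<integral>y. a * (cut_density ?\<alpha> ?\<beta> ?p (b + a * y) * g (b + a * y)) \<partial>lborel)"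
      using a by simp
    also have "\<dots> = (\<integral>y. cut_density \<alpha> \<beta> p y * g (b + a * y) \<partial>lborel)"
      unfolding dens using a by (intro Bochner_Integration.integral_cong) auto
    finally show ?thesis .
  qed
  have total': "(\<integral>y. cut_density ?\<alpha> ?\<beta> ?p y \<partial>lborel) = 1"
    using sub[of "\<lambda>_. 1"] total by simp
  have pot: "(\<integral>z. cut_density ?\<alpha> ?\<beta> ?p z * ln \<bar>b + a * x - z\<bar> \<partial>lborel)
    = ln a + (\<integral>y. cut_density \<alpha> \<beta> p y * ln \<bar>x - y\<bar> \<partial>lborel)" for x
  proof -
    have "(\<integral>z. cut_density ?\<alpha> ?\<beta> ?p z * ln \<bar>b + a * x - z\<bar> \<partial>lborel)
      = (\<integral>y. cut_density \<alpha> \<beta> p y * ln \<bar>b + a * x - (b + a * y)\<bar> \<partial>lborel)" by (rule sub)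
    also have "\<dots> = (\<integral>y. cut_density \<alpha> \<beta> p y * ln a + cut_density \<alpha> \<beta> p y * ln \<bar>x - y\<bar> \<partial>lborel)"
    proof (rule integral_cong_AE)
      show "AE y in lborel. cut_density \<alpha> \<beta> p y * ln \<bar>b + a * x - (b + a * y)\<bar>
        = cut_density \<alpha> \<beta> p y * ln a + cut_density \<alpha> \<beta> p y * ln \<bar>x - y\<bar>"
        using AE_lborel_singleton[of x]
      proof eventually_elim
        case (elim y)
        have "\<bar>b + a * x - (b + a * y)\<bar> = a * \<bar>x - y\<bar>"
          using a by (simp add: abs_mult_pos' flip: right_diff_distrib)
        then have "ln \<bar>b + a * x - (b + a * y)\<bar> = ln a + ln \<bar>x - y\<bar>"
          using a elim by (simp add: ln_mult_pos)
        then show ?case by (simp only: distrib_left)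
      qed
    qed measurable
    also have "\<dots> = ln a + (\<integral>y. cut_density \<alpha> \<beta> p y * ln \<bar>x - y\<bar> \<partial>lborel)"
      using F.integrable_density F.integrable_log[of x] total by simp
    finally show ?thesis .
  qed
  have repr: "\<exists>y. x = b + a * y" for x
    using a by (intro exI[of _ "(x - b) / a"]) simp
  have "?\<alpha> < ?\<beta>" using \<alpha>\<beta> a by simp
  moreover have "0 < poly ?p x" if "x \<in> {?\<alpha>..?\<beta>}" for x
  proof -
    obtain y where y: "x = b + a * y" using repr by blast
    show ?thesis using that a p[of y] unfolding y mem poly_smult poly_aff by simp
  qed
  moreover have "2 * (\<integral>z. cut_density ?\<alpha> ?\<beta> ?p z * ln \<bar>x - z\<bar> \<partial>lborel) - poly (V \<circ>\<^sub>p [:- b / a, 1 / a:] + [:k:]) x = l + 2 * ln a - k"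
    if "x \<in> {?\<alpha>..?\<beta>}" for x
  proof -
    obtain y where y: "x = b + a * y" using repr by blast
    show ?thesis using that l(1)[of y] unfolding y mem poly_add poly_aff pot by simp
  qed
  moreover have "2 * (\<integral>z. cut_density ?\<alpha> ?\<beta> ?p z * ln \<bar>x - z\<bar> \<partial>lborel) - poly (V \<circ>\<^sub>p [:- b / a, 1 / a:] + [:k:]) x < l + 2 * ln a - k"
    if "x \<notin> {?\<alpha>..?\<beta>}" for x
  proof -
    obtain y where y: "x = b + a * y" using repr by blast
    show ?thesis using that l(2)[of y] unfolding y mem poly_add poly_aff pot by simp
  qed
  ultimately show ?thesis using total' unfolding one_cut_def by blast
qed

text \<open>Equal endpoints mean that the square root factor is shared, so mixing the measures
  amounts to mixing \<open>p\<close> and \<open>q\<close>, and equality and strict inequality hold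
  on the same sets for both potentials.\<close>

lemma one_cut_convex:
  assumes c: "one_cut \<alpha> \<beta> p V" and d: "one_cut \<alpha> \<beta> q W" and s: "0 \<le> s" "s \<le> 1"
  shows "one_cut \<alpha> \<beta> (smult (1 - s) p + smult s q) (smult (1 - s) V + smult s W)"
proof -
  let ?p = "smult (1 - s) p + smult s q"
  obtain R B where "bounded_prob_density (cut_density \<alpha> \<beta> p) R B"
    using one_cut_bounded_prob_density[OF c] by blast
  then interpret F: bounded_prob_density "cut_density \<alpha> \<beta> p" R B .
  obtain R' B' where "bounded_prob_density (cut_density \<alpha> \<beta> q) R' B'"
    using one_cut_bounded_prob_density[OF d] by blast
  then interpret G: bounded_prob_density "cut_density \<alpha> \<beta> q" R' B' .
  obtain l where l: "\<And>x. x \<in> {\<alpha>..\<beta>} \<Longrightarrow> 2 * (\<integral>y. cut_density \<alpha> \<beta> p y * ln \<bar>x - y\<bar> \<partial>lborel) - poly V x = l"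
    "\<And>x. x \<notin> {\<alpha>..\<beta>} \<Longrightarrow> 2 * (\<integral>y. cut_density \<alpha> \<beta> p y * ln \<bar>x - y\<bar> \<partial>lborel) - poly V x < l"
    using c unfolding one_cut_def by blast
  obtain l' where l': "\<And>x. x \<in> {\<alpha>..\<beta>} \<Longrightarrow> 2 * (\<integral>y. cut_density \<alpha> \<beta> q y * ln \<bar>x - y\<bar> \<partial>lborel) - poly W x = l'"
    "\<And>x. x \<notin> {\<alpha>..\<beta>} \<Longrightarrow> 2 * (\<integral>y. cut_density \<alpha> \<beta> q y * ln \<bar>x - y\<bar> \<partial>lborel) - poly W x < l'"
    using d unfolding one_cut_def by blast
  \<comment> \<open>At \<open>s = 0\<close> or \<open>s = 1\<close> one summand vanishes, and
    strictness has to come from the other.\<close>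
  have pos: "0 < (1 - s) * u + s * v" if "0 < u" "0 < v" for u v :: real
    using that s by (cases "s = 0") (auto intro: add_nonneg_pos)
  have dens: "cut_density \<alpha> \<beta> ?p y = (1 - s) * cut_density \<alpha> \<beta> p y + s * cut_density \<alpha> \<beta> q y" for y
    by (simp add: cut_density_def algebra_simps)
  have total: "(\<integral>y. cut_density \<alpha> \<beta> ?p y \<partial>lborel) = 1"
    unfolding dens using F.integrable_density G.integrable_density F.total G.total by simp
  have "(\<integral>y. cut_density \<alpha> \<beta> ?p y * ln \<bar>x - y\<bar> \<partial>lborel)
    = (\<integral>y. (1 - s) * (cut_density \<alpha> \<beta> p y * ln \<bar>x - y\<bar>) + s * (cut_density \<alpha> \<beta> q y * ln \<bar>x - y\<bar>) \<partial>lborel)" for x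
    unfolding dens by (simp add: distrib_right mult.assoc)
  then have pot: "2 * (\<integral>y. cut_density \<alpha> \<beta> ?p y * ln \<bar>x - y\<bar> \<partial>lborel) - poly (smult (1 - s) V + smult s W) x
    = (1 - s) * (2 * (\<integral>y. cut_density \<alpha> \<beta> p y * ln \<bar>x - y\<bar> \<partial>lborel) - poly V x)
      + s * (2 * (\<integral>y. cut_density \<alpha> \<beta> q y * ln \<bar>x - y\<bar> \<partial>lborel) - poly W x)" for x
    using F.integrable_log[of x] G.integrable_log[of x] by (simp add: algebra_simps)
  have "2 * (\<integral>y. cut_density \<alpha> \<beta> ?p y * ln \<bar>x - y\<bar> \<partial>lborel) - poly (smult (1 - s) V + smult s W) x = (1 - s) * l + s * l'"
    if "x \<in> {\<alpha>..\<beta>}" for x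
    unfolding pot using l(1)[OF that] l'(1)[OF that] by simp
  moreover have "2 * (\<integral>y. cut_density \<alpha> \<beta> ?p y * ln \<bar>x - y\<bar> \<partial>lborel) - poly (smult (1 - s) V + smult s W) x < (1 - s) * l + s * l'"
    if "x \<notin> {\<alpha>..\<beta>}" for x
    unfolding pot
    using pos[of "l - (2 * (\<integral>y. cut_density \<alpha> \<beta> p y * ln \<bar>x - y\<bar> \<partial>lborel) - poly V x)"
        "l' - (2 * (\<integral>y. cut_density \<alpha> \<beta> q y * ln \<bar>x - y\<bar> \<partial>lborel) - poly W x)"] l(2)[OF that] l'(2)[OF that]
    by (simp add: right_diff_distrib)
  moreover have "0 < poly ?p y" if "y \<in> {\<alpha>..\<beta>}" for y
    using c d that pos by (simp add: one_cut_def)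
  moreover have "\<alpha> < \<beta>" using c by (simp add: one_cut_def)
  ultimately show ?thesis using total unfolding one_cut_def by blast
qed

lemma one_cut_semicircle: "one_cut (-2) 2 [:1 / (2 * pi):] [:0, 0, 1/2:]"
proof -
  have q: "poly [:0, 0, 1/2:] x = x\<^sup>2 / 2" for x :: real by (simp add: power2_eq_square)
  have "2 * semicircle_potential x - x\<^sup>2 / 2 = -1" if "x \<in> {-2..2}" for x
    using semicircle_Euler_Lagrange(1)[of x] that by (simp add: abs_le_iff)
  moreover have "2 * semicircle_potential x - x\<^sup>2 / 2 < -1" if "x \<notin> {-2..2}" for x
    using semicircle_Euler_Lagrange(2)[of x] that by (auto simp: not_le)
  ultimately show ?thesis
    unfolding one_cut_def q using semicircle_total unfolding semicircle_potential_def by fastforce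
qed

section \<open>Degrees and coefficients of the potentials on the path\<close>

lemma confining_of_P_set: "V \<in> P_set m \<Longrightarrow> confining V"
proof -
  assume V: "V \<in> P_set m"
  \<comment> \<open>A constant that vanishes at 0 is the zero polynomial, whose leading coefficient
    is not positive.\<close>
  have "degree V \<noteq> 0"
  proof
    assume "degree V = 0"
    then obtain v where "V = [:v:]" by (rule degree_eq_zeroE)
    with V show False by (auto simp: P_set_def)
  qed
  with V show ?thesis by (auto simp: P_set_def confining_def elim!: evenE)
qed

text \<open>Two positive leading coefficients cannot cancel, so the larger degree wins. Unequal
  degrees occur when \<open>x^2/2\<close> is mixed with a potential of higher degree.\<close>

lemma confining_add:
  assumes "confining V" "confining W" "degree V \<le> m" "degree W \<le> m"
  shows "confining (V + W) \<and> degree (V + W) \<le> m"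
proof -
  consider "degree V < degree W" | "degree W < degree V" | "degree V = degree W" by linarith
  then show ?thesis
  proof cases
    case 1
    then show ?thesis using assms by (simp add: confining_def degree_add_eq_right coeff_eq_0)
  next
    case 2
    then show ?thesis using assms by (simp add: confining_def degree_add_eq_left coeff_eq_0)
  next
    case 3
    have c: "coeff (V + W) (degree V) > 0" using assms(1,2) 3 by (simp add: confining_def)
    then have "degree V \<le> degree (V + W)" by (intro le_degree) auto
    moreover have "degree (V + W) \<le> degree V" using 3 degree_add_le_max[of V W] by simp
    ultimately have "degree (V + W) = degree V" by simp
    then show ?thesis using assms c by (simp add: confining_def)
  qed
qed

lemma confining_smult: "confining V \<Longrightarrow> 0 < c \<Longrightarrow> confining (smult c V)"
  by (simp add: confining_def)

lemma confining_affine: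
  assumes "confining V" "0 < v"
  shows "confining (V \<circ>\<^sub>p [:u, v:] + [:k:])" "degree (V \<circ>\<^sub>p [:u, v:] + [:k:]) = degree V"
proof -
  have d: "degree (V \<circ>\<^sub>p [:u, v:]) = degree V" using assms(2) by (simp add: degree_pcompose)
  have l: "lead_coeff (V \<circ>\<^sub>p [:u, v:]) = lead_coeff V * v ^ degree V"
    using assms(2) by (subst lead_coeff_comp) auto
  have d2: "degree [:k:] < degree (V \<circ>\<^sub>p [:u, v:])" using assms(1) d by (simp add: confining_def)
  show d': "degree (V \<circ>\<^sub>p [:u, v:] + [:k:]) = degree V" using degree_add_eq_left[OF d2] d by simp
  have "coeff [:k:] (degree V) = 0" using d2 d by (intro coeff_eq_0) simp
  then have "lead_coeff (V \<circ>\<^sub>p [:u, v:] + [:k:]) = lead_coeff V * v ^ degree V"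
    unfolding d' using l d by simp
  then show "confining (V \<circ>\<^sub>p [:u, v:] + [:k:])"
    using assms d' by (simp add: confining_def)
qed

text \<open>The source of continuity of the path: by Horner's scheme each coefficient is a
  polynomial expression in \<open>u\<close> and \<open>v\<close>.\<close>

lemma continuous_on_coeff_pcompose:
  fixes u v :: "real \<Rightarrow> real"
  assumes "continuous_on S u" "continuous_on S v"
  shows "continuous_on S (\<lambda>s. coeff (p \<circ>\<^sub>p [:u s, v s:]) j)"
proof (induction p arbitrary: j)
  case (pCons c p)
  show ?case
    by (cases j) (auto simp: pcompose_pCons coeff_pCons intro!: continuous_intros assms pCons.IH)
qed simp

lemma coeff_V_t: "coeff (V_t m t) i = (if i = 2 then 1/2 else 0) + (if i \<in> {1..m} then t i else 0)"
proof -
  have "coeff (V_t m t) i = coeff [:0, 0, 1/2:] i + (\<Sum>j=1..m. if j = i then t j else 0)"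
    by (simp add: V_t_def coeff_sum)
  also have "coeff [:0, 0, 1/2:] i = (if i = 2 then 1/2 else (0::real))"
    by (auto simp: coeff_pCons split: nat.splits)
  also have "(\<Sum>j=1..m. if j = i then t j else 0) = (if i \<in> {1..m} then t i else 0)"
    by (subst sum.delta) auto
  finally show ?thesis .
qed

lemma V_t_eqI:
  assumes "degree W \<le> m" "poly W 0 = 0" "2 \<le> m"
    and "\<And>j. j \<in> {1..m} \<Longrightarrow> t j = coeff W j - (if j = 2 then 1/2 else 0)"
  shows "V_t m t = W"
proof (rule poly_eqI)
  fix i
  consider "i = 0" | "i \<in> {1..m}" | "i > m" by fastforce
  then show "coeff (V_t m t) i = coeff W i"
  proof cases
    case 1
    then show ?thesis using assms(2) by (simp add: coeff_V_t poly_0_coeff_0)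
  next
    case 2
    then show ?thesis using assms(4)[OF 2] by (simp add: coeff_V_t)
  next
    \<comment> \<open>Above \<open>m\<close> the quadratic term of \<open>V_t\<close> must not
      appear, which is where \<open>2 \<le> m\<close> enters.\<close>
    case 3
    then have "coeff W i = 0" using assms(1) by (intro coeff_eq_0) simp
    then show ?thesis using 3 assms(3) by (simp add: coeff_V_t)
  qed
qed

theorem theorem2p3:
  fixes m :: nat and t :: "nat \<Rightarrow> real"
  assumes "m \<ge> 2"
    and "V_t m t \<in> P_reg m 1"
  shows "\<exists>tp :: real \<Rightarrow> nat \<Rightarrow> real.
           (\<forall>j\<in>{1..m}. continuous_on {0..1} (\<lambda>\<tau>. tp \<tau> j)) \<and>
           (\<forall>j\<in>{1..m}. tp 0 j = 0 \<and> tp 1 j = t j) \<and>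
           (\<forall>\<tau>\<in>{0..1}. V_t m (tp \<tau>) \<in> P_reg m 1)"
proof -
  define V where "V = V_t m t"
  define G :: "real poly" where "G = [:0, 0, 1/2:]"
  have V: "V \<in> P_set m" and reg: "cut_regular 1 V" using assms(2) by (auto simp: V_def P_reg_def)
  have cV: "confining V" and dV: "degree V \<le> m" using V confining_of_P_set by (auto simp: P_set_def)
  have cG: "confining G" and dG: "degree G \<le> m" using assms(1) by (auto simp: G_def confining_def)
  obtain \<alpha> \<beta> p where oc: "one_cut \<alpha> \<beta> p V" using cut_regular_imp_one_cut[OF cV reg] by blast
  \<comment> \<open>The map \<open>x -> a * x + b\<close> takes \<open>[-2, 2]\<close> onto the
    support of the equilibrium measure of \<open>V\<close>.\<close>
  define a b where "a = (\<beta> - \<alpha>) / 4" and "b = (\<alpha> + \<beta>) / 2"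
  have a: "a > 0" using oc by (simp add: a_def one_cut_def)
  define U where "U = V \<circ>\<^sub>p [:b, a:]"
  have ocU: "\<exists>p. one_cut (-2) 2 p U"
  proof -
    have "1 / a * \<alpha> + - b / a = -2" "1 / a * \<beta> + - b / a = 2"
      using a by (auto simp: divide_simps) (auto simp: a_def b_def field_simps)
    moreover have "[:- (- b / a) / (1 / a), 1 / (1 / a):] = [:b, a:]" using a by simp
    ultimately show ?thesis
      using one_cut_affine[OF oc, of "1 / a" "- b / a" 0] a unfolding U_def by auto
  qed
  have cU: "confining U" and dU: "degree U \<le> m"
    using confining_affine[OF cV a, of b 0] dV by (auto simp: U_def)
  \<comment> \<open>Scale and centre move linearly from \<open>(1, 0)\<close> to
    \<open>(a, b)\<close>, so the support at time \<open>s\<close> is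
    \<open>[B s - 2 * A s, B s + 2 * A s]\<close>; \<open>A s\<close> stays positive as a mixture of
    \<open>1\<close> and \<open>a\<close>.\<close>
  define A B where "A s = 1 - s + s * a" and "B s = s * b" for s :: real
  have A: "A s > 0" if "s \<in> {0..1}" for s
    using that a by (cases "s = 0") (auto simp: A_def intro: add_nonneg_pos)
  define X where "X s = smult (1 - s) G + smult s U" for s
  \<comment> \<open>The added constant restores the value 0 at the origin that \<open>P_set\<close>
    demands; it only shifts the Lagrange constant.\<close>
  define W where "W s = X s \<circ>\<^sub>p [:- B s / A s, 1 / A s:] + [:- poly (X s) (- B s / A s):]" for s
  define tp where "tp s j = coeff (W s) j - (if j = 2 then 1/2 else 0)" for s j
  have cX: "confining (X s) \<and> degree (X s) \<le> m" if s: "s \<in> {0..1}" for s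
  proof -
    \<comment> \<open>At the ends one summand is the zero polynomial, which is not confining, so
      \<open>confining_add\<close> covers only the interior.\<close>
    consider "s = 0" | "s = 1" | "0 < s" "s < 1" using s by fastforce
    then show ?thesis
    proof cases
      case 3
      then show ?thesis
        unfolding X_def using cG cU dG dU by (intro confining_add confining_smult) auto
    qed (use cG cU dG dU in \<open>auto simp: X_def\<close>)
  qed
  have W0: "poly (W s) 0 = 0" for s by (simp add: W_def poly_pcompose)
  have cW: "confining (W s)" "degree (W s) \<le> m" if s: "s \<in> {0..1}" for s
    using confining_affine[of "X s" "1 / A s"] cX[OF s] A[OF s] by (auto simp: W_def)
  have ocW: "cut_regular 1 (W s)" if s: "s \<in> {0..1}" for s
  proof -
    obtain q where "one_cut (-2) 2 q U" using ocU by blast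
    then have "one_cut (-2) 2 (smult (1 - s) [:1 / (2 * pi):] + smult s q) (X s)"
      unfolding X_def G_def using s by (intro one_cut_convex one_cut_semicircle) auto
    from one_cut_affine[OF this A[OF s], of "B s" "- poly (X s) (- B s / A s)"]
    show ?thesis using cW(1)[OF s] unfolding W_def[symmetric] by (rule one_cut_imp_cut_regular[rotated])
  qed
  have "V_t m (tp s) = W s" if s: "s \<in> {0..1}" for s
    using cW(2)[OF s] W0 assms(1) by (rule V_t_eqI) (simp add: tp_def)
  moreover have "W s \<in> P_reg m 1" if s: "s \<in> {0..1}" for s
    using cW[OF s] ocW[OF s] W0[of s] by (simp add: P_reg_def P_set_def confining_def)
  ultimately have path: "\<forall>\<tau>\<in>{0..1}. V_t m (tp \<tau>) \<in> P_reg m 1" by simp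
  have "X 0 = G" "A 0 = 1" "B 0 = 0" by (simp_all add: X_def A_def B_def)
  then have "W 0 = G"
    by (simp add: W_def G_def pcompose_idR)
  then have start: "tp 0 j = 0" for j
    by (auto simp: tp_def G_def coeff_pCons split: nat.splits)
  have "W 1 = V"
  proof -
    have "X 1 = U" "A 1 = a" "B 1 = b" by (simp_all add: X_def A_def B_def)
    moreover have "U \<circ>\<^sub>p [:- b / a, 1 / a:] = V"
    proof -
      have "[:b, a:] \<circ>\<^sub>p [:- b / a, 1 / a:] = [:0, 1:]"
        using a by (simp add: pcompose_pCons)
      then show ?thesis unfolding U_def pcompose_assoc[symmetric] by (simp add: pcompose_idR)
    qed
    \<comment> \<open>This is the value of \<open>V\<close> at 0, so the added constant vanishes at
      the end of the path.\<close>
    moreover have "poly U (- b / a) = 0"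
      using a V by (simp add: U_def poly_pcompose P_set_def)
    ultimately show ?thesis by (simp add: W_def)
  qed
  then have finish: "tp 1 j = t j" if "j \<in> {1..m}" for j
    using that by (simp add: tp_def V_def coeff_V_t)
  have cont: "continuous_on {0..1} (\<lambda>s. tp s j)" if j: "j \<in> {1..m}" for j
  proof -
    have AB: "continuous_on {0..1} (\<lambda>s. - B s / A s)" "continuous_on {0..1} (\<lambda>s. 1 / A s)"
    proof -
      have "continuous_on {0..1} A" "continuous_on {0..1} B"
        unfolding A_def B_def by (intro continuous_intros)+
      moreover have "\<forall>s\<in>{0..1}. A s \<noteq> 0" using A by force
      ultimately show "continuous_on {0..1} (\<lambda>s. - B s / A s)" "continuous_on {0..1} (\<lambda>s. 1 / A s)"
        by (auto intro!: continuous_intros)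
    qed
    \<comment> \<open>For a positive index the additive constant in \<open>W s\<close> does not
      contribute, so only the coefficients of the two compositions have to be continuous.\<close>
    obtain i where i: "j = Suc i" using j by (cases j) auto
    have "tp s j = (1 - s) * coeff (G \<circ>\<^sub>p [:- B s / A s, 1 / A s:]) j
      + s * coeff (U \<circ>\<^sub>p [:- B s / A s, 1 / A s:]) j - (if j = 2 then 1/2 else 0)" for s
      by (simp add: tp_def W_def X_def pcompose_add pcompose_smult i)
    then show ?thesis
      by (simp only:) (intro continuous_intros continuous_on_coeff_pcompose AB)
  qed
  show ?thesis
    using cont start finish path by (intro exI[of _ tp]) blast
qed

end
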